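(* Let $N=(G,+,<)$ be elementarily equivalent to an archimedean ordered abelian group with small quotients, and let $M$ be a reduct of $N$ (not necessarily a $0$-reduct) that expands $(G,+)$. Suppose that one of the following holds: (1) $M$ is stable, or (2) every unary subset $D\subseteq G$ that is definable in $M$ is also definable in $(G,+)$. Then $M$ is interdefinable with $(G,+)$.
   Context: "Definable" without a specified parameter set means definable with parameters from the structure. For structures $M,N$ with the same universe and a subset $A$ of that universe, $M$ is an $A$-reduct of $N$ (equivalently $N$ is an $A$-expansion of $M$) if every $X\subseteq M^k$ (any $k$) that is $\emptyset$-definable in $M$ is $A$-definable in $N$. When $A$ is the whole universe one says reduct/expansion; when $A=\emptyset$ one says $0$-reduct/$0$-expansion. $M$ and $N$ are interdefinable if each is a reduct of the other. A structure expands $(G,+)$ if it is an expansion of the structure $(G,+)$. An ordered abelian group is an abelian group with a linear order $<$ such that $a<b$ implies $a+c<b+c$. It is archimedean if for every $a,b\in G$ with $a\neq 0$ there is $n\in\mathbb{Z}$ with $b<na$. An abelian group $(G,+)$ has small quotients if for all $1\le n<\omega$ the index $[G:nG]$ is finite. *)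

theory Defs
  imports Main
begin

section \<open>First-order structures and formulas\<close>

text \<open>
  The universe of a structure is the whole type \<^typ>\<open>'a\<close>. The symbols of its language are the
  elements of \<open>funs\<close> and \<open>rels\<close>, each paired with its arity; both sets may be empty or infinite.
  Values of \<open>fun_of\<close> and \<open>rel_of\<close> at other symbols or at lists of the wrong length are irrelevant,
  because only well-formed formulas are ever considered.
\<close>

record ('f, 'r, 'a) fo_structure =
  funs :: "('f \<times> nat) set"
  rels :: "('r \<times> nat) set"
  fun_of :: "'f \<Rightarrow> 'a list \<Rightarrow> 'a"
  rel_of :: "'r \<Rightarrow> 'a list \<Rightarrow> bool"

text \<open>Variables are de Bruijn indices: \<open>Exists\<close> binds index 0 of its body.\<close>

datatype 'f trm = Var nat | Fn 'f "'f trm list"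

datatype ('f, 'r) form =
    Eq "'f trm" "'f trm"
  | Rel 'r "'f trm list"
  | Neg "('f, 'r) form"
  | Conj "('f, 'r) form" "('f, 'r) form"
  | Exists "('f, 'r) form"

primrec fv_trm :: "'f trm \<Rightarrow> nat set" where
  "fv_trm (Var i) = {i}"
| "fv_trm (Fn f ts) = \<Union> (set (map fv_trm ts))"

primrec fv :: "('f, 'r) form \<Rightarrow> nat set" where
  "fv (Eq s t) = fv_trm s \<union> fv_trm t"
| "fv (Rel r ts) = (\<Union>t\<in>set ts. fv_trm t)"
| "fv (Neg \<phi>) = fv \<phi>"
| "fv (Conj \<phi> \<psi>) = fv \<phi> \<union> fv \<psi>"
| "fv (Exists \<phi>) = {i. Suc i \<in> fv \<phi>}"

primrec wf_trm :: "('f, 'r, 'a) fo_structure \<Rightarrow> 'f trm \<Rightarrow> bool" where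
  "wf_trm M (Var i) \<longleftrightarrow> True"
| "wf_trm M (Fn f ts) \<longleftrightarrow> (f, length ts) \<in> funs M \<and> list_all (\<lambda>b. b) (map (wf_trm M) ts)"

primrec wf_form :: "('f, 'r, 'a) fo_structure \<Rightarrow> ('f, 'r) form \<Rightarrow> bool" where
  "wf_form M (Eq s t) \<longleftrightarrow> wf_trm M s \<and> wf_trm M t"
| "wf_form M (Rel r ts) \<longleftrightarrow> (r, length ts) \<in> rels M \<and> (\<forall>t\<in>set ts. wf_trm M t)"
| "wf_form M (Neg \<phi>) \<longleftrightarrow> wf_form M \<phi>"
| "wf_form M (Conj \<phi> \<psi>) \<longleftrightarrow> wf_form M \<phi> \<and> wf_form M \<psi>"
| "wf_form M (Exists \<phi>) \<longleftrightarrow> wf_form M \<phi>"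

primrec val :: "('f, 'r, 'a) fo_structure \<Rightarrow> (nat \<Rightarrow> 'a) \<Rightarrow> 'f trm \<Rightarrow> 'a" where
  "val M e (Var i) = e i"
| "val M e (Fn f ts) = fun_of M f (map (val M e) ts)"

primrec sat :: "('f, 'r, 'a) fo_structure \<Rightarrow> (nat \<Rightarrow> 'a) \<Rightarrow> ('f, 'r) form \<Rightarrow> bool" where
  "sat M e (Eq s t) \<longleftrightarrow> val M e s = val M e t"
| "sat M e (Rel r ts) \<longleftrightarrow> rel_of M r (map (val M e) ts)"
| "sat M e (Neg \<phi>) \<longleftrightarrow> \<not> sat M e \<phi>"
| "sat M e (Conj \<phi> \<psi>) \<longleftrightarrow> sat M e \<phi> \<and> sat M e \<psi>"
| "sat M e (Exists \<phi>) \<longleftrightarrow> (\<exists>a. sat M (case_nat a e) \<phi>)"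

definition elementarily_equivalent ::
    "('f, 'r, 'a) fo_structure \<Rightarrow> ('f, 'r, 'b) fo_structure \<Rightarrow> bool" where
  "elementarily_equivalent M N \<longleftrightarrow>
     funs M = funs N \<and> rels M = rels N \<and>
     (\<forall>\<phi>. wf_form M \<phi> \<and> fv \<phi> = {} \<longrightarrow> ((\<forall>e. sat M e \<phi>) \<longleftrightarrow> (\<forall>e. sat N e \<phi>)))"


section \<open>Definable sets, reducts, stability\<close>

text \<open>
  Subsets of the \<open>k\<close>-th power of the universe are sets of lists of length \<open>k\<close>. The variables
  below \<open>k\<close> stand for the coordinates of the point, the following ones for the parameters \<open>bs\<close>.
\<close>

definition definable ::
    "('f, 'r, 'a) fo_structure \<Rightarrow> 'a set \<Rightarrow> nat \<Rightarrow> 'a list set \<Rightarrow> bool" where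
  "definable M A k X \<longleftrightarrow>
     (\<exists>\<phi> bs. wf_form M \<phi> \<and> set bs \<subseteq> A \<and> fv \<phi> \<subseteq> {..<k + length bs} \<and>
        X = {xs. length xs = k \<and> sat M ((!) (xs @ bs)) \<phi>})"

definition reduct_over ::
    "'a set \<Rightarrow> ('f, 'r, 'a) fo_structure \<Rightarrow> ('g, 's, 'a) fo_structure \<Rightarrow> bool" where
  "reduct_over A M N \<longleftrightarrow> (\<forall>k X. definable M {} k X \<longrightarrow> definable N A k X)"

abbreviation reduct ::
    "('f, 'r, 'a) fo_structure \<Rightarrow> ('g, 's, 'a) fo_structure \<Rightarrow> bool" where
  "reduct M N \<equiv> reduct_over UNIV M N"

abbreviation expands ::
    "('f, 'r, 'a) fo_structure \<Rightarrow> ('g, 's, 'a) fo_structure \<Rightarrow> bool" where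
  "expands M N \<equiv> reduct N M"

definition interdefinable ::
    "('f, 'r, 'a) fo_structure \<Rightarrow> ('g, 's, 'a) fo_structure \<Rightarrow> bool" where
  "interdefinable M N \<longleftrightarrow> reduct M N \<and> reduct N M"

text \<open>
  An \<open>n\<close>-ladder for a formula whose free variables are split into a group of \<open>p\<close> and a group
  of \<open>q\<close> variables. Stability is a property of the complete theory of \<open>M\<close>: every formula
  (without parameters, with arbitrary splitting) has a bound on the length of its ladders.
  For each \<open>n\<close>, having an \<open>n\<close>-ladder is expressed by a single sentence, so it does
  not matter in which model of the theory of \<open>M\<close> ladders are sought.
\<close>

definition has_ladder ::
    "('f, 'r, 'a) fo_structure \<Rightarrow> ('f, 'r) form \<Rightarrow> nat \<Rightarrow> nat \<Rightarrow> nat \<Rightarrow> bool" where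
  "has_ladder M \<phi> p q n \<longleftrightarrow>
     (\<exists>a b :: nat \<Rightarrow> 'a list.
        (\<forall>i<n. length (a i) = p \<and> length (b i) = q) \<and>
        (\<forall>i<n. \<forall>j<n. sat M ((!) (a i @ b j)) \<phi> \<longleftrightarrow> i < j))"

definition stable :: "('f, 'r, 'a) fo_structure \<Rightarrow> bool" where
  "stable M \<longleftrightarrow>
     (\<forall>\<phi> p q. wf_form M \<phi> \<and> fv \<phi> \<subseteq> {..<p + q} \<longrightarrow> (\<exists>n. \<not> has_ladder M \<phi> p q n))"


section \<open>Ordered abelian groups\<close>

datatype oag_fun = Plus
datatype oag_rel = Less

definition group_structure :: "(oag_fun, oag_rel, 'a::ab_group_add) fo_structure" where
  "group_structure =
     \<lparr>funs = {(Plus, 2)}, rels = {},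
      fun_of = (\<lambda>_ xs. xs ! 0 + xs ! 1), rel_of = (\<lambda>_ _. False)\<rparr>"

definition oag_structure :: "(oag_fun, oag_rel, 'a::linordered_ab_group_add) fo_structure" where
  "oag_structure =
     \<lparr>funs = {(Plus, 2)}, rels = {(Less, 2)},
      fun_of = (\<lambda>_ xs. xs ! 0 + xs ! 1), rel_of = (\<lambda>_ xs. xs ! 0 < xs ! 1)\<rparr>"

definition nat_mult :: "nat \<Rightarrow> 'a::ab_group_add \<Rightarrow> 'a" where
  "nat_mult n a = (\<Sum>i<n. a)"

definition int_mult :: "int \<Rightarrow> 'a::ab_group_add \<Rightarrow> 'a" where
  "int_mult n a = (if 0 \<le> n then nat_mult (nat n) a else - nat_mult (nat (- n)) a)"

definition archimedean_group :: "'a::linordered_ab_group_add itself \<Rightarrow> bool" where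
  "archimedean_group _ \<longleftrightarrow> (\<forall>a b :: 'a. a \<noteq> 0 \<longrightarrow> (\<exists>n. b < int_mult n a))"

text \<open>The set required to be finite is the set of cosets of \<open>nG\<close>.\<close>

definition small_quotients :: "'a::ab_group_add itself \<Rightarrow> bool" where
  "small_quotients _ \<longleftrightarrow>
     (\<forall>n\<ge>1. finite (range (\<lambda>g :: 'a. (\<lambda>h. g + h) ` range (nat_mult n))))"

end

theory Submission
  imports Defs "HOL.Modules"
begin

text \<open>
  Only one direction has content: every set definable in \<open>M\<close> must be shown to be definable from
  addition alone.

  The starting point is quantifier elimination. An archimedean group is regular (every sufficiently
  long interval meets every coset of \<open>nG\<close>), regularity is a scheme of first-order sentences, and in
  a regular group membership in a definable set depends only on the signs of finitely many affine
  forms and on the coordinates modulo some \<open>n\<close>. After fixing the residue class of one coordinate,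
  each fibre in that direction is a finite union of convex sets. Write \<open>eps\<close> for the least positive
  element, or for 0 if the order is dense; this treats the discrete and the dense case together.

  Stability and the condition on unary sets are used only through one common consequence: a fibre
  as above is finite or cofinite (\<open>dichotomy_of_stable\<close>,
  \<open>dichotomy_of_unary_group_definable\<close>). If both it and its complement were infinite, some
  arithmetic progression would pass from one to the other exactly once, which yields ladders of any length; and a
  set definable in the group cannot separate the long intervals inside and outside it, since
  both meet every coset of \<open>nG\<close>.

  The proof is then an induction on the number of variables (\<open>pdef_group_of_finite_support\<close>).
  Suppose first that there is a bound \<open>K\<close> such that every fibre of \<open>P\<close> in direction \<open>i\<close>, or its
  complement, has at most \<open>K\<close> points. The set \<open>C\<close> of base points with a fibre of more than \<open>K\<close>
  points is definable in \<open>M\<close> with one variable less, hence in the group, and \<open>P\<close> differs from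
  \<open>C\<close> by a set with at most \<open>K\<close> points in each fibre. Such points lie within a bounded number of
  steps \<open>eps\<close> from a wall of the affine arrangement, so the difference is covered by finitely many
  hyperplanes, each of which projects injectively to the remaining variables; the induction
  hypothesis applies to these projections (\<open>bounded_fibres\<close>).

  What remains is the bound \<open>K\<close> (\<open>uniform_bound\<close>). It is evident for dense orders, but in the
  discrete case finite intervals can have any length. Let the jump at a base point be the
  sum of the right end points of the fibre minus the sum of the left end points, where the left end
  point of an interval is the last element before it.
  It equals \<open>n eps\<close> for a fibre with \<open>n\<close> points and \<open>- n eps\<close> for a fibre with \<open>n\<close> missing points, so its
  sign tells finite from cofinite. There are boundedly many end points in each fibre, so the
  jump is definable in \<open>M\<close>, and its graph, having one point in each fibre, is already known to be
  definable in the group. If its range were infinite and the group were not cyclic, the range would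
  be an infinite definable set inside the proper convex subgroup generated by \<open>eps\<close>, which
  contradicts tameness. If the group is cyclic, two points of the graph with the same data for the
  group span a line that runs in the graph up to finitely many points. Along this
  line the fibres of \<open>P\<close> are finite at one end and cofinite at the other, so a line in the total
  space that is steeper than all walls ends outside \<open>P\<close> on one side and inside \<open>P\<close> on the other,
  and this again contradicts tameness.
\<close>

type_synonym 'a oag_type = "(oag_fun, oag_rel, 'a) fo_structure"

section \<open>Integer multiples\<close>

lemma nat_mult_Suc: "nat_mult (Suc n) a = nat_mult n a + a"
  by (simp add: nat_mult_def)

lemma int_mult_of_nat: "int_mult (int n) a = nat_mult n a"
  by (simp add: int_mult_def)

lemma int_mult_minus_of_nat: "int_mult (- int n) a = - nat_mult n a"
  unfolding int_mult_def nat_mult_def by (cases "n = 0") simp_all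

lemma int_mult_add_one: "int_mult (n + 1) a = int_mult n a + a"
proof (cases n)
  case (nonneg k)
  then show ?thesis
    using int_mult_of_nat[of "Suc k" a] int_mult_of_nat[of k a] by (simp add: nat_mult_Suc add.commute)
next
  case (neg k)
  then have "n = - int (Suc k)" "n + 1 = - int k"
    by simp_all
  then show ?thesis
    by (simp only: int_mult_minus_of_nat nat_mult_Suc) simp
qed

lemma int_mult_0: "int_mult 0 a = 0"
  by (simp add: int_mult_def nat_mult_def)

lemma int_mult_one: "int_mult 1 a = a"
  using int_mult_add_one[of 0 a] by (simp add: int_mult_0)

lemma int_mult_diff_one: "int_mult (n - 1) a = int_mult n a - a"
  using int_mult_add_one[of "n - 1" a] by simp

lemma int_mult_add_left: "int_mult (m + n) a = int_mult m a + int_mult n a"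
proof (induction n rule: int_induct[where k = 0])
  case base
  then show ?case by (simp add: int_mult_0)
next
  case (step1 i)
  then show ?case
    by (metis add.assoc int_mult_add_one)
next
  case (step2 i)
  then show ?case
    by (metis add_diff_eq int_mult_diff_one)
qed

lemma int_mult_add_right: "int_mult n (a + b) = int_mult n a + int_mult n b"
  by (induction n rule: int_induct[where k = 0])
     (simp_all add: int_mult_0 int_mult_add_one int_mult_diff_one)

lemma int_mult_mult: "int_mult (m * n) a = int_mult m (int_mult n a)"
proof (induction m rule: int_induct[where k = 0])
  case base
  then show ?case by (simp add: int_mult_0)
next
  case (step1 i)
  then show ?case by (simp only: int_mult_add_one int_mult_add_left distrib_right mult_1
        int_mult_one)
next
  case (step2 i)
  have "int_mult (i * n) a = int_mult ((i - 1) * n) a + int_mult n a"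
    by (simp flip: int_mult_add_left add: left_diff_distrib)
  with step2 show ?case by (simp add: int_mult_diff_one eq_diff_eq)
qed

interpretation zm: module "int_mult :: int \<Rightarrow> 'a::ab_group_add \<Rightarrow> 'a"
proof
  fix a b :: int and x y :: 'a
  show "int_mult a (x + y) = int_mult a x + int_mult a y"
    by (rule int_mult_add_right)
  show "int_mult (a + b) x = int_mult a x + int_mult b x"
    by (rule int_mult_add_left)
  show "int_mult a (int_mult b x) = int_mult (a * b) x"
    by (rule int_mult_mult[symmetric])
  show "int_mult 1 x = x"
    by (rule int_mult_one)
qed

notation int_mult (infixr "\<cdot>" 75)

lemma int_mult_less:
  fixes a b :: "'a::linordered_ab_group_add"
  assumes "0 < n" "a < b"
  shows "n \<cdot> a < n \<cdot> b"
  using assms(1)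
proof (induction n rule: int_gr_induct)
  case base
  then show ?case using assms by (simp add: zm.scale_one)
next
  case (step i)
  then show ?case using assms(2) by (simp add: int_mult_add_one add_strict_mono)
qed

lemma int_mult_less_iff:
  fixes a b :: "'a::linordered_ab_group_add"
  assumes "0 < n"
  shows "n \<cdot> a < n \<cdot> b \<longleftrightarrow> a < b"
  by (metis assms int_mult_less linorder_neqE not_less_iff_gr_or_eq)

lemma int_mult_le_iff:
  fixes a b :: "'a::linordered_ab_group_add"
  assumes "0 < n"
  shows "n \<cdot> a \<le> n \<cdot> b \<longleftrightarrow> a \<le> b"
  using int_mult_less_iff[OF assms] by (meson linorder_not_le)

lemma int_mult_eq_iff:
  fixes a b :: "'a::linordered_ab_group_add"
  assumes "n \<noteq> 0"
  shows "n \<cdot> a = n \<cdot> b \<longleftrightarrow> a = b"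
proof -
  have pos: "k \<cdot> a = k \<cdot> b \<longleftrightarrow> a = b" if "0 < k" for k
    by (metis that int_mult_less less_irrefl linorder_neqE)
  show ?thesis
  proof (cases "0 < n")
    case False
    then have "(- n) \<cdot> a = (- n) \<cdot> b \<longleftrightarrow> a = b"
      using assms by (intro pos) simp
    then show ?thesis by simp
  qed (rule pos)
qed

lemma int_mult_eq_0_iff:
  fixes a :: "'a::linordered_ab_group_add"
  shows "n \<cdot> a = 0 \<longleftrightarrow> n = 0 \<or> a = 0"
  using int_mult_eq_iff[of n a 0] by auto

lemma int_mult_less_left:
  fixes a :: "'a::linordered_ab_group_add"
  assumes "m < n" "0 < a"
  shows "m \<cdot> a < n \<cdot> a"
  using int_mult_less[of "n - m" 0 a] assms by (simp add: zm.scale_left_diff_distrib)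

lemma int_mult_right_eq_iff:
  fixes a :: "'a::linordered_ab_group_add"
  assumes "a \<noteq> 0"
  shows "m \<cdot> a = n \<cdot> a \<longleftrightarrow> m = n"
  using int_mult_eq_0_iff[of "m - n" a] assms by (simp add: zm.scale_left_diff_distrib)

lemma int_mult_le_left:
  fixes a :: "'a::linordered_ab_group_add"
  assumes "m \<le> n" "0 \<le> a"
  shows "m \<cdot> a \<le> n \<cdot> a"
  using int_mult_less_left[of m n a] assms by (cases "m = n"; cases "a = 0") (auto intro: less_imp_le)

lemma int_mult_nonneg:
  fixes a :: "'a::linordered_ab_group_add"
  shows "0 \<le> n \<Longrightarrow> 0 \<le> a \<Longrightarrow> 0 \<le> n \<cdot> a"
  using int_mult_le_left[of 0 n a] by simp

section \<open>Formulas and parametrically definable predicates\<close>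

primrec rename_trm :: "(nat \<Rightarrow> nat) \<Rightarrow> 'f trm \<Rightarrow> 'f trm" where
  "rename_trm \<rho> (Var i) = Var (\<rho> i)"
| "rename_trm \<rho> (Fn f ts) = Fn f (map (rename_trm \<rho>) ts)"

primrec rename :: "('f, 'r) form \<Rightarrow> (nat \<Rightarrow> nat) \<Rightarrow> ('f, 'r) form" where
  "rename (Eq s t) \<rho> = Eq (rename_trm \<rho> s) (rename_trm \<rho> t)"
| "rename (Rel r ts) \<rho> = Rel r (map (rename_trm \<rho>) ts)"
| "rename (Neg \<phi>) \<rho> = Neg (rename \<phi> \<rho>)"
| "rename (Conj \<phi> \<psi>) \<rho> = Conj (rename \<phi> \<rho>) (rename \<psi> \<rho>)"
| "rename (Exists \<phi>) \<rho> = Exists (rename \<phi> (case_nat 0 (\<lambda>i. Suc (\<rho> i))))"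

lemma val_rename: "val M e (rename_trm \<rho> t) = val M (\<lambda>i. e (\<rho> i)) t"
  by (induction t) (simp_all add: comp_def cong: map_cong)

lemma sat_rename: "sat M e (rename \<phi> \<rho>) \<longleftrightarrow> sat M (\<lambda>i. e (\<rho> i)) \<phi>"
proof (induction \<phi> arbitrary: e \<rho>)
  case (Exists \<phi>)
  have "(\<lambda>i. case_nat a e (case_nat 0 (\<lambda>i. Suc (\<rho> i)) i)) = case_nat a (\<lambda>i. e (\<rho> i))" for a
    by (auto split: nat.splits)
  with Exists show ?case by simp
qed (simp_all add: val_rename comp_def cong: map_cong)

lemma fv_rename_trm: "fv_trm (rename_trm \<rho> t) = \<rho> ` fv_trm t"
  by (induction t) auto

lemma fv_rename: "fv (rename \<phi> \<rho>) = \<rho> ` fv \<phi>"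
proof (induction \<phi> arbitrary: \<rho>)
  case (Exists \<phi>)
  show ?case
  proof (intro set_eqI iffI)
    fix i assume "i \<in> fv (rename (Exists \<phi>) \<rho>)"
    then obtain j where j: "j \<in> fv \<phi>" "Suc i = case_nat 0 (\<lambda>i. Suc (\<rho> i)) j"
      using Exists by auto
    then show "i \<in> \<rho> ` fv (Exists \<phi>)"
      by (cases j) auto
  next
    fix i assume "i \<in> \<rho> ` fv (Exists \<phi>)"
    then obtain j where "Suc j \<in> fv \<phi>" "i = \<rho> j" by auto
    then show "i \<in> fv (rename (Exists \<phi>) \<rho>)"
      using Exists by (auto intro!: image_eqI[of _ _ "Suc j"])
  qed
qed (simp_all add: fv_rename_trm image_Un image_UN)

lemma wf_rename_trm: "wf_trm M (rename_trm \<rho> t) = wf_trm M t"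
  by (induction t) (auto simp: list_all_iff)

lemma wf_rename: "wf_form M (rename \<phi> \<rho>) = wf_form M \<phi>"
  by (induction \<phi> arbitrary: \<rho>) (auto simp: wf_rename_trm)

lemma finite_fv_trm: "finite (fv_trm t)"
  by (induction t) auto

lemma finite_fv: "finite (fv \<phi>)"
proof (induction \<phi>)
  case (Exists \<phi>)
  have "{i. Suc i \<in> fv \<phi>} = Suc -` fv \<phi>" by auto
  with Exists show ?case by (simp add: finite_vimageI)
qed (auto simp: finite_fv_trm)

lemma val_cong: "(\<And>i. i \<in> fv_trm t \<Longrightarrow> e i = e' i) \<Longrightarrow> val M e t = val M e' t"
proof (induction t)
  case (Fn f ts)
  then have "map (val M e) ts = map (val M e') ts" by force
  then show ?case by (simp only: val.simps)
qed simp

lemma sat_cong: "(\<And>i. i \<in> fv \<phi> \<Longrightarrow> e i = e' i) \<Longrightarrow> sat M e \<phi> \<longleftrightarrow> sat M e' \<phi>"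
proof (induction \<phi> arbitrary: e e')
  case (Eq s t)
  then show ?case using val_cong[of s e e' M] val_cong[of t e e' M] by simp
next
  case (Rel r ts)
  then have "map (val M e) ts = map (val M e') ts"
    by (auto intro!: val_cong)
  then show ?case by (simp only: sat.simps)
next
  case (Conj \<phi> \<psi>)
  have "sat M e \<phi> \<longleftrightarrow> sat M e' \<phi>" "sat M e \<psi> \<longleftrightarrow> sat M e' \<psi>"
    using Conj.prems by (intro Conj.IH; simp)+
  then show ?case by simp
next
  case (Exists \<phi>)
  have "sat M (case_nat a e) \<phi> \<longleftrightarrow> sat M (case_nat a e') \<phi>" for a
    by (rule Exists.IH) (use Exists.prems in \<open>auto split: nat.splits\<close>)
  then show ?case by simp
next
  case (Neg \<phi>)
  have "sat M e \<phi> \<longleftrightarrow> sat M e' \<phi>"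
    using Neg.prems by (intro Neg.IH) simp
  then show ?case by simp
qed

text \<open>
  A coordinate is either a fixed parameter or is read off from the environment.
\<close>

fun source :: "(nat \<Rightarrow> 'a) \<Rightarrow> 'a + nat \<Rightarrow> 'a" where
  "source e (Inl c) = c"
| "source e (Inr j) = e j"

text \<open>
  Definability with parameters, for predicates on infinite environments instead of sets of tuples of
  a fixed length: substitution, renaming and quantification over any coordinate then need no
  bookkeeping of arities.
\<close>

definition pdef :: "('f, 'r, 'a) fo_structure \<Rightarrow> ((nat \<Rightarrow> 'a) \<Rightarrow> bool) \<Rightarrow> bool" where
  "pdef M P \<longleftrightarrow>
     (\<exists>\<phi> \<sigma>. wf_form M \<phi> \<and> (\<forall>e. P e \<longleftrightarrow> sat M (\<lambda>i. source e (\<sigma> i)) \<phi>))"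

lemma pdef_sat: "wf_form M \<phi> \<Longrightarrow> pdef M (\<lambda>e. sat M e \<phi>)"
  unfolding pdef_def by (rule exI[of _ \<phi>], rule exI[of _ Inr]) simp

lemma pdef_subst:
  assumes "pdef M P"
  shows "pdef M (\<lambda>e. P (\<lambda>i. source e (\<tau> i)))"
proof -
  obtain \<phi> \<sigma> where *: "wf_form M \<phi>" "\<And>e. P e \<longleftrightarrow> sat M (\<lambda>i. source e (\<sigma> i)) \<phi>"
    using assms unfolding pdef_def by blast
  define \<sigma>' where "\<sigma>' i = (case \<sigma> i of Inl c \<Rightarrow> Inl c | Inr j \<Rightarrow> \<tau> j)" for i
  have "(\<lambda>i. source (\<lambda>i. source e (\<tau> i)) (\<sigma> i)) = (\<lambda>i. source e (\<sigma>' i))" for e :: "nat \<Rightarrow> 'c"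
    by (rule ext) (simp add: \<sigma>'_def split: sum.splits)
  then show ?thesis
    unfolding pdef_def using * by (intro exI[of _ \<phi>] exI[of _ \<sigma>']) simp
qed

lemma pdef_rename: "pdef M P \<Longrightarrow> pdef M (\<lambda>e. P (\<lambda>i. e (\<rho> i)))"
  using pdef_subst[of M P "\<lambda>i. Inr (\<rho> i)"] by simp

lemma pdef_neg:
  assumes "pdef M P"
  shows "pdef M (\<lambda>e. \<not> P e)"
proof -
  obtain \<phi> \<sigma> where "wf_form M \<phi>" "\<And>e. P e \<longleftrightarrow> sat M (\<lambda>i. source e (\<sigma> i)) \<phi>"
    using assms unfolding pdef_def by blast
  then show ?thesis
    unfolding pdef_def by (intro exI[of _ "Neg \<phi>"] exI[of _ \<sigma>]) simp
qed

text \<open>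
  The variables of the two formulas are kept apart by moving them to even and odd indices.
\<close>

lemma pdef_conj:
  assumes "pdef M P" "pdef M Q"
  shows "pdef M (\<lambda>e. P e \<and> Q e)"
proof -
  obtain \<phi> \<sigma> where p: "wf_form M \<phi>" "\<And>e. P e \<longleftrightarrow> sat M (\<lambda>i. source e (\<sigma> i)) \<phi>"
    using assms(1) unfolding pdef_def by blast
  obtain \<psi> \<tau> where q: "wf_form M \<psi>" "\<And>e. Q e \<longleftrightarrow> sat M (\<lambda>i. source e (\<tau> i)) \<psi>"
    using assms(2) unfolding pdef_def by blast
  define \<theta> where "\<theta> i = (if even i then \<sigma> (i div 2) else \<tau> (i div 2))" for i
  show ?thesis
    unfolding pdef_def
    by (rule exI[of _ "Conj (rename \<phi> (\<lambda>i. 2 * i)) (rename \<psi> (\<lambda>i. 2 * i + 1))"],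
        rule exI[of _ \<theta>])
       (simp add: p q wf_rename sat_rename \<theta>_def)
qed

lemma pdef_disj: "pdef M P \<Longrightarrow> pdef M Q \<Longrightarrow> pdef M (\<lambda>e. P e \<or> Q e)"
  using pdef_neg[OF pdef_conj[OF pdef_neg[of M P] pdef_neg[of M Q]]] by simp

lemma pdef_imp: "pdef M P \<Longrightarrow> pdef M Q \<Longrightarrow> pdef M (\<lambda>e. P e \<longrightarrow> Q e)"
  using pdef_disj[OF pdef_neg[of M P], of Q] by simp

lemma pdef_iff: "pdef M P \<Longrightarrow> pdef M Q \<Longrightarrow> pdef M (\<lambda>e. P e \<longleftrightarrow> Q e)"
  using pdef_conj[OF pdef_imp[of M P Q] pdef_imp[of M Q P]] by (simp add: iff_conv_conj_imp)

lemma pdef_eq: "pdef M (\<lambda>e. e i = e j)"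
  using pdef_sat[of M "Eq (Var i) (Var j)"] by simp

lemma pdef_const: "pdef M (\<lambda>e. b)"
  using pdef_eq[of M 0 0] pdef_neg[OF pdef_eq[of M 0 0]] by (cases b) simp_all

lemma pdef_ex:
  assumes "pdef M P"
  shows "pdef M (\<lambda>e. \<exists>x. P (e(i := x)))"
proof -
  obtain \<phi> \<sigma> where p: "wf_form M \<phi>" "\<And>e. P e \<longleftrightarrow> sat M (\<lambda>i. source e (\<sigma> i)) \<phi>"
    using assms unfolding pdef_def by blast
  define \<rho> where "\<rho> j = (if \<sigma> j = Inr i then 0 else Suc j)" for j
  have "(\<lambda>j. case_nat x (\<lambda>i. source e (\<sigma> i)) (\<rho> j)) = (\<lambda>j. source (e(i := x)) (\<sigma> j))" for x e
  proof
    fix j show "case_nat x (\<lambda>i. source e (\<sigma> i)) (\<rho> j) = source (e(i := x)) (\<sigma> j)"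
      by (cases "\<sigma> j") (auto simp: \<rho>_def)
  qed
  then show ?thesis
    unfolding pdef_def
    by (intro exI[of _ "Exists (rename \<phi> \<rho>)"] exI[of _ \<sigma>]) (simp add: p wf_rename sat_rename)
qed

lemma pdef_all: "pdef M P \<Longrightarrow> pdef M (\<lambda>e. \<forall>x. P (e(i := x)))"
  using pdef_neg[OF pdef_ex[OF pdef_neg[of M P], of i]] by simp

lemma pdef_Ball: "finite I \<Longrightarrow> (\<And>l. l \<in> I \<Longrightarrow> pdef M (P l)) \<Longrightarrow> pdef M (\<lambda>e. \<forall>l\<in>I. P l e)"
  by (induction I rule: finite_induct) (simp_all add: pdef_const pdef_conj)

lemma pdef_Bex: "finite I \<Longrightarrow> (\<And>l. l \<in> I \<Longrightarrow> pdef M (P l)) \<Longrightarrow> pdef M (\<lambda>e. \<exists>l\<in>I. P l e)"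
  by (induction I rule: finite_induct) (simp_all add: pdef_const pdef_disj)

lemma pdef_ex_block:
  assumes "pdef M P" "finite J"
  shows "pdef M (\<lambda>e. \<exists>u. P (\<lambda>j. if j \<in> J then u j else e j))"
  using assms(2)
proof (induction J rule: finite_induct)
  case empty
  then show ?case using assms(1) by simp
next
  case (insert i J)
  have "(\<exists>u. P (\<lambda>j. if j \<in> insert i J then u j else e j)) \<longleftrightarrow>
        (\<exists>x. \<exists>u. P (\<lambda>j. if j \<in> J then u j else (e(i := x)) j))" (is "?l \<longleftrightarrow> ?r") for e
  proof
    assume ?l
    then obtain u where u: "P (\<lambda>j. if j \<in> insert i J then u j else e j)" by blast
    have "(\<lambda>j. if j \<in> insert i J then u j else e j) = (\<lambda>j. if j \<in> J then u j else (e(i := u i)) j)"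
      by auto
    with u show ?r by metis
  next
    assume ?r
    then obtain x u where u: "P (\<lambda>j. if j \<in> J then u j else (e(i := x)) j)" by blast
    have "(\<lambda>j. if j \<in> insert i J then (u(i := x)) j else e j) = (\<lambda>j. if j \<in> J then u j else (e(i := x)) j)"
      using insert by auto
    with u show ?l by metis
  qed
  then show ?case using pdef_ex[OF insert.IH, of i] by simp
qed

text \<open>
  A tuple \<open>u\<close> can be quantified away because it may be stored in the coordinates from \<open>m\<close> on, where
  \<open>Q\<close> does not look.
\<close>

lemma pdef_ex_fun:
  fixes Q :: "(nat \<Rightarrow> 'a) \<Rightarrow> (nat \<Rightarrow> 'a) \<Rightarrow> bool"
  assumes "pdef M (\<lambda>e. Q (\<lambda>l. e (m + l)) e)"
    and dep: "\<And>u e e'. (\<And>j. j < m \<Longrightarrow> e j = e' j) \<Longrightarrow> Q u e \<longleftrightarrow> Q u e'"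
    and dep': "\<And>u u' e. (\<And>l. l < r \<Longrightarrow> u l = u' l) \<Longrightarrow> Q u e \<longleftrightarrow> Q u' e"
  shows "pdef M (\<lambda>e. \<exists>u. Q u e)"
proof -
  have "(\<exists>u. Q u e) \<longleftrightarrow>
     (\<exists>u. Q (\<lambda>l. if m + l \<in> {m..<m + r} then u (m + l) else e (m + l))
            (\<lambda>j. if j \<in> {m..<m + r} then u j else e j))" (is "?l \<longleftrightarrow> ?r") for e
  proof
    assume ?l
    then obtain u where "Q u e" by blast
    then have "Q (\<lambda>l. if m + l \<in> {m..<m + r} then u ((m + l) - m) else e (m + l))
            (\<lambda>j. if j \<in> {m..<m + r} then u (j - m) else e j)"
      by (subst dep[of _ e], simp, subst dep'[of _ u]) simp_all
    then show ?r by (rule exI[of _ "\<lambda>j. u (j - m)"])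
  next
    assume ?r
    then obtain u where "Q (\<lambda>l. if m + l \<in> {m..<m + r} then u (m + l) else e (m + l))
            (\<lambda>j. if j \<in> {m..<m + r} then u j else e j)" by blast
    then have "Q (\<lambda>l. if m + l \<in> {m..<m + r} then u (m + l) else e (m + l)) e"
      by (subst dep[of e "\<lambda>j. if j \<in> {m..<m + r} then u j else e j"]) simp_all
    then show ?l by blast
  qed
  then show ?thesis
    using pdef_ex_block[OF assms(1), of "{m..<m + r}"] by simp
qed

definition depends :: "nat set \<Rightarrow> ((nat \<Rightarrow> 'a) \<Rightarrow> 'b) \<Rightarrow> bool" where
  "depends S f \<longleftrightarrow> (\<forall>e e'. (\<forall>i\<in>S. e i = e' i) \<longrightarrow> f e = f e')"

lemma dependsD: "depends S f \<Longrightarrow> (\<And>i. i \<in> S \<Longrightarrow> e i = e' i) \<Longrightarrow> f e = f e'"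
  unfolding depends_def by blast

lemma pdef_depends:
  assumes "pdef M P"
  obtains m where "depends {..<m} P"
proof -
  obtain \<phi> \<sigma> where p: "wf_form M \<phi>" "\<And>e. P e \<longleftrightarrow> sat M (\<lambda>i. source e (\<sigma> i)) \<phi>"
    using assms unfolding pdef_def by blast
  have "finite {j. Inr j \<in> \<sigma> ` fv \<phi>}"
    using finite_vimageI[of "\<sigma> ` fv \<phi>" Inr] finite_fv[of \<phi>] by (simp add: vimage_def)
  then obtain m where m: "{j. Inr j \<in> \<sigma> ` fv \<phi>} \<subseteq> {..<m}"
    by (auto simp: finite_nat_set_iff_bounded)
  have "P e = P e'" if "\<forall>i\<in>{..<m}. e i = e' i" for e e'
    unfolding p
  proof (rule sat_cong)
    fix i assume "i \<in> fv \<phi>"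
    then have "Inr j = \<sigma> i \<Longrightarrow> j < m" for j
      using m by (auto simp: image_iff)
    then show "source e (\<sigma> i) = source e' (\<sigma> i)"
      using that by (cases "\<sigma> i") auto
  qed
  then show ?thesis
    using that unfolding depends_def by blast
qed

lemma definable_imp_pdef:
  assumes "definable M A k X"
  shows "pdef M (\<lambda>e. map e [0..<k] \<in> X)"
proof -
  obtain \<phi> bs where *: "wf_form M \<phi>" "fv \<phi> \<subseteq> {..<k + length bs}"
      "X = {xs. length xs = k \<and> sat M ((!) (xs @ bs)) \<phi>}"
    using assms unfolding definable_def by blast
  have "map e [0..<k] \<in> X \<longleftrightarrow>
        sat M (\<lambda>i. source e (if i < k then Inr i else Inl (bs ! (i - k)))) \<phi>" for e
    unfolding *(3) by (simp, rule sat_cong) (use *(2) in \<open>auto simp: nth_append\<close>)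
  then show ?thesis
    unfolding pdef_def using *(1)
    by (intro exI[of _ \<phi>] exI[of _ "\<lambda>i. if i < k then Inr i else Inl (bs ! (i - k))"]) simp
qed

text \<open>
  Parameters are appended to the tuple at position \<open>k\<close>; a coordinate from \<open>k\<close> on does not influence
  \<open>P\<close> and can be filled with an arbitrary parameter as well.
\<close>

lemma pdef_imp_definable:
  assumes "pdef M P" and dep: "depends {..<k} P"
  shows "definable M UNIV k {xs. length xs = k \<and> P ((!) xs)}"
proof -
  obtain \<phi> \<sigma> where p: "wf_form M \<phi>" "\<And>e. P e \<longleftrightarrow> sat M (\<lambda>i. source e (\<sigma> i)) \<phi>"
    using assms(1) unfolding pdef_def by blast
  obtain m where m: "fv \<phi> \<subseteq> {..<m}"
    using finite_fv[of \<phi>] by (auto simp: finite_nat_set_iff_bounded)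
  define bs where "bs = map (\<lambda>i. case \<sigma> i of Inl c \<Rightarrow> c | Inr j \<Rightarrow> undefined) [0..<m]"
  define \<rho> where "\<rho> i = (case \<sigma> i of Inl c \<Rightarrow> k + i | Inr j \<Rightarrow> if j < k then j else k + i)" for i
  have "fv (rename \<phi> \<rho>) \<subseteq> {..<k + length bs}"
    unfolding fv_rename using m by (auto simp: \<rho>_def bs_def split: sum.splits)
  moreover have "P ((!) xs) \<longleftrightarrow> sat M ((!) (xs @ bs)) (rename \<phi> \<rho>)" if "length xs = k" for xs
  proof -
    have "P ((!) xs) \<longleftrightarrow> P (\<lambda>j. if j < k then xs ! j else undefined)"
      by (rule dependsD[OF dep]) simp
    also have "\<dots> \<longleftrightarrow> sat M ((!) (xs @ bs)) (rename \<phi> \<rho>)"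
      unfolding p(2) sat_rename
    proof (rule sat_cong)
      fix i assume "i \<in> fv \<phi>"
      with m have "i < m" by auto
      then show "source (\<lambda>j. if j < k then xs ! j else undefined) (\<sigma> i) = (xs @ bs) ! \<rho> i"
        using that by (cases "\<sigma> i") (auto simp: \<rho>_def bs_def nth_append)
    qed
    finally show ?thesis .
  qed
  ultimately show ?thesis
    unfolding definable_def using p(1)
    by (intro exI[of _ "rename \<phi> \<rho>"] exI[of _ bs]) (auto simp: wf_rename)
qed

lemma reduct_pdef:
  assumes "reduct M N" "pdef M P"
  shows "pdef N P"
proof -
  obtain \<phi> \<sigma> where p: "wf_form M \<phi>" "\<And>e. P e \<longleftrightarrow> sat M (\<lambda>i. source e (\<sigma> i)) \<phi>"
    using assms(2) unfolding pdef_def by blast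
  obtain k where k: "fv \<phi> \<subseteq> {..<k}"
    using finite_fv[of \<phi>] by (auto simp: finite_nat_set_iff_bounded)
  define X where "X = {xs. length xs = k \<and> sat M ((!) xs) \<phi>}"
  have "definable M {} k X"
    unfolding definable_def X_def using p(1) k by (intro exI[of _ \<phi>] exI[of _ "[]"]) simp
  then have "pdef N (\<lambda>e. map e [0..<k] \<in> X)"
    using assms(1) definable_imp_pdef unfolding reduct_over_def by blast
  moreover have "map e [0..<k] \<in> X \<longleftrightarrow> sat M e \<phi>" for e
    unfolding X_def by (simp, rule sat_cong) (use k in auto)
  ultimately have "pdef N (\<lambda>e. sat M e \<phi>)" by simp
  from pdef_subst[OF this, of \<sigma>] show ?thesis by (simp add: p(2)[abs_def])
qed

lemma reductI_pdef:
  fixes M :: "('f, 'r, 'a) fo_structure"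
  assumes "\<And>P. pdef M P \<Longrightarrow> pdef N P"
  shows "reduct M N"
  unfolding reduct_over_def
proof (intro allI impI)
  fix k X assume X: "definable M {} k X"
  have len: "X \<subseteq> {xs. length xs = k}"
    using X unfolding definable_def by auto
  have "pdef N (\<lambda>e. map e [0..<k] \<in> X)"
    using X by (intro assms definable_imp_pdef)
  moreover have "depends {..<k} (\<lambda>e. map e [0..<k] \<in> X)"
    unfolding depends_def
  proof (intro allI impI)
    fix e e' :: "nat \<Rightarrow> 'a" assume "\<forall>i\<in>{..<k}. e i = e' i"
    then have "map e [0..<k] = map e' [0..<k]" by simp
    then show "(map e [0..<k] \<in> X) = (map e' [0..<k] \<in> X)" by (simp only:)
  qed
  ultimately have "definable N UNIV k {xs. length xs = k \<and> map ((!) xs) [0..<k] \<in> X}"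
    by (rule pdef_imp_definable)
  moreover have "{xs. length xs = k \<and> map ((!) xs) [0..<k] \<in> X} = X"
    using len by (auto simp: map_nth)
  ultimately show "definable N UNIV k X" by simp
qed

section \<open>Affine functions\<close>

text \<open>
  Affine functions with integer coefficients, generated so that each closure property is a short
  induction and no coefficient vectors are needed.
\<close>

inductive affine :: "((nat \<Rightarrow> 'a::ab_group_add) \<Rightarrow> 'a) \<Rightarrow> bool" where
  affine_const: "affine (\<lambda>e. c)"
| affine_var: "affine (\<lambda>e. e i)"
| affine_diff: "affine f \<Longrightarrow> affine g \<Longrightarrow> affine (\<lambda>e. f e - g e)"

lemma affine_uminus: "affine f \<Longrightarrow> affine (\<lambda>e. - f e)"
  using affine_diff[OF affine_const[of 0], of f] by simp

lemma affine_add: "affine f \<Longrightarrow> affine g \<Longrightarrow> affine (\<lambda>e. f e + g e)"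
  using affine_diff[of f "\<lambda>e. - g e"] affine_uminus[of g] by simp

lemma affine_int_mult:
  assumes "affine f"
  shows "affine (\<lambda>e. n \<cdot> f e)"
  by (induction n rule: int_induct[where k = 0])
     (simp_all add: int_mult_0 int_mult_add_one int_mult_diff_one affine_const affine_add affine_diff assms)

lemma affine_sum: "(\<And>l. l \<in> I \<Longrightarrow> affine (f l)) \<Longrightarrow> affine (\<lambda>e. \<Sum>l\<in>I. f l e)"
  by (induction I rule: infinite_finite_induct) (simp_all add: affine_const affine_add)

lemma affine_subst:
  assumes "affine f" "\<And>j. affine (\<lambda>e. \<tau> e j)"
  shows "affine (\<lambda>e. f (\<tau> e))"
  using assms(1) by induction (simp_all add: assms(2) affine_const affine_diff)

lemma affine_source: "affine (\<lambda>e. source e s)"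
  by (cases s) (simp_all add: affine_const affine_var)

lemma affine_split_case_nat:
  assumes "affine f"
  shows "\<exists>a g. affine g \<and> (\<forall>x e. f (case_nat x e) = a \<cdot> x + g e)"
  using assms
proof induction
  case (affine_const c)
  then show ?case
    by (intro exI[of _ 0] exI[of _ "\<lambda>e. c"]) (simp add: affine.affine_const)
next
  case (affine_var i)
  show ?case
  proof (cases i)
    case 0
    then show ?thesis
      by (intro exI[of _ 1] exI[of _ "\<lambda>e. 0"]) (simp add: affine.affine_const)
  next
    case (Suc j)
    then show ?thesis
      by (intro exI[of _ 0] exI[of _ "\<lambda>e. e j"]) (simp add: affine.affine_var)
  qed
next
  case (affine_diff f g)
  then obtain a f' b g' where "affine f'" "affine g'"
      "\<And>x e. f (case_nat x e) = a \<cdot> x + f' e" "\<And>x e. g (case_nat x e) = b \<cdot> x + g' e"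
    by blast
  then show ?case
    by (intro exI[of _ "a - b"] exI[of _ "\<lambda>e. f' e - g' e"])
       (simp add: affine.affine_diff zm.scale_left_diff_distrib algebra_simps)
qed

text \<open>
  Only integer multiples \<open>z\<close> are available on a line through two given points.
\<close>

lemma affine_line:
  assumes "affine f"
  shows "f (\<lambda>j. p j + z \<cdot> (q j - p j)) = f p + z \<cdot> (f q - f p)"
  using assms
  by induction (simp_all add: zm.scale_right_diff_distrib)

lemma affine_congruent:
  assumes "affine f" "\<And>j. \<exists>h. e' j = e j + n \<cdot> h"
  shows "\<exists>h. f e' = f e + n \<cdot> h"
  using assms(1)
proof induction
  case (affine_const c)
  show ?case by (rule exI[of _ 0]) simp
next
  case (affine_var i)
  then show ?case using assms(2) by simp
next
  case (affine_diff f g)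
  then obtain h k where "f e' = f e + n \<cdot> h" "g e' = g e + n \<cdot> k" by blast
  then show ?case
    by (intro exI[of _ "h - k"]) (simp add: zm.scale_right_diff_distrib)
qed

lemma affine_depends:
  assumes "affine f"
  shows "\<exists>m. depends {..<m} f"
  using assms
proof induction
  case (affine_var i)
  show ?case by (rule exI[of _ "Suc i"]) (simp add: depends_def)
next
  case (affine_diff f g)
  then obtain m n where "depends {..<m} f" "depends {..<n} g" by blast
  have "f e - g e = f e' - g e'" if "\<forall>i\<in>{..<max m n}. e i = e' i" for e e'
  proof -
    have "f e = f e'"
      by (rule dependsD[OF \<open>depends {..<m} f\<close>]) (use that in auto)
    moreover have "g e = g e'"
      by (rule dependsD[OF \<open>depends {..<n} g\<close>]) (use that in auto)
    ultimately show ?thesis by simp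
  qed
  then show ?case unfolding depends_def by blast
qed (simp add: depends_def)


section \<open>Sets determined by finitely many affine functions and congruences\<close>

text \<open>
  The form that quantifier elimination takes here: \<open>\<kappa>\<close> records the sign of an element for ordered
  groups, and whether it is zero for pure groups. No normal form of formulas is needed,
  because closure under projection is shown by a back-and-forth argument on environments.
\<close>

definition sigdet_by ::
    "('a::ab_group_add \<Rightarrow> 'k) \<Rightarrow> ((nat \<Rightarrow> 'a) \<Rightarrow> 'a) set \<Rightarrow> int \<Rightarrow> ((nat \<Rightarrow> 'a) \<Rightarrow> bool) \<Rightarrow> bool" where
  "sigdet_by \<kappa> F n P \<longleftrightarrow> finite F \<and> (\<forall>f\<in>F. affine f) \<and> 0 < n \<and>
     (\<forall>e e'. (\<forall>f\<in>F. \<kappa> (f e) = \<kappa> (f e')) \<and> (\<forall>j. \<exists>h. e' j = e j + n \<cdot> h) \<longrightarrow> (P e \<longleftrightarrow> P e'))"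

definition sigdet :: "('a::ab_group_add \<Rightarrow> 'k) \<Rightarrow> ((nat \<Rightarrow> 'a) \<Rightarrow> bool) \<Rightarrow> bool" where
  "sigdet \<kappa> P \<longleftrightarrow> (\<exists>F n. sigdet_by \<kappa> F n P)"

lemma sigdet_byD:
  assumes "sigdet_by \<kappa> F n P"
  shows "finite F" "\<And>f. f \<in> F \<Longrightarrow> affine f" "0 < n"
    "(\<And>f. f \<in> F \<Longrightarrow> \<kappa> (f e) = \<kappa> (f e')) \<Longrightarrow> (\<And>j. \<exists>h. e' j = e j + n \<cdot> h) \<Longrightarrow> P e \<longleftrightarrow> P e'"
  using assms unfolding sigdet_by_def by simp_all

lemma sigdet_neg: "sigdet \<kappa> P \<Longrightarrow> sigdet \<kappa> (\<lambda>e. \<not> P e)"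
  unfolding sigdet_def sigdet_by_def by simp

lemma sigdet_conj:
  assumes "sigdet \<kappa> P" "sigdet \<kappa> Q"
  shows "sigdet \<kappa> (\<lambda>e. P e \<and> Q e)"
proof -
  obtain F m where "sigdet_by \<kappa> F m P" using assms(1) unfolding sigdet_def by blast
  note F = sigdet_byD[OF this]
  obtain G n where "sigdet_by \<kappa> G n Q" using assms(2) unfolding sigdet_def by blast
  note G = sigdet_byD[OF this]
  have "(P e \<and> Q e) \<longleftrightarrow> (P e' \<and> Q e')"
    if k: "\<forall>f\<in>F \<union> G. \<kappa> (f e) = \<kappa> (f e')" and c: "\<forall>j. \<exists>h. e' j = e j + (m * n) \<cdot> h" for e e'
  proof -
    have c': "\<exists>h. e' j = e j + m \<cdot> h" "\<exists>h. e' j = e j + n \<cdot> h" for j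
    proof -
      obtain h where h: "e' j = e j + (m * n) \<cdot> h" using c by blast
      then have "e' j = e j + m \<cdot> (n \<cdot> h)" "e' j = e j + n \<cdot> (m \<cdot> h)"
        by (simp_all add: mult.commute)
      then show "\<exists>h. e' j = e j + m \<cdot> h" "\<exists>h. e' j = e j + n \<cdot> h" by blast+
    qed
    have "P e \<longleftrightarrow> P e'"
      by (rule F(4)) (use k c' in simp_all)
    moreover have "Q e \<longleftrightarrow> Q e'"
      by (rule G(4)) (use k c' in simp_all)
    ultimately show ?thesis by simp
  qed
  then show ?thesis
    unfolding sigdet_def sigdet_by_def using F(1-3) G(1-3)
    by (intro exI[of _ "F \<union> G"] exI[of _ "m * n"]) auto
qed

lemma sigdet_subst:
  assumes "sigdet \<kappa> P"
  shows "sigdet \<kappa> (\<lambda>e. P (\<lambda>i. source e (\<tau> i)))"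
proof -
  obtain F n where "sigdet_by \<kappa> F n P" using assms unfolding sigdet_def by blast
  note F = sigdet_byD[OF this]
  define F' where "F' = (\<lambda>f e. f (\<lambda>i. source e (\<tau> i))) ` F"
  have "\<forall>f\<in>F'. affine f"
    unfolding F'_def using F(2) by (auto intro: affine_subst affine_source)
  moreover have "P (\<lambda>i. source e (\<tau> i)) \<longleftrightarrow> P (\<lambda>i. source e' (\<tau> i))"
    if "\<forall>f\<in>F'. \<kappa> (f e) = \<kappa> (f e')" "\<forall>j. \<exists>h. e' j = e j + n \<cdot> h" for e e'
  proof (rule F(4))
    fix j show "\<exists>h. source e' (\<tau> j) = source e (\<tau> j) + n \<cdot> h"
      using that(2) by (cases "\<tau> j") (auto intro: exI[of _ 0])
  qed (use that(1) in \<open>auto simp: F'_def\<close>)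
  ultimately show ?thesis
    unfolding sigdet_def sigdet_by_def using F(1,3) by (intro exI[of _ F'] exI[of _ n]) (auto simp: F'_def)
qed

lemma sigdet_affine:
  assumes "affine f" and "\<And>g h. \<kappa> g = \<kappa> h \<Longrightarrow> R g \<longleftrightarrow> R h"
  shows "sigdet \<kappa> (\<lambda>e. R (f e))"
  unfolding sigdet_def sigdet_by_def
proof (intro exI[of _ "{f}"] exI[of _ 1] conjI allI impI)
  fix e e' assume "(\<forall>f\<in>{f}. \<kappa> (f e) = \<kappa> (f e')) \<and> (\<forall>j. \<exists>h. e' j = e j + 1 \<cdot> h)"
  then have "\<kappa> (f e) = \<kappa> (f e')" by simp
  then show "R (f e) \<longleftrightarrow> R (f e')" by (rule assms(2))
qed (simp_all add: assms(1))

text \<open>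
  The one-variable extension step, stated so that it covers ordered and pure groups. Two
  families of points \<open>u e\<close> and \<open>u e'\<close> whose differences look alike, up to shifts by at most \<open>n\<close> steps
  \<open>eps\<close>, are given, and \<open>x\<close> is placed among the first family. Either \<open>x\<close> is within \<open>n\<close> steps of a member,
  and then it is transferred by hand, or some element of its residue class is in the same position
  with respect to the second family.
\<close>

locale extension_property =
  fixes \<kappa> :: "'a::ab_group_add \<Rightarrow> 'k" and eps :: 'a
  assumes scale: "n \<noteq> 0 \<Longrightarrow> \<kappa> (n \<cdot> g) = \<kappa> (n \<cdot> h) \<longleftrightarrow> \<kappa> g = \<kappa> h"
    and separates_zero: "\<kappa> g = \<kappa> 0 \<Longrightarrow> g = 0"
    and extend: "finite L \<Longrightarrow> 0 < n \<Longrightarrow>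
      (\<And>u v s. u \<in> L \<Longrightarrow> v \<in> L \<Longrightarrow> \<bar>s\<bar> \<le> n \<Longrightarrow>
         \<kappa> (u e - v e + s \<cdot> eps) = \<kappa> (u e' - v e' + s \<cdot> eps)) \<Longrightarrow>
      (\<exists>u\<in>L. \<exists>s. \<bar>s\<bar> \<le> n \<and> x = u e + s \<cdot> eps) \<or>
      (\<exists>g. \<forall>u\<in>L. \<kappa> (x - u e) = \<kappa> (x + n \<cdot> g - (u :: (nat \<Rightarrow> 'a) \<Rightarrow> 'a) e'))"
begin

text \<open>
  For a single additional variable \<open>x\<close>, all affine forms can be given the same coefficient \<open>A\<close> at \<open>x\<close>, by
  taking a common multiple of their coefficients; those with coefficient 0 go to \<open>L0\<close>.
\<close>

lemma normalise:
  fixes F :: "((nat \<Rightarrow> 'a) \<Rightarrow> 'a) set"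
  assumes "finite F" "\<forall>f\<in>F. affine f"
  shows "\<exists>A L L0. 0 < A \<and> finite L \<and> finite L0 \<and> (\<forall>u\<in>L. affine u) \<and> (\<forall>v\<in>L0. affine v) \<and>
    (\<forall>e e' x x'. (\<forall>u\<in>L. \<kappa> (A \<cdot> x - u e) = \<kappa> (A \<cdot> x' - u e')) \<and> (\<forall>v\<in>L0. \<kappa> (v e) = \<kappa> (v e')) \<longrightarrow>
       (\<forall>f\<in>F. \<kappa> (f (case_nat x e)) = \<kappa> (f (case_nat x' e'))))"
  using assms
proof (induction F rule: finite_induct)
  case empty
  then show ?case by (intro exI[of _ 1] exI[of _ "{}"]) simp
next
  case (insert f F)
  from insert.IH insert.prems obtain A L L0 where AL: "0 < A" "finite L" "finite L0"
      "\<forall>u\<in>L. affine u" "\<forall>v\<in>L0. affine v"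
      and sig: "\<And>e e' x x'. (\<forall>u\<in>L. \<kappa> (A \<cdot> x - u e) = \<kappa> (A \<cdot> x' - u e')) \<Longrightarrow>
        (\<forall>v\<in>L0. \<kappa> (v e) = \<kappa> (v e')) \<Longrightarrow> \<forall>f\<in>F. \<kappa> (f (case_nat x e)) = \<kappa> (f (case_nat x' e'))"
    by auto
  obtain a g where g: "affine g" "\<And>x e. f (case_nat x e) = a \<cdot> x + g e"
    using affine_split_case_nat[of f] insert.prems by blast
  show ?case
  proof (cases "a = 0")
    case True
    show ?thesis
      using AL g sig True
      by (intro exI[of _ A] exI[of _ L] exI[of _ "insert g L0"]) auto
  next
    case False
    define B where "B = \<bar>a\<bar> * A"
    define L' where "L' = insert (\<lambda>e. (- (sgn a * A)) \<cdot> g e) ((\<lambda>u e. \<bar>a\<bar> \<cdot> u e) ` L)"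
    have B: "0 < B" using AL(1) False by (simp add: B_def)
    have L': "finite L'" "\<forall>u\<in>L'. affine u"
      using AL g by (auto simp: L'_def intro: affine_int_mult affine_uminus)
    have "\<forall>f'\<in>insert f F. \<kappa> (f' (case_nat x e)) = \<kappa> (f' (case_nat x' e'))"
      if h: "\<forall>u\<in>L'. \<kappa> (B \<cdot> x - u e) = \<kappa> (B \<cdot> x' - u e')" "\<forall>v\<in>L0. \<kappa> (v e) = \<kappa> (v e')" for e e' x x'
    proof -
      have "\<kappa> (A \<cdot> x - u e) = \<kappa> (A \<cdot> x' - u e')" if "u \<in> L" for u
      proof -
        have "\<kappa> (B \<cdot> x - \<bar>a\<bar> \<cdot> u e) = \<kappa> (B \<cdot> x' - \<bar>a\<bar> \<cdot> u e')"
          using h(1) that by (auto simp: L'_def)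
        then have "\<kappa> (\<bar>a\<bar> \<cdot> (A \<cdot> x - u e)) = \<kappa> (\<bar>a\<bar> \<cdot> (A \<cdot> x' - u e'))"
          by (simp add: B_def zm.scale_right_diff_distrib)
        then show ?thesis using scale[of "\<bar>a\<bar>"] False by simp
      qed
      then have "\<forall>f\<in>F. \<kappa> (f (case_nat x e)) = \<kappa> (f (case_nat x' e'))"
        using sig h(2) by blast
      moreover have "\<kappa> (f (case_nat x e)) = \<kappa> (f (case_nat x' e'))"
      proof -
        have eq: "B \<cdot> y - (- (sgn a * A)) \<cdot> g d = (sgn a * A) \<cdot> (a \<cdot> y + g d)" for y d
          by (simp add: B_def zm.scale_right_distrib abs_sgn mult.commute mult.left_commute)
        have "\<kappa> ((sgn a * A) \<cdot> (a \<cdot> x + g e)) = \<kappa> ((sgn a * A) \<cdot> (a \<cdot> x' + g e'))"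
          using h(1) unfolding L'_def eq[symmetric] by auto
        then show ?thesis
          using scale[of "sgn a * A"] False AL(1) g(2) by (simp add: sgn_eq_0_iff)
      qed
      ultimately show ?thesis by simp
    qed
    then show ?thesis
      using AL(3,5) L' B by (intro exI[of _ B] exI[of _ L'] exI[of _ L0] conjI allI impI) simp_all
  qed
qed

text \<open>
  Back and forth: a witness \<open>x\<close> for \<open>e\<close> is moved to a witness \<open>x + n g\<close> for \<open>e'\<close>. The modulus has to grow
  to \<open>A n\<close> because the walls bound \<open>A x\<close>, not \<open>x\<close>, and the new affine forms compare two walls with
  each other.
\<close>

lemma sigdet_ex:
  assumes "sigdet \<kappa> P"
  shows "sigdet \<kappa> (\<lambda>e. \<exists>x. P (case_nat x e))"
proof -
  obtain F n where "sigdet_by \<kappa> F n P" using assms unfolding sigdet_def by blast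
  note F = sigdet_byD[OF this]
  have "\<forall>f\<in>F. affine f" using F(2) by blast
  from normalise[OF F(1) this] obtain A L L0 where AL: "0 < A" "finite L" "finite L0"
      "\<forall>u\<in>L. affine u" "\<forall>v\<in>L0. affine v"
      and sig: "\<forall>e e' x x'. (\<forall>u\<in>L. \<kappa> (A \<cdot> x - u e) = \<kappa> (A \<cdot> x' - u e')) \<and>
        (\<forall>v\<in>L0. \<kappa> (v e) = \<kappa> (v e')) \<longrightarrow> (\<forall>f\<in>F. \<kappa> (f (case_nat x e)) = \<kappa> (f (case_nat x' e')))"
    by (elim exE conjE) (rule that)
  define N where "N = A * n"
  have N: "0 < N" using AL(1) F(3) by (simp add: N_def)
  define G where "G = L0 \<union> (\<lambda>(u, v, s) e. u e - v e + s \<cdot> eps) ` (L \<times> L \<times> {- N..N})"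
  have G: "finite G" "\<forall>f\<in>G. affine f"
    using AL by (auto simp: G_def intro!: affine_add affine_diff affine_const)
  have half: "\<exists>x'. P (case_nat x' e')"
    if k: "\<forall>f\<in>G. \<kappa> (f e) = \<kappa> (f e')" and c: "\<forall>j. \<exists>h. e' j = e j + N \<cdot> h"
      and P: "P (case_nat x e)" for e e' x
  proof -
    have k': "\<kappa> (u e - v e + s \<cdot> eps) = \<kappa> (u e' - v e' + s \<cdot> eps)"
      if "u \<in> L" "v \<in> L" "\<bar>s\<bar> \<le> N" for u v s
    proof -
      have "(\<lambda>e. u e - v e + s \<cdot> eps) \<in> G"
        unfolding G_def using that by (intro UnI2 image_eqI[of _ _ "(u, v, s)"]) auto
      then show ?thesis using k by auto
    qed
    have "(\<exists>u\<in>L. \<exists>s. \<bar>s\<bar> \<le> N \<and> A \<cdot> x = u e + s \<cdot> eps) \<or>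
      (\<exists>g. \<forall>u\<in>L. \<kappa> (A \<cdot> x - u e) = \<kappa> (A \<cdot> x + N \<cdot> g - u e'))"
      by (rule extend[OF AL(2) N]) (rule k')
    then have "\<exists>g. \<forall>u\<in>L. \<kappa> (A \<cdot> x - u e) = \<kappa> (A \<cdot> (x + n \<cdot> g) - u e')"
    proof
      assume "\<exists>g. \<forall>u\<in>L. \<kappa> (A \<cdot> x - u e) = \<kappa> (A \<cdot> x + N \<cdot> g - u e')"
      then show ?thesis
        by (simp add: N_def zm.scale_right_distrib)
    next
      assume "\<exists>u\<in>L. \<exists>s. \<bar>s\<bar> \<le> N \<and> A \<cdot> x = u e + s \<cdot> eps"
      then obtain u s where us: "u \<in> L" "\<bar>s\<bar> \<le> N" "A \<cdot> x = u e + s \<cdot> eps" by blast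
      obtain h where h: "u e' = u e + N \<cdot> h"
        using affine_congruent[OF AL(4)[rule_format, OF us(1)], of e' e N] c by blast
      have "\<kappa> (A \<cdot> x - v e) = \<kappa> (A \<cdot> (x + n \<cdot> h) - v e')" if "v \<in> L" for v
      proof -
        have "A \<cdot> (x + n \<cdot> h) - v e' = u e' - v e' + s \<cdot> eps"
          using us(3) h by (simp add: N_def zm.scale_right_distrib)
        moreover have "A \<cdot> x - v e = u e - v e + s \<cdot> eps"
          using us(3) by simp
        ultimately show ?thesis
          using k'[OF us(1) that us(2)] by (simp only:)
      qed
      then show ?thesis by blast
    qed
    then obtain g where g: "\<forall>u\<in>L. \<kappa> (A \<cdot> x - u e) = \<kappa> (A \<cdot> (x + n \<cdot> g) - u e')" by blast
    have "\<forall>v\<in>L0. \<kappa> (v e) = \<kappa> (v e')" using k by (simp add: G_def)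
    with sig g have "\<forall>f\<in>F. \<kappa> (f (case_nat x e)) = \<kappa> (f (case_nat (x + n \<cdot> g) e'))" by blast
    moreover have "\<exists>h. case_nat (x + n \<cdot> g) e' j = case_nat x e j + n \<cdot> h" for j
    proof (cases j)
      case (Suc i)
      obtain h where "e' i = e i + N \<cdot> h" using c by blast
      then show ?thesis
        using Suc by (intro exI[of _ "A \<cdot> h"]) (simp add: N_def mult.commute)
    qed auto
    ultimately have "P (case_nat (x + n \<cdot> g) e')"
      using F(4)[of "case_nat x e" "case_nat (x + n \<cdot> g) e'"] P by blast
    then show ?thesis by blast
  qed
  have "(\<exists>x. P (case_nat x e)) \<longleftrightarrow> (\<exists>x. P (case_nat x e'))"
    if k: "\<forall>f\<in>G. \<kappa> (f e) = \<kappa> (f e')" and c: "\<forall>j. \<exists>h. e' j = e j + N \<cdot> h" for e e'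
  proof -
    have "\<exists>h. e j = e' j + N \<cdot> h" for j
    proof -
      obtain h where "e' j = e j + N \<cdot> h" using c by blast
      then show ?thesis by (intro exI[of _ "- h"]) simp
    qed
    then have "\<forall>j. \<exists>h. e j = e' j + N \<cdot> h" by blast
    moreover have "\<forall>f\<in>G. \<kappa> (f e') = \<kappa> (f e)" using k by simp
    ultimately show ?thesis
      using half[OF k c] half[of e' e] by blast
  qed
  then show ?thesis
    unfolding sigdet_def sigdet_by_def using G N by (intro exI[of _ G] exI[of _ N]) simp
qed

lemma sigdet_sat:
  assumes trms: "\<And>t. wf_trm N t \<Longrightarrow> affine (\<lambda>e. val N e t)"
    and rel: "\<And>r ts. wf_form N (Rel r ts) \<Longrightarrow> sigdet \<kappa> (\<lambda>e. sat N e (Rel r ts))"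
  shows "wf_form N \<phi> \<Longrightarrow> sigdet \<kappa> (\<lambda>e. sat N e \<phi>)"
proof (induction \<phi>)
  case (Eq s t)
  have "sigdet \<kappa> (\<lambda>e. val N e s - val N e t = 0)"
  proof (rule sigdet_affine)
    show "affine (\<lambda>e. val N e s - val N e t)"
      using Eq trms by (auto intro: affine_diff)
    show "(g = 0) = (h = 0)" if "\<kappa> g = \<kappa> h" for g h
      using that separates_zero[of g] separates_zero[of h] by metis
  qed
  then show ?case by simp
next
  case (Rel r ts)
  then show ?case by (rule rel)
next
  case (Neg \<phi>)
  then show ?case using sigdet_neg by simp
next
  case (Conj \<phi> \<psi>)
  then show ?case using sigdet_conj by simp
next
  case (Exists \<phi>)
  then show ?case using sigdet_ex by simp
qed

lemma pdef_sigdet: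
  assumes trms: "\<And>t. wf_trm N t \<Longrightarrow> affine (\<lambda>e. val N e t)"
    and rel: "\<And>r ts. wf_form N (Rel r ts) \<Longrightarrow> sigdet \<kappa> (\<lambda>e. sat N e (Rel r ts))"
    and P: "pdef N P"
  shows "sigdet \<kappa> P"
proof -
  obtain \<phi> \<sigma> where p: "wf_form N \<phi>" "\<And>e. P e \<longleftrightarrow> sat N (\<lambda>i. source e (\<sigma> i)) \<phi>"
    using P unfolding pdef_def by blast
  show ?thesis
    using sigdet_subst[OF sigdet_sat[OF trms rel p(1)], of \<sigma>] by (simp add: p(2)[abs_def])
qed

end

section \<open>Regular ordered abelian groups\<close>

text \<open>
  The sign of an element, encoded without reference to a ring structure.
\<close>

definition sgn3 :: "'a::linordered_ab_group_add \<Rightarrow> bool \<times> bool" where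
  "sgn3 g = (g < 0, 0 < g)"

lemma sgn3_eq_iff: "sgn3 g = sgn3 h \<longleftrightarrow> (g < 0 \<longleftrightarrow> h < 0) \<and> (0 < g \<longleftrightarrow> 0 < h)"
  by (simp add: sgn3_def)

lemma sgn3_int_mult:
  fixes g h :: "'a::linordered_ab_group_add"
  assumes "n \<noteq> 0"
  shows "sgn3 (n \<cdot> g) = sgn3 (n \<cdot> h) \<longleftrightarrow> sgn3 g = sgn3 h"
proof -
  have *: "sgn3 (k \<cdot> g) = sgn3 (k \<cdot> h) \<longleftrightarrow> sgn3 g = sgn3 h" if "0 < k" for k
    using int_mult_less_iff[OF that, of "0 :: 'a"] int_mult_less_iff[OF that, of _ "0 :: 'a"]
    by (simp add: sgn3_eq_iff)
  show ?thesis
  proof (cases "0 < n")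
    case False
    with assms have "0 < - n" by simp
    from *[OF this] show ?thesis by (auto simp: sgn3_eq_iff)
  qed (rule *)
qed

text \<open>
  \<open>eps\<close> is the least positive element or 0. In the latter case the regularity axiom says that the
  cosets of \<open>nG\<close> are dense, in the former that every \<open>n\<close> consecutive elements represent all
  cosets.
\<close>

locale regular_group =
  fixes eps :: "'a::linordered_ab_group_add"
  assumes eps_nonneg: "0 \<le> eps"
    and eps_least: "0 < eps \<Longrightarrow> 0 < x \<Longrightarrow> eps \<le> x"
    and regular: "0 < n \<Longrightarrow> \<alpha> + n \<cdot> eps < \<beta> \<Longrightarrow> \<exists>g. \<alpha> < c + n \<cdot> g \<and> c + n \<cdot> g < \<beta>"
    and finite_index: "0 < n \<Longrightarrow> \<exists>R. finite R \<and> (\<forall>x :: 'a. \<exists>r\<in>R. \<exists>h. x = n \<cdot> h + r)"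
    and nontrivial: "\<exists>x :: 'a. 0 < x"
begin

text \<open>
  In a discrete group \<open>eps\<close> itself is as small as possible; in a dense one there are arbitrarily small
  positive elements. Choosing \<open>\<eta>\<close> with this lemma avoids the case distinction later.
\<close>

lemma small_step:
  assumes "0 \<le> n" "n \<cdot> eps < \<mu>"
  obtains \<eta> where "0 < \<eta>" "eps \<le> \<eta>" "n \<cdot> \<eta> < \<mu>"
proof (cases "0 < eps")
  case True
  then show thesis using that[of eps] assms by simp
next
  case False
  with eps_nonneg have e: "eps = 0" by simp
  show thesis
  proof (cases "n = 0")
    case True
    obtain x :: 'a where "0 < x" using nontrivial by blast
    then show thesis using that[of x] e True assms by simp
  next
    case False
    then have n: "0 < n" using assms(1) by simp
    have "0 + n \<cdot> eps < \<mu>" using assms(2) by simp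
    from regular[OF n this, of 0] obtain g where g: "0 < n \<cdot> g" "n \<cdot> g < \<mu>" by auto
    then have "0 < g" using int_mult_less_iff[OF n, of 0 g] by simp
    with g show thesis using that[of g] e by simp
  qed
qed

lemma near_zero_nonneg: "0 \<le> g \<Longrightarrow> g \<le> int b \<cdot> eps \<Longrightarrow> \<exists>s. 0 \<le> s \<and> s \<le> int b \<and> g = s \<cdot> eps"
proof (induction b arbitrary: g)
  case 0
  then show ?case by (intro exI[of _ 0]) simp
next
  case (Suc b)
  show ?case
  proof (cases "g = 0")
    case True
    then show ?thesis by (intro exI[of _ 0]) simp
  next
    case False
    then have "0 < g" using Suc.prems(1) by simp
    then have "eps \<le> g" using eps_least eps_nonneg by (cases "eps = 0") auto
    moreover have "g - eps \<le> int b \<cdot> eps"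
      using Suc.prems(2) by (simp add: int_mult_add_one add.commute[of 1] diff_le_eq)
    ultimately obtain s where "0 \<le> s" "s \<le> int b" "g - eps = s \<cdot> eps"
      using Suc.IH[of "g - eps"] by auto
    then show ?thesis
      by (intro exI[of _ "s + 1"]) (simp add: int_mult_add_one diff_eq_eq)
  qed
qed

text \<open>
  In a discrete group the elements from 0 on are counted off in steps of \<open>eps\<close>. For \<open>eps = 0\<close> the
  statement reads \<open>g = 0\<close>, which lets arguments about walls cover the dense case as well.
\<close>

lemma near_zero:
  assumes "- (b \<cdot> eps) \<le> g" "g \<le> b \<cdot> eps" "0 \<le> b"
  shows "\<exists>s. \<bar>s\<bar> \<le> b \<and> g = s \<cdot> eps"
proof (cases "0 \<le> g")
  case True
  then obtain s where "0 \<le> s \<and> s \<le> int (nat b) \<and> g = s \<cdot> eps"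
    using near_zero_nonneg[of g "nat b"] assms by auto
  then show ?thesis using assms(3) by (intro exI[of _ s]) simp
next
  case False
  have "- g \<le> b \<cdot> eps" using assms(1) by (simp add: minus_le_iff)
  then obtain s where "0 \<le> s \<and> s \<le> int (nat b) \<and> - g = s \<cdot> eps"
    using near_zero_nonneg[of "- g" "nat b"] assms False by (auto simp: not_le intro: less_imp_le)
  then show ?thesis
    using assms(3) by (intro exI[of _ "- s"]) (auto simp: minus_equation_iff[of g])
qed

text \<open>
  Regularity for cuts instead of intervals; an empty side is replaced by a point far enough away.
\<close>

lemma fill_cut:
  assumes "finite U" "finite V" "0 < n" "\<And>u v. u \<in> U \<Longrightarrow> v \<in> V \<Longrightarrow> u + n \<cdot> eps < v"
  shows "\<exists>g. (\<forall>u\<in>U. u < c + n \<cdot> g) \<and> (\<forall>v\<in>V. c + n \<cdot> g < v)"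
proof -
  obtain p :: 'a where p: "0 < p" using nontrivial by blast
  have "\<exists>\<alpha> \<beta>. (\<forall>u\<in>U. u \<le> \<alpha>) \<and> (\<forall>v\<in>V. \<beta> \<le> v) \<and> \<alpha> + n \<cdot> eps < \<beta>"
  proof (cases "U = {}")
    case U: True
    show ?thesis
    proof (cases "V = {}")
      case True
      show ?thesis
        by (rule exI[of _ 0], rule exI[of _ "n \<cdot> eps + p"]) (simp add: U True p)
    next
      case False
      show ?thesis
        by (rule exI[of _ "Min V - n \<cdot> eps - p"], rule exI[of _ "Min V"])
           (use assms(2) U False p Min_le[OF assms(2)] in \<open>auto simp: diff_less_eq intro: le_less_trans less_imp_le\<close>)
    qed
  next
    case U: False
    show ?thesis
    proof (cases "V = {}")
      case True
      show ?thesis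
        by (rule exI[of _ "Max U"], rule exI[of _ "Max U + n \<cdot> eps + p"])
           (use assms(1) U True p in auto)
    next
      case False
      show ?thesis
        by (rule exI[of _ "Max U"], rule exI[of _ "Min V"]) (use assms U False in simp)
    qed
  qed
  then obtain \<alpha> \<beta> where *: "\<forall>u\<in>U. u \<le> \<alpha>" "\<forall>v\<in>V. \<beta> \<le> v" "\<alpha> + n \<cdot> eps < \<beta>" by blast
  obtain g where "\<alpha> < c + n \<cdot> g" "c + n \<cdot> g < \<beta>" using regular[OF assms(3) *(3)] by blast
  with * show ?thesis by (intro exI[of _ g]) force
qed

text \<open>
  Otherwise the set would be contained in the finitely many \<open>a + s eps\<close> with \<open>-n \<le> s \<le> n\<close>.
\<close>

lemma infinite_far_apart:
  assumes "infinite J"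
  obtains \<alpha> \<beta> where "\<alpha> \<in> J" "\<beta> \<in> J" "\<alpha> + int n \<cdot> eps < \<beta>"
proof -
  have "\<exists>\<alpha>\<in>J. \<exists>\<beta>\<in>J. \<alpha> + int n \<cdot> eps < \<beta>"
  proof (rule ccontr)
    assume "\<not> ?thesis"
    then have close: "\<beta> \<le> \<alpha> + int n \<cdot> eps" if "\<alpha> \<in> J" "\<beta> \<in> J" for \<alpha> \<beta>
      using that by (meson linorder_not_le)
    obtain a where a: "a \<in> J" using assms by (metis finite.emptyI ex_in_conv)
    have "J \<subseteq> (\<lambda>s. a + s \<cdot> eps) ` {- int n..int n}"
    proof
      fix b assume b: "b \<in> J"
      have "\<exists>s. \<bar>s\<bar> \<le> int n \<and> b - a = s \<cdot> eps"
      proof (rule near_zero)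
        show "- (int n \<cdot> eps) \<le> b - a"
          using close[OF b a] by (simp add: algebra_simps)
        show "b - a \<le> int n \<cdot> eps"
          using close[OF a b] by (simp add: algebra_simps)
      qed simp
      then obtain s where s: "\<bar>s\<bar> \<le> int n" "b - a = s \<cdot> eps" by blast
      then show "b \<in> (\<lambda>s. a + s \<cdot> eps) ` {- int n..int n}"
        by (intro image_eqI[of _ _ s]) (auto simp: diff_eq_eq add.commute)
    qed
    then have "finite J" by (rule finite_subset) simp
    with assms show False by simp
  qed
  then show thesis using that by blast
qed

lemma infinite_UNIV_group: "infinite (UNIV :: 'a set)"
proof
  assume fin: "finite (UNIV :: 'a set)"
  obtain p :: 'a where p: "0 < p" using nontrivial by blast
  have "Max UNIV + p \<le> Max UNIV" by (rule Max_ge[OF fin]) simp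
  with p show False by simp
qed

end

text \<open>
  If \<open>x\<close> is far from all points of the first family, then the points below \<open>x\<close> and those above \<open>x\<close> are
  separated by more than \<open>n eps\<close>. This is visible to \<open>\<kappa>\<close>, hence also holds for the second family, and
  regularity finds an element of the residue class in the gap.
\<close>

sublocale regular_group \<subseteq> oag: extension_property sgn3 eps
proof
  fix n :: int and g h :: 'a
  show "n \<noteq> 0 \<Longrightarrow> (sgn3 (n \<cdot> g) = sgn3 (n \<cdot> h)) = (sgn3 g = sgn3 h)"
    by (rule sgn3_int_mult)
  show "sgn3 g = sgn3 0 \<Longrightarrow> g = 0"
    by (simp add: sgn3_eq_iff) (meson linorder_neqE)
next
  fix L :: "((nat \<Rightarrow> 'a) \<Rightarrow> 'a) set" and n :: int and e e' x
  assume L: "finite L" and n: "0 < n"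
    and k: "\<And>u v s. u \<in> L \<Longrightarrow> v \<in> L \<Longrightarrow> \<bar>s\<bar> \<le> n \<Longrightarrow>
       sgn3 (u e - v e + s \<cdot> eps) = sgn3 (u e' - v e' + s \<cdot> eps)"
  show "(\<exists>u\<in>L. \<exists>s. \<bar>s\<bar> \<le> n \<and> x = u e + s \<cdot> eps) \<or>
      (\<exists>g. \<forall>u\<in>L. sgn3 (x - u e) = sgn3 (x + n \<cdot> g - u e'))"
  proof (rule disjCI)
    assume no: "\<not> (\<exists>g. \<forall>u\<in>L. sgn3 (x - u e) = sgn3 (x + n \<cdot> g - u e'))"
    show "\<exists>u\<in>L. \<exists>s. \<bar>s\<bar> \<le> n \<and> x = u e + s \<cdot> eps"
    proof (rule ccontr)
      assume far: "\<not> (\<exists>u\<in>L. \<exists>s. \<bar>s\<bar> \<le> n \<and> x = u e + s \<cdot> eps)"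
      have ne: "x \<noteq> u e" if "u \<in> L" for u
        using far that n by (metis abs_zero add.right_neutral less_imp_le zm.scale_zero_left)
      define U where "U = {u\<in>L. u e < x}"
      define V where "V = {u\<in>L. x < u e}"
      have "u e' + n \<cdot> eps < v e'" if "u \<in> U" "v \<in> V" for u v
      proof -
        have "u e + n \<cdot> eps < x"
        proof (rule ccontr)
          assume "\<not> u e + n \<cdot> eps < x"
          then have "x - u e \<le> n \<cdot> eps" by (simp add: algebra_simps)
          moreover have "- (n \<cdot> eps) \<le> x - u e"
          proof -
            have "0 \<le> n \<cdot> eps" using n eps_nonneg by (intro int_mult_nonneg) auto
            then have "- (n \<cdot> eps) \<le> 0" by simp
            also have "0 \<le> x - u e" using that by (simp add: U_def less_imp_le)
            finally show ?thesis .
          qed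
          ultimately have "\<exists>s. \<bar>s\<bar> \<le> n \<and> x - u e = s \<cdot> eps"
            using n by (intro near_zero) simp_all
          then show False using far that(1) by (auto simp: U_def diff_eq_eq add.commute)
        qed
        also have "x < v e" using that by (simp add: V_def)
        finally have "u e - v e + n \<cdot> eps < 0" by (simp add: algebra_simps)
        then have "u e' - v e' + n \<cdot> eps < 0"
          using k[of u v n] that n by (simp add: U_def V_def sgn3_eq_iff)
        then show ?thesis by (simp add: algebra_simps)
      qed
      then have "\<exists>g. (\<forall>a\<in>(\<lambda>u. u e') ` U. a < x + n \<cdot> g) \<and> (\<forall>b\<in>(\<lambda>u. u e') ` V. x + n \<cdot> g < b)"
        using L n by (intro fill_cut) (auto simp: U_def V_def)
      then obtain g where g: "\<And>u. u \<in> U \<Longrightarrow> u e' < x + n \<cdot> g" "\<And>v. v \<in> V \<Longrightarrow> x + n \<cdot> g < v e'"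
        by auto
      have "sgn3 (x - u e) = sgn3 (x + n \<cdot> g - u e')" if u: "u \<in> L" for u
      proof (cases "u e < x")
        case True
        with g(1)[of u] u show ?thesis by (auto simp: sgn3_eq_iff U_def)
      next
        case False
        then have "x < u e" using ne[OF u] by simp
        with g(2)[of u] u show ?thesis by (auto simp: sgn3_eq_iff V_def)
      qed
      with no show False by blast
    qed
  qed
qed

text \<open>
  Without the order it suffices to avoid finitely many elements, and residue classes are infinite.
\<close>

sublocale regular_group \<subseteq> grp: extension_property "\<lambda>g. g = (0 :: 'a)" 0
proof
  fix n :: int and g h :: 'a
  show "n \<noteq> 0 \<Longrightarrow> ((n \<cdot> g = 0) = (n \<cdot> h = 0)) = ((g = 0) = (h = 0))"
    by (simp add: int_mult_eq_0_iff)
  show "(g = 0) = (0 = (0 :: 'a)) \<Longrightarrow> g = 0"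
    by simp
next
  fix L :: "((nat \<Rightarrow> 'a) \<Rightarrow> 'a) set" and n :: int and e e' x
  assume L: "finite L" and n: "0 < n"
  show "(\<exists>u\<in>L. \<exists>s. \<bar>s\<bar> \<le> n \<and> x = u e + s \<cdot> 0) \<or>
      (\<exists>g. \<forall>u\<in>L. (x - u e = 0) = (x + n \<cdot> g - u e' = 0))"
  proof (rule disjCI)
    assume no: "\<not> (\<exists>g. \<forall>u\<in>L. (x - u e = 0) = (x + n \<cdot> g - u e' = 0))"
    have "inj (\<lambda>g. x + n \<cdot> g)"
      using n by (simp add: inj_def int_mult_eq_iff)
    then have "infinite (range (\<lambda>g. x + n \<cdot> g))"
      using infinite_UNIV_group finite_imageD by blast
    then have "\<not> range (\<lambda>g. x + n \<cdot> g) \<subseteq> (\<lambda>u. u e') ` L"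
      using L finite_subset by blast
    then obtain g where "\<forall>u\<in>L. x + n \<cdot> g \<noteq> u e'" by auto
    with no obtain u where "u \<in> L" "x = u e" by auto
    then show "\<exists>u\<in>L. \<exists>s. \<bar>s\<bar> \<le> n \<and> x = u e + s \<cdot> 0"
      using n by (intro bexI[of _ u] exI[of _ 0]) auto
  qed
qed

lemma wf_trm_plus_affine:
  assumes "funs N = {(Plus, 2)}" "fun_of N = (\<lambda>_ xs. xs ! 0 + xs ! 1)" "wf_trm N t"
  shows "affine (\<lambda>e. val N e t)"
  using assms(3)
proof (induction t)
  case (Var i)
  then show ?case by (simp add: affine_var)
next
  case (Fn f ts)
  then have "length ts = 2" using assms(1) by simp
  then obtain s t where ts: "ts = [s, t]"
    by (metis (no_types, opaque_lifting) One_nat_def Suc_1 length_0_conv length_Suc_conv)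
  with Fn have "affine (\<lambda>e. val N e s)" "affine (\<lambda>e. val N e t)"
    by simp_all
  then show ?case
    using ts by (simp add: assms(2) affine_add)
qed

context regular_group
begin

lemma oag_pdef_sigdet:
  assumes "pdef (oag_structure :: 'a oag_type) P"
  shows "sigdet sgn3 P"
proof (rule oag.pdef_sigdet[OF _ _ assms])
  fix t assume "wf_trm (oag_structure :: 'a oag_type) t"
  then show "affine (\<lambda>e. val (oag_structure :: 'a oag_type) e t)"
    by (intro wf_trm_plus_affine) (simp_all add: oag_structure_def)
next
  fix r ts assume wf: "wf_form (oag_structure :: 'a oag_type) (Rel r ts)"
  let ?N = "oag_structure :: 'a oag_type"
  have "length ts = 2" using wf by (simp add: oag_structure_def)
  then obtain s t where ts: "ts = [s, t]"
    by (metis (no_types, opaque_lifting) One_nat_def Suc_1 length_0_conv length_Suc_conv)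
  have "affine (\<lambda>e. val ?N e s)" "affine (\<lambda>e. val ?N e t)"
    using wf ts by (auto intro!: wf_trm_plus_affine simp: oag_structure_def)
  then have "sigdet sgn3 (\<lambda>e. val ?N e s - val ?N e t < 0)"
    by (intro sigdet_affine affine_diff) (simp_all add: sgn3_eq_iff)
  then show "sigdet sgn3 (\<lambda>e. sat ?N e (Rel r ts))"
    using ts by (simp add: oag_structure_def)
qed

lemma group_pdef_sigdet:
  assumes "pdef (group_structure :: 'a oag_type) P"
  shows "sigdet (\<lambda>g. g = 0) P"
proof (rule grp.pdef_sigdet[OF _ _ assms])
  fix t assume "wf_trm (group_structure :: 'a oag_type) t"
  then show "affine (\<lambda>e. val (group_structure :: 'a oag_type) e t)"
    by (intro wf_trm_plus_affine) (simp_all add: group_structure_def)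
qed (simp add: group_structure_def)

end

section \<open>Transfer of regularity along elementary equivalence\<close>

abbreviation (input) plus_trm :: "oag_fun trm \<Rightarrow> oag_fun trm \<Rightarrow> oag_fun trm" where
  "plus_trm s t \<equiv> Fn Plus [s, t]"

abbreviation (input) less_form :: "oag_fun trm \<Rightarrow> oag_fun trm \<Rightarrow> (oag_fun, oag_rel) form" where
  "less_form s t \<equiv> Rel Less [s, t]"

abbreviation (input) Imp :: "('f, 'r) form \<Rightarrow> ('f, 'r) form \<Rightarrow> ('f, 'r) form" where
  "Imp \<phi> \<psi> \<equiv> Neg (Conj \<phi> (Neg \<psi>))"

abbreviation (input) All :: "('f, 'r) form \<Rightarrow> ('f, 'r) form" where
  "All \<phi> \<equiv> Neg (Exists (Neg \<phi>))"

text \<open>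
  Terms for the positive multiples \<open>(n + 1) t\<close>; the language has no constant 0.
\<close>

primrec mult_trm :: "nat \<Rightarrow> oag_fun trm \<Rightarrow> oag_fun trm" where
  "mult_trm 0 t = t"
| "mult_trm (Suc n) t = plus_trm (mult_trm n t) t"

text \<open>
  Variable 0 stands for \<open>eps\<close>; the truth condition is \<open>is_step\<close> below. The group laws allow to
  express \<open>0 < x\<close> by \<open>x < x + x\<close>, and \<open>x = 0\<close> by \<open>x + x = x\<close>.
\<close>

definition step_form :: "(oag_fun, oag_rel) form" where
  "step_form =
     Neg (Conj
       (Neg (Conj (less_form (Var 0) (plus_trm (Var 0) (Var 0)))
          (All (Imp (less_form (Var 0) (plus_trm (Var 0) (Var 0))) (Neg (less_form (Var 0) (Var 1)))))))
       (Neg (Conj (Eq (plus_trm (Var 0) (Var 0)) (Var 0))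
          (All (Imp (less_form (Var 0) (plus_trm (Var 0) (Var 0)))
             (Exists (Conj (less_form (Var 0) (plus_trm (Var 0) (Var 0))) (less_form (Var 0) (Var 1)))))))))"

text \<open>
  After the quantifiers the variables 3, 2, 1, 0 stand for \<open>eps\<close>, the coset representative, the upper
  and the lower end of the interval. Quantifying over all elements that satisfy \<open>step_form\<close>
  replaces a constant for \<open>eps\<close>.
\<close>

definition regular_form :: "nat \<Rightarrow> (oag_fun, oag_rel) form" where
  "regular_form n =
     All (Imp step_form (All (All (All (
       Imp (less_form (plus_trm (Var 0) (mult_trm n (Var 3))) (Var 1))
         (Exists (Conj (less_form (Var 1) (plus_trm (Var 3) (mult_trm n (Var 0))))
           (less_form (plus_trm (Var 3) (mult_trm n (Var 0))) (Var 2)))))))))"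

primrec exs :: "nat \<Rightarrow> ('f, 'r) form \<Rightarrow> ('f, 'r) form" where
  "exs 0 \<phi> = \<phi>"
| "exs (Suc r) \<phi> = Exists (exs r \<phi>)"

primrec no_rep_form :: "nat \<Rightarrow> nat \<Rightarrow> (oag_fun, oag_rel) form" where
  "no_rep_form n 0 = Eq (Var 0) (Var 0)"
| "no_rep_form n (Suc r) = Conj (no_rep_form n r)
     (Neg (Exists (Eq (Var 1) (plus_trm (mult_trm n (Var 0)) (Var (r + 2))))))"

text \<open>
  Says that \<open>r\<close> elements represent all cosets modulo \<open>n + 1\<close>: the outer quantifiers provide the
  representatives, and no element avoids all their cosets.
\<close>

definition index_form :: "nat \<Rightarrow> nat \<Rightarrow> (oag_fun, oag_rel) form" where
  "index_form n r = exs r (Neg (Exists (no_rep_form n r)))"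

lemma oag_simps [simp]:
  "funs oag_structure = {(Plus, 2)}" "rels oag_structure = {(Less, 2)}"
  "fun_of oag_structure f xs = xs ! 0 + xs ! 1" "rel_of oag_structure r xs = (xs ! 0 < xs ! 1)"
  by (simp_all add: oag_structure_def)

lemma val_mult_trm: "val oag_structure e (mult_trm n t) = int (Suc n) \<cdot> val oag_structure e t"
proof (induction n)
  case 0
  then show ?case by (simp add: int_mult_one)
next
  case (Suc n)
  have "int (Suc (Suc n)) = int (Suc n) + 1" by simp
  with Suc show ?case by (simp only: int_mult_add_one) simp
qed

lemma fv_mult_trm: "fv_trm (mult_trm n t) = fv_trm t"
  by (induction n) auto

lemma wf_mult_trm: "funs M = {(Plus, 2)} \<Longrightarrow> wf_trm M (mult_trm n t) = wf_trm M t"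
  by (induction n) auto

definition is_step :: "'a::linordered_ab_group_add \<Rightarrow> bool" where
  "is_step z \<longleftrightarrow> (0 < z \<and> (\<forall>x>0. z \<le> x)) \<or> (z = 0 \<and> (\<forall>x::'a>0. \<exists>y>0. y < x))"

lemma sat_step_form:
  fixes e :: "nat \<Rightarrow> 'a::linordered_ab_group_add"
  shows "sat oag_structure e step_form \<longleftrightarrow> is_step (e 0)"
proof -
  have "sat oag_structure e step_form \<longleftrightarrow>
     (0 < e 0 \<and> (\<forall>a>0. \<not> a < e 0)) \<or> (e 0 = 0 \<and> (\<forall>a::'a>0. \<exists>b>0. b < a))"
    by (simp add: step_form_def del: not_less)
  then show ?thesis by (simp only: is_step_def not_less)
qed

lemma sat_regular_form:
  "sat oag_structure (e :: nat \<Rightarrow> 'a::linordered_ab_group_add) (regular_form n) \<longleftrightarrow>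
     (\<forall>z::'a. is_step z \<longrightarrow> (\<forall>c \<beta> \<alpha>. \<alpha> + int (Suc n) \<cdot> z < \<beta> \<longrightarrow>
        (\<exists>g. \<alpha> < c + int (Suc n) \<cdot> g \<and> c + int (Suc n) \<cdot> g < \<beta>)))"
  unfolding regular_form_def
  by (simp add: sat_step_form val_mult_trm numeral_2_eq_2 numeral_3_eq_3 del: of_nat_Suc)

lemma sat_exs:
  "sat M e (exs r \<phi>) \<longleftrightarrow> (\<exists>xs. length xs = r \<and> sat M (\<lambda>i. if i < r then xs ! i else e (i - r)) \<phi>)"
proof (induction r arbitrary: e)
  case 0
  then show ?case by simp
next
  case (Suc r)
  have *: "(\<lambda>i. if i < r then xs ! i else case_nat a e (i - r)) =
     (\<lambda>i. if i < Suc r then (xs @ [a]) ! i else e (i - Suc r))" if "length xs = r" for xs a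
  proof
    fix i
    show "(if i < r then xs ! i else case_nat a e (i - r)) =
      (if i < Suc r then (xs @ [a]) ! i else e (i - Suc r))"
    proof (cases "i \<le> r")
      case True
      then show ?thesis using that by (auto simp: nth_append)
    next
      case False
      then have "i - r = Suc (i - Suc r)" by simp
      with False show ?thesis by simp
    qed
  qed
  have "sat M e (exs (Suc r) \<phi>) \<longleftrightarrow>
     (\<exists>a xs. length xs = r \<and> sat M (\<lambda>i. if i < Suc r then (xs @ [a]) ! i else e (i - Suc r)) \<phi>)"
    using * by (simp add: Suc.IH cong: conj_cong)
  also have "\<dots> \<longleftrightarrow> (\<exists>ys. length ys = Suc r \<and> sat M (\<lambda>i. if i < Suc r then ys ! i else e (i - Suc r)) \<phi>)"
    by (auto simp: length_Suc_conv_rev)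
  finally show ?case .
qed

lemma sat_no_rep_form:
  "sat oag_structure e (no_rep_form n r) \<longleftrightarrow>
     (\<forall>i<r. \<not> (\<exists>h. e 0 = int (Suc n) \<cdot> h + e (Suc i)))"
  by (induction r) (auto simp: val_mult_trm less_Suc_eq simp del: of_nat_Suc)

lemma sat_index_form:
  "sat oag_structure (e :: nat \<Rightarrow> 'a::linordered_ab_group_add) (index_form n r) \<longleftrightarrow>
     (\<exists>xs. length xs = r \<and> (\<forall>x::'a. \<exists>i<r. \<exists>h. x = int (Suc n) \<cdot> h + xs ! i))"
  unfolding index_form_def sat_exs
  by (intro ex_cong conj_cong refl) (simp add: sat_no_rep_form del: of_nat_Suc)

lemma closed_regular_form: "wf_form oag_structure (regular_form n)" "fv (regular_form n) = {}"
proof -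
  have "fv step_form = {0}" by (auto simp: step_form_def)
  then show "fv (regular_form n) = {}"
    by (auto simp: regular_form_def fv_mult_trm numeral_2_eq_2 numeral_3_eq_3)
qed (simp add: regular_form_def step_form_def wf_mult_trm)

lemma wf_exs: "wf_form M (exs r \<phi>) = wf_form M \<phi>"
  by (induction r) auto

lemma fv_exs: "fv (exs r \<phi>) = {i. i + r \<in> fv \<phi>}"
  by (induction r) auto

lemma closed_index_form: "wf_form oag_structure (index_form n r)" "fv (index_form n r) = {}"
proof -
  show "wf_form oag_structure (index_form n r)"
    unfolding index_form_def wf_exs wf_form.simps
    by (induction r) (auto simp: wf_mult_trm)
  have "fv (no_rep_form n r) \<subseteq> {..r}"
    by (induction r) (auto simp: fv_mult_trm)
  then show "fv (index_form n r) = {}"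
    by (fastforce simp: index_form_def fv_exs)
qed

lemma ex_is_step: "\<exists>z :: 'a::linordered_ab_group_add. is_step z"
proof (cases "\<exists>z::'a. 0 < z \<and> (\<forall>x>0. z \<le> x)")
  case False
  then have "is_step (0::'a)" unfolding is_step_def by (meson not_le)
  then show ?thesis ..
qed (auto simp: is_step_def)

text \<open>
  It is enough to find a positive element of \<open>nG\<close> that is smaller than the length of the interval: the archimedean property then provides its first multiple that, shifted by \<open>c\<close>, lies beyond the lower end. In a dense group
  a small enough element is obtained by repeated halving.
\<close>

lemma archimedean_regular:
  fixes z \<alpha> \<beta> c :: "'b::linordered_ab_group_add"
  assumes arch: "archimedean_group TYPE('b)" and z: "is_step z" and n: "0 < n"
    and lt: "\<alpha> + n \<cdot> z < \<beta>"
  shows "\<exists>g. \<alpha> < c + n \<cdot> g \<and> c + n \<cdot> g < \<beta>"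
proof -
  have "\<exists>\<delta>>0. n \<cdot> \<delta> < \<beta> - \<alpha>"
  proof (cases "0 < z")
    case True
    then show ?thesis using lt by (intro exI[of _ z]) (simp add: algebra_simps)
  next
    case False
    with z have z0: "z = 0" and dense: "\<And>x::'b. 0 < x \<Longrightarrow> \<exists>y>0. y < x"
      unfolding is_step_def by auto
    have halve: "\<exists>y>0. 2 \<cdot> y \<le> x" if x: "0 < x" for x :: 'b
    proof -
      obtain y where y: "0 < y" "y < x" using dense[OF x] by blast
      have two: "2 \<cdot> w = w + w" for w :: 'b
        using int_mult_add_one[of 1 w] by (simp add: int_mult_one)
      show ?thesis
      proof (cases "2 \<cdot> y \<le> x")
        case False
        then have "2 \<cdot> (x - y) \<le> x" unfolding two by (simp add: algebra_simps)
        then show ?thesis using y by (intro exI[of _ "x - y"]) simp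
      qed (use y in blast)
    qed
    have pow: "\<exists>y>0. (2 ^ k) \<cdot> y \<le> x" if "0 < x" for x :: 'b and k
      using that
    proof (induction k arbitrary: x)
      case 0
      then show ?case by (auto simp: int_mult_one)
    next
      case (Suc k)
      obtain y where y: "0 < y" "2 \<cdot> y \<le> x" using halve[OF Suc.prems] by blast
      obtain w where w: "0 < w" "(2 ^ k) \<cdot> w \<le> y" using Suc.IH[OF y(1)] by blast
      have "(2 ^ Suc k) \<cdot> w = 2 \<cdot> ((2 ^ k) \<cdot> w)" by simp
      also have "\<dots> \<le> 2 \<cdot> y" using w(2) int_mult_le_iff[of 2 "(2 ^ k) \<cdot> w" y] by simp
      finally show ?case using y w by (meson order_trans)
    qed
    have "0 < \<beta> - \<alpha>" using lt z0 by simp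
    from pow[OF this, of "nat n"] obtain y where y: "0 < y" "(2 ^ nat n) \<cdot> y \<le> \<beta> - \<alpha>" by blast
    have "int (nat n) < int (2 ^ nat n)" by (subst of_nat_less_iff) (rule less_exp)
    then have "int (nat n) < 2 ^ nat n" by simp
    then have "n \<cdot> y < (2 ^ nat n) \<cdot> y" using y(1) n by (intro int_mult_less_left) simp_all
    with y show ?thesis by (meson less_le_trans)
  qed
  then obtain \<delta> where \<delta>: "0 < \<delta>" "n \<cdot> \<delta> < \<beta> - \<alpha>" by blast
  define d where "d = n \<cdot> \<delta>"
  have d: "0 < d" using int_mult_less[OF n \<delta>(1)] by (simp add: d_def)
  \<comment> \<open>two integers that enclose the multiple to be found\<close>
  obtain k1 where k1: "\<alpha> - c < k1 \<cdot> d"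
    using arch d unfolding archimedean_group_def by fastforce
  obtain k2 where k2: "c - \<alpha> < k2 \<cdot> d"
    using arch d unfolding archimedean_group_def by fastforce
  \<comment> \<open>the set of multiples beyond \<alpha> - c; its least element lands in the interval\<close>
  define K where "K = {k. \<alpha> - c < k \<cdot> d \<and> k \<le> k1}"
  have bound: "- k2 < k" if "\<alpha> - c < k \<cdot> d" for k
  proof (rule ccontr)
    assume "\<not> - k2 < k"
    then have "k \<cdot> d \<le> (- k2) \<cdot> d" using d by (intro int_mult_le_left) simp_all
    also have "\<dots> < \<alpha> - c" using k2 by (simp add: minus_less_iff algebra_simps)
    finally show False using that by simp
  qed
  have K: "K \<subseteq> {- k2..k1}" "k1 \<in> K" using bound k1 by (force simp: K_def)+
  define k where "k = Min K"
  have fin: "finite K" using K(1) finite_subset by blast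
  have k: "k \<in> K" unfolding k_def using fin K(2) by (intro Min_in) auto
  have "k - 1 \<notin> K"
    using fin Min_le[of K "k - 1"] unfolding k_def by force
  then have "(k - 1) \<cdot> d \<le> \<alpha> - c" using k by (auto simp: K_def not_less)
  then have "c + k \<cdot> d \<le> \<alpha> + d" by (simp add: int_mult_diff_one algebra_simps)
  also have "\<dots> < \<beta>" using \<delta>(2) by (simp add: d_def algebra_simps)
  finally have "c + k \<cdot> d < \<beta>" .
  moreover have "\<alpha> < c + k \<cdot> d" using k by (simp add: K_def algebra_simps)
  moreover have "k \<cdot> d = n \<cdot> (k \<cdot> \<delta>)" by (simp add: d_def mult.commute)
  ultimately show ?thesis by metis
qed

lemma small_quotients_finite_index:
  assumes "small_quotients TYPE('b::linordered_ab_group_add)"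
  shows "\<exists>r xs. length xs = r \<and> (\<forall>x::'b. \<exists>i<r. \<exists>h. x = int (Suc n) \<cdot> h + xs ! i)"
proof -
  let ?c = "\<lambda>g :: 'b. (\<lambda>h. g + h) ` range (nat_mult (Suc n))"
  have "finite (range ?c)" using assms unfolding small_quotients_def by auto
  then obtain X where X: "finite X" "range ?c = ?c ` X"
    using finite_subset_image[of "range ?c" ?c UNIV] by auto
  obtain xs where xs: "set xs = X" using finite_list[OF X(1)] by blast
  have "\<exists>i<length xs. \<exists>h. x = int (Suc n) \<cdot> h + xs ! i" for x
  proof -
    have "?c x \<in> ?c ` X" using X(2) by blast
    then obtain r where r: "r \<in> X" "?c x = ?c r" by blast
    have "x \<in> ?c x"
      by (rule image_eqI[of _ _ 0]) (simp_all add: image_iff nat_mult_def exI[of _ 0])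
    then obtain h where "x = r + nat_mult (Suc n) h" using r(2) by auto
    then have "x = int (Suc n) \<cdot> h + r" by (simp only: int_mult_of_nat add.commute)
    moreover obtain i where "i < length xs" "xs ! i = r" using r(1) xs by (metis in_set_conv_nth)
    ultimately show ?thesis by blast
  qed
  then show ?thesis by blast
qed

theorem elementarily_equivalent_regular:
  assumes arch: "archimedean_group TYPE('b::linordered_ab_group_add)"
    and small: "small_quotients TYPE('b)"
    and ee: "elementarily_equivalent
           (oag_structure :: (oag_fun, oag_rel, 'a::linordered_ab_group_add) fo_structure)
           (oag_structure :: (oag_fun, oag_rel, 'b) fo_structure)"
    and nontriv: "\<exists>x::'a. 0 < x"
  shows "\<exists>eps :: 'a. regular_group eps"
proof -
  have transfer: "\<forall>e :: nat \<Rightarrow> 'a. sat oag_structure e \<phi>"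
    if "wf_form (oag_structure :: 'a oag_type) \<phi>" "fv \<phi> = {}"
       "\<forall>e :: nat \<Rightarrow> 'b. sat oag_structure e \<phi>" for \<phi>
    using ee that unfolding elementarily_equivalent_def by blast
  obtain eps :: 'a where eps: "is_step eps" using ex_is_step by blast
  have "regular_group eps"
  proof
    show "0 \<le> eps" using eps by (auto simp: is_step_def)
    show "0 < eps \<Longrightarrow> 0 < x \<Longrightarrow> eps \<le> x" for x using eps by (auto simp: is_step_def)
    show "\<exists>x::'a. 0 < x" by (rule nontriv)
  next
    fix n :: int and \<alpha> \<beta> c :: 'a assume n: "0 < n" and lt: "\<alpha> + n \<cdot> eps < \<beta>"
    obtain m where m: "n = int (Suc m)" using n by (metis gr0_implies_Suc zero_less_imp_eq_int)
    have "\<forall>e :: nat \<Rightarrow> 'a. sat oag_structure e (regular_form m)"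
    proof (rule transfer[OF closed_regular_form])
      show "\<forall>e :: nat \<Rightarrow> 'b. sat oag_structure e (regular_form m)"
        unfolding sat_regular_form using archimedean_regular[OF arch, of _ "int (Suc m)"] by simp
    qed
    then show "\<exists>g. \<alpha> < c + n \<cdot> g \<and> c + n \<cdot> g < \<beta>"
      unfolding sat_regular_form m[symmetric] using eps lt by blast
  next
    fix n :: int assume n: "0 < n"
    obtain m where m: "n = int (Suc m)" using n by (metis gr0_implies_Suc zero_less_imp_eq_int)
    obtain r where r: "\<exists>xs. length xs = r \<and> (\<forall>x::'b. \<exists>i<r. \<exists>h. x = int (Suc m) \<cdot> h + xs ! i)"
      using small_quotients_finite_index[OF small, of m] by blast
    have "\<forall>e :: nat \<Rightarrow> 'a. sat oag_structure e (index_form m r)"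
      by (rule transfer[OF closed_index_form]) (simp only: sat_index_form r simp_thms)
    then obtain xs :: "'a list" where "length xs = r" "\<forall>x. \<exists>i<r. \<exists>h. x = n \<cdot> h + xs ! i"
      unfolding sat_index_form m[symmetric] by blast
    then show "\<exists>R. finite R \<and> (\<forall>x :: 'a. \<exists>r\<in>R. \<exists>h. x = n \<cdot> h + r)"
      by (intro exI[of _ "set xs"]) (metis List.finite_set nth_mem)
  qed
  then show ?thesis ..
qed

section \<open>Unary sets cut out by finitely many points\<close>

text \<open>
  A set with the points of \<open>W\<close> as walls, where \<open>x\<close> is compared with a wall after multiplication by \<open>A\<close>
  since walls need not be divisible: membership is constant between consecutive walls. Fibres of sets
  definable in the ordered group are of this kind after fixing a residue class.
\<close>

definition cut :: "int \<Rightarrow> 'a::linordered_ab_group_add set \<Rightarrow> 'a set \<Rightarrow> bool" where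
  "cut A W X \<longleftrightarrow> 0 < A \<and> finite W \<and>
     (\<forall>x y. (\<forall>w\<in>W. sgn3 (A \<cdot> x - w) = sgn3 (A \<cdot> y - w)) \<longrightarrow> (x \<in> X \<longleftrightarrow> y \<in> X))"

lemma cutD: "cut A W X \<Longrightarrow> (\<And>w. w \<in> W \<Longrightarrow> sgn3 (A \<cdot> x - w) = sgn3 (A \<cdot> y - w)) \<Longrightarrow> x \<in> X \<longleftrightarrow> y \<in> X"
  unfolding cut_def by blast

lemma cut_compl: "cut A W X \<Longrightarrow> cut A W (- X)"
  unfolding cut_def by simp

lemma finite_preimage_int_mult:
  fixes W :: "'a::linordered_ab_group_add set"
  assumes "0 < A" "finite W"
  shows "finite {x. A \<cdot> x \<in> W}" "card {x. A \<cdot> x \<in> W} \<le> card W"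
proof -
  have inj: "inj_on (\<lambda>x. A \<cdot> x) {x. A \<cdot> x \<in> W}"
    using assms(1) by (simp add: inj_on_def int_mult_eq_iff)
  have sub: "(\<lambda>x. A \<cdot> x) ` {x. A \<cdot> x \<in> W} \<subseteq> W" by auto
  show "finite {x. A \<cdot> x \<in> W}"
    using inj_on_finite[OF inj sub assms(2)] .
  show "card {x. A \<cdot> x \<in> W} \<le> card W"
    using card_inj_on_le[OF inj sub assms(2)] .
qed

context regular_group
begin

text \<open>
  A point that is further away from all walls has \<open>K\<close> right neighbours \<open>x + s \<eta>\<close> between the same walls,
  which would also belong to \<open>X\<close>.
\<close>

lemma near_cut:
  assumes cut: "cut A W X" and fin: "finite X" "card X \<le> K" and x: "x \<in> X"
  shows "\<exists>w\<in>W. \<exists>s. \<bar>s\<bar> \<le> A * int (K + 1) \<and> A \<cdot> x = w + s \<cdot> eps"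
proof (rule ccontr)
  assume no: "\<not> ?thesis"
  \<comment> \<open>each of the K + 1 shifts changes A x by at most B steps\<close>
  define B where "B = A * int (K + 1)"
  define dist where "dist w = max (A \<cdot> x - w) (w - A \<cdot> x)" for w
  have A: "0 < A" "finite W" using cut by (auto simp: cut_def)
  have B: "0 \<le> B" using A by (simp add: B_def)
  have far: "B \<cdot> eps < dist w" if "w \<in> W" for w
  proof (rule ccontr)
    assume "\<not> B \<cdot> eps < dist w"
    then have "A \<cdot> x - w \<le> B \<cdot> eps" "w - A \<cdot> x \<le> B \<cdot> eps"
      by (auto simp: dist_def not_less)
    then have "\<exists>s. \<bar>s\<bar> \<le> B \<and> A \<cdot> x - w = s \<cdot> eps"
      using B by (intro near_zero) (auto simp: algebra_simps)
    then show False using no that by (auto simp: B_def diff_eq_eq add.commute)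
  qed
  obtain p :: 'a where p: "0 < p" using nontrivial by blast
  define \<mu> where "\<mu> = Min (insert (B \<cdot> eps + p) (dist ` W))"
  have "B \<cdot> eps < \<mu>" unfolding \<mu>_def using A far p by simp
  then obtain \<eta> where \<eta>: "0 < \<eta>" "B \<cdot> \<eta> < \<mu>" using small_step[OF B] by blast
  have B\<eta>: "B \<cdot> \<eta> < dist w" if "w \<in> W" for w
    by (rule less_le_trans[OF \<eta>(2)]) (use A that in \<open>simp add: \<mu>_def\<close>)
  have "x + int s \<cdot> \<eta> \<in> X" if "s \<le> K" for s
  proof -
    have "x \<in> X \<longleftrightarrow> x + int s \<cdot> \<eta> \<in> X"
    proof (rule cutD[OF cut])
      fix w assume w: "w \<in> W"
      have "A * int s \<le> B" using that A by (simp add: B_def)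
      then have 1: "(A * int s) \<cdot> \<eta> \<le> B \<cdot> \<eta>" using \<eta>(1) by (intro int_mult_le_left) simp_all
      have 2: "0 \<le> (A * int s) \<cdot> \<eta>"
        using \<eta>(1) A by (intro int_mult_nonneg) auto
      have 3: "A \<cdot> (x + int s \<cdot> \<eta>) - w = (A \<cdot> x - w) + (A * int s) \<cdot> \<eta>"
        by (simp add: zm.scale_right_distrib)
      consider "B \<cdot> \<eta> < A \<cdot> x - w" | "B \<cdot> \<eta> < w - A \<cdot> x"
        using B\<eta>[OF w] by (auto simp: dist_def less_max_iff_disj)
      then show "sgn3 (A \<cdot> x - w) = sgn3 (A \<cdot> (x + int s \<cdot> \<eta>) - w)"
      proof cases
        case 1
        then have "0 < A \<cdot> x - w" using 2 \<open>(A * int s) \<cdot> \<eta> \<le> B \<cdot> \<eta>\<close> by (meson le_less_trans)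
        moreover from this 2 have "0 < (A \<cdot> x - w) + (A * int s) \<cdot> \<eta>" by (rule add_pos_nonneg)
        ultimately show ?thesis unfolding 3 by (auto simp: sgn3_eq_iff)
      next
        case 2
        with 1 have "(A * int s) \<cdot> \<eta> < w - A \<cdot> x" by (meson le_less_trans)
        then have "(A \<cdot> x - w) + (A * int s) \<cdot> \<eta> < 0" by (simp add: algebra_simps)
        moreover from this have "A \<cdot> x - w < 0"
          using \<open>0 \<le> (A * int s) \<cdot> \<eta>\<close> by (meson le_less_trans le_add_same_cancel1)
        ultimately show ?thesis unfolding 3 by (auto simp: sgn3_eq_iff)
      qed
    qed
    with x show ?thesis by simp
  qed
  then have "(\<lambda>s. x + int s \<cdot> \<eta>) ` {..K} \<subseteq> X" by auto
  moreover have "inj_on (\<lambda>s. x + int s \<cdot> \<eta>) {..K}"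
    using \<eta>(1) by (simp add: inj_on_def int_mult_right_eq_iff)
  ultimately have "card {..K} \<le> card X" using card_inj_on_le fin(1) by blast
  with fin(2) show False by simp
qed

text \<open>
  Beyond all walls membership is constant on an infinite ray.
\<close>

lemma beyond_cuts:
  fixes X :: "'a set"
  assumes cut: "cut A W X" and fin: "finite X"
    and x: "(\<forall>w\<in>W. w < A \<cdot> x) \<or> (\<forall>w\<in>W. A \<cdot> x < w)"
  shows "x \<notin> X"
proof
  assume xX: "x \<in> X"
  obtain p :: 'a where p: "0 < p" using nontrivial by blast
  have A: "0 < A" using cut by (simp add: cut_def)
  have nn: "0 \<le> (A * int s) \<cdot> p" for s using p A by (intro int_mult_nonneg) auto
  have "\<exists>q. q \<noteq> 0 \<and> (\<forall>s. \<forall>w\<in>W. sgn3 (A \<cdot> x - w) = sgn3 (A \<cdot> (x + int s \<cdot> q) - w))"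
    using x
  proof
    assume w: "\<forall>w\<in>W. w < A \<cdot> x"
    have "w < A \<cdot> (x + int s \<cdot> p)" if "w \<in> W" for w s
      using add_less_le_mono[OF bspec[OF w that] nn[of s]] by (simp add: zm.scale_right_distrib)
    with w p show ?thesis by (intro exI[of _ p]) (auto simp: sgn3_eq_iff dest: less_asym)
  next
    assume w: "\<forall>w\<in>W. A \<cdot> x < w"
    have "A \<cdot> (x + int s \<cdot> (- p)) < w" if "w \<in> W" for w s
      using add_less_le_mono[OF bspec[OF w that] nn[of s]]
      by (simp add: zm.scale_right_diff_distrib diff_less_eq)
    with w p show ?thesis by (intro exI[of _ "- p"]) (auto simp: sgn3_eq_iff dest: less_asym)
  qed
  then obtain q where q: "q \<noteq> 0"
    and "\<And>s w. w \<in> W \<Longrightarrow> sgn3 (A \<cdot> x - w) = sgn3 (A \<cdot> (x + int s \<cdot> q) - w)" by blast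
  then have "range (\<lambda>s. x + int s \<cdot> q) \<subseteq> X" using cutD[OF cut] xX by blast
  moreover have "inj (\<lambda>s. x + int s \<cdot> q)" using q by (simp add: inj_def int_mult_right_eq_iff)
  ultimately show False
    using fin finite_subset finite_imageD infinite_UNIV_nat by blast
qed

lemma sgn3_between:
  fixes a b c :: 'a
  assumes "a \<le> b" "b \<le> c" "sgn3 a = sgn3 c"
  shows "sgn3 b = sgn3 a"
  using assms unfolding sgn3_eq_iff by (blast intro: le_less_trans less_le_trans)

text \<open>
  By the pigeonhole principle infinitely many points of \<open>X\<close> lie in the same way with respect to the
  walls and to the points of \<open>Z\<close>; the interval between any two of them is contained in \<open>X\<close> and
  avoids \<open>Z\<close>.
\<close>

lemma long_interval:
  assumes cut: "cut A W X" and inf: "infinite X" and Z: "finite Z"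
  shows "\<exists>\<alpha> \<beta>. \<alpha> + int n \<cdot> eps < \<beta> \<and> (\<forall>t. \<alpha> < t \<and> t < \<beta> \<longrightarrow> t \<in> X \<and> t \<notin> Z)"
proof -
  have A: "0 < A" "finite W" using cut by (auto simp: cut_def)
  define g where "g x = ({w\<in>W. A \<cdot> x - w < 0}, {w\<in>W. 0 < A \<cdot> x - w}, {z\<in>Z. z < x})" for x
  have "finite (g ` (X - Z))"
    by (rule finite_subset[of _ "Pow W \<times> Pow W \<times> Pow Z"]) (use A Z in \<open>auto simp: g_def\<close>)
  moreover have "infinite (X - Z)" using inf Z by (rule Diff_infinite_finite[rotated])
  ultimately obtain x0 where "infinite {x\<in>X - Z. g x = g x0}"
    using pigeonhole_infinite[of "X - Z" g] by blast
  then obtain \<alpha> \<beta> where ab: "\<alpha> \<in> {x\<in>X - Z. g x = g x0}" "\<beta> \<in> {x\<in>X - Z. g x = g x0}"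
      "\<alpha> + int n \<cdot> eps < \<beta>"
    by (rule infinite_far_apart)
  have eq: "g \<alpha> = g \<beta>" using ab by simp
  have "t \<in> X \<and> t \<notin> Z" if t: "\<alpha> < t" "t < \<beta>" for t
  proof
    have "\<alpha> \<in> X \<longleftrightarrow> t \<in> X"
    proof (rule cutD[OF cut])
      fix w assume w: "w \<in> W"
      have "sgn3 (A \<cdot> \<alpha> - w) = sgn3 (A \<cdot> \<beta> - w)"
        using eq w unfolding g_def sgn3_eq_iff by blast
      moreover have "A \<cdot> \<alpha> - w \<le> A \<cdot> t - w" "A \<cdot> t - w \<le> A \<cdot> \<beta> - w"
        using t A by (auto simp: int_mult_le_iff)
      ultimately show "sgn3 (A \<cdot> \<alpha> - w) = sgn3 (A \<cdot> t - w)"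
        using sgn3_between by metis
    qed
    with ab show "t \<in> X" by simp
    show "t \<notin> Z"
    proof
      assume "t \<in> Z"
      then have "t \<in> {z\<in>Z. z < \<beta>}" using t by simp
      moreover have "{z\<in>Z. z < \<alpha>} = {z\<in>Z. z < \<beta>}" using eq by (simp add: g_def)
      ultimately have "t < \<alpha>" by blast
      then show False using t by simp
    qed
  qed
  with ab(3) show ?thesis by blast
qed

text \<open>
  Two infinite cells \<open>I\<close> and \<open>J\<close> with only finitely many elements between them. A unit \<open>\<eta>\<close> is chosen that is
  tiny compared with both cells. Close to a wall between the cells there is a point
  \<open>t0\<close> such that \<open>t0 - s \<eta>\<close> is in \<open>I\<close> and \<open>t0 + s \<eta>\<close> in \<open>J\<close> as soon as \<open>s\<close> exceeds the size of the gap by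
  2, as long as \<open>s\<close> stays within the lengths of the cells. A progression whose difference is twice this threshold, shifted by half a step, jumps over the gap.
\<close>

lemma progression_crossing:
  fixes W U V I J :: "'a set"
  assumes W: "finite W" and A: "0 < A" and UV: "U \<subset> V" "V \<subseteq> W"
    and I_def: "I = {x. A \<cdot> x \<notin> W \<and> {w\<in>W. w < A \<cdot> x} = U}"
    and J_def: "J = {x. A \<cdot> x \<notin> W \<and> {w\<in>W. w < A \<cdot> x} = V}"
    and inf: "infinite I" "infinite J"
    and gap: "finite {t. (\<forall>x\<in>I. x < t) \<and> (\<forall>y\<in>J. t < y)}"
  shows "\<exists>p \<delta>. \<forall>s. \<bar>s\<bar> \<le> int n \<longrightarrow> (if 0 < s then p + s \<cdot> \<delta> \<in> J else p + s \<cdot> \<delta> \<in> I)"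
proof -
  define g where "g = card {t. (\<forall>x\<in>I. x < t) \<and> (\<forall>y\<in>J. t < y)}"
  \<comment> \<open>k steps to either side of t0 pass the gap; M bounds the steps that the progression needs\<close>
  define k where "k = int g + 2"
  define M where "M = (2 * int n + 1) * k + 2"
  define cell where "cell U' = {x. A \<cdot> x \<notin> W \<and> {w\<in>W. w < A \<cdot> x} = U'}" for U'
  have convex: "t \<in> cell U'"
    if "a \<in> cell U'" "b \<in> cell U'"
      "a \<le> t" "t \<le> b" for a b t :: 'a and U'
  proof -
    note that' = that[unfolded cell_def]
    have le: "A \<cdot> a \<le> A \<cdot> t" "A \<cdot> t \<le> A \<cdot> b"
      using that(3,4) A int_mult_le_iff[of A a t] int_mult_le_iff[of A t b] by simp_all
    then have "{w\<in>W. w < A \<cdot> a} \<subseteq> {w\<in>W. w < A \<cdot> t}" "{w\<in>W. w < A \<cdot> t} \<subseteq> {w\<in>W. w < A \<cdot> b}"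
      by (blast intro: less_le_trans)+
    then have "{w\<in>W. w < A \<cdot> t} = U'" using that'(1,2) by simp
    moreover have "A \<cdot> t \<notin> W"
    proof
      assume t: "A \<cdot> t \<in> W"
      have "A \<cdot> b \<notin> W" using that'(2) by simp
      with t le(2) have "A \<cdot> t < A \<cdot> b" by (metis le_less)
      with t that'(2) have "A \<cdot> t \<in> U'" by blast
      with that'(1) have "A \<cdot> t < A \<cdot> a" by blast
      then show False using le(1) by simp
    qed
    ultimately show ?thesis by (simp add: cell_def)
  qed
  have I: "I = cell U" and J: "J = cell V" by (simp_all add: I_def J_def cell_def)
  obtain w where w: "w \<in> V" "w \<notin> U" using UV by blast
  have Iw: "A \<cdot> x < w" if "x \<in> I" for x
  proof -
    have "\<not> w < A \<cdot> x" "A \<cdot> x \<noteq> w" using that w UV by (auto simp: I_def)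
    then show ?thesis by simp
  qed
  have Jw: "w < A \<cdot> y" if "y \<in> J" for y
    using that w by (auto simp: J_def)
  have k0: "0 < k" by (simp add: k_def)
  have M0: "0 \<le> M" using k0 by (simp add: M_def)
  have Mn: "int (nat M) = M" using M0 by simp
  obtain i0 i1 where i: "i0 \<in> I" "i1 \<in> I" "i0 + M \<cdot> eps < i1"
    using infinite_far_apart[OF inf(1), of "nat M"] unfolding Mn by blast
  obtain j0 j1 where j: "j0 \<in> J" "j1 \<in> J" "j0 + M \<cdot> eps < j1"
    using infinite_far_apart[OF inf(2), of "nat M"] unfolding Mn by blast
  have "M \<cdot> eps < min (i1 - i0) (j1 - j0)" using i(3) j(3) by (simp add: algebra_simps)
  then obtain \<eta> where \<eta>: "0 < \<eta>" "eps \<le> \<eta>" and M\<eta>: "M \<cdot> \<eta> < min (i1 - i0) (j1 - j0)"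
    using small_step[OF M0] by blast
  have "- ((A + 1) \<cdot> \<eta>) + A \<cdot> eps < 0"
  proof -
    have "A \<cdot> eps \<le> A \<cdot> \<eta>" using \<eta> A by (simp add: int_mult_le_iff)
    also have "\<dots> < (A + 1) \<cdot> \<eta>" using \<eta>(1) by (simp add: int_mult_add_one)
    finally show ?thesis by simp
  qed
  \<comment> \<open>t0 lies just below the wall that separates I from J\<close>
  from regular[OF A this, of "- w"] obtain t0 where t0: "- ((A + 1) \<cdot> \<eta>) < A \<cdot> t0 - w" "A \<cdot> t0 < w"
    by (auto simp: algebra_simps)
  have t0J: "t0 < y" if "y \<in> J" for y
  proof -
    have "A \<cdot> t0 < A \<cdot> y" using t0(2) Jw[OF that] by (rule less_trans)
    then show ?thesis using int_mult_less_iff[OF A] by blast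
  qed
  have It0: "x < t0 + 2 \<cdot> \<eta>" if "x \<in> I" for x
  proof -
    have "(A + 1) \<cdot> \<eta> \<le> (2 * A) \<cdot> \<eta>" using \<eta>(1) A by (intro int_mult_le_left) auto
    moreover have "w < A \<cdot> t0 + (A + 1) \<cdot> \<eta>"
      using t0(1) by (simp add: minus_less_iff less_diff_eq algebra_simps)
    ultimately have "w < A \<cdot> t0 + (2 * A) \<cdot> \<eta>"
      by (meson add_left_mono less_le_trans)
    also have "\<dots> = A \<cdot> (t0 + 2 \<cdot> \<eta>)" by (simp add: zm.scale_right_distrib mult.commute)
    finally have "A \<cdot> x < A \<cdot> (t0 + 2 \<cdot> \<eta>)" using Iw[OF that] by (meson less_trans)
    then show ?thesis using int_mult_less_iff[OF A] by blast
  qed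
  have inj: "inj (\<lambda>s. c + s \<cdot> \<eta>)" for c
    using \<eta>(1) by (simp add: inj_def int_mult_right_eq_iff)
  have gap_small: False
    if T: "\<And>s. s \<in> T \<Longrightarrow> (\<forall>x\<in>I. x < t0 + s \<cdot> \<eta>) \<and> (\<forall>y\<in>J. t0 + s \<cdot> \<eta> < y)" and "g < card T" for T
  proof -
    have "(\<lambda>s. t0 + s \<cdot> \<eta>) ` T \<subseteq> {t. (\<forall>x\<in>I. x < t) \<and> (\<forall>y\<in>J. t < y)}" using T by blast
    from card_inj_on_le[OF inj_on_subset[OF inj subset_UNIV] this gap]
    have "card T \<le> g" by (simp add: g_def)
    with that(2) show False by simp
  qed
  have mono: "t0 + s \<cdot> \<eta> \<le> t0 + t \<cdot> \<eta>" if "s \<le> t" for s t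
    using int_mult_le_left[OF that, of \<eta>] \<eta>(1) by simp
  have "\<exists>s\<in>{- int g..0}. \<exists>x\<in>I. t0 + s \<cdot> \<eta> \<le> x"
  proof (rule ccontr)
    assume no: "\<not> ?thesis"
    show False
    proof (rule gap_small[of "{- int g..0}"])
      fix s assume s: "s \<in> {- int g..0}"
      have "t0 + s \<cdot> \<eta> \<le> t0" using mono[of s 0] s by simp
      then show "(\<forall>x\<in>I. x < t0 + s \<cdot> \<eta>) \<and> (\<forall>y\<in>J. t0 + s \<cdot> \<eta> < y)"
        using no s t0J by (meson le_less_trans not_less)
    qed simp
  qed
  then obtain s1 x1 where sx: "- int g \<le> s1" "x1 \<in> I" "t0 + s1 \<cdot> \<eta> \<le> x1" by auto
  have "\<exists>s\<in>{2..int g + 2}. \<exists>y\<in>J. y \<le> t0 + s \<cdot> \<eta>"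
  proof (rule ccontr)
    assume no: "\<not> ?thesis"
    show False
    proof (rule gap_small[of "{2..int g + 2}"])
      fix s assume s: "s \<in> {2..int g + 2}"
      have "t0 + 2 \<cdot> \<eta> \<le> t0 + s \<cdot> \<eta>" using mono[of 2 s] s by simp
      then show "(\<forall>x\<in>I. x < t0 + s \<cdot> \<eta>) \<and> (\<forall>y\<in>J. t0 + s \<cdot> \<eta> < y)"
        using no s It0 by (meson less_le_trans not_less)
    qed simp
  qed
  then obtain s2 y2 where sy: "s2 \<le> int g + 2" "y2 \<in> J" "y2 \<le> t0 + s2 \<cdot> \<eta>" by auto
  have inI: "t0 + s \<cdot> \<eta> \<in> I" if "2 - M \<le> s" "s \<le> - int g" for s
    unfolding I
  proof (rule convex)
    show "i0 \<in> cell U" using i(1) by (simp only: I)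
    show "x1 \<in> cell U" using sx(2) by (simp only: I)
    show "t0 + s \<cdot> \<eta> \<le> x1" using mono[of s s1] sx that by (meson order_trans)
    have "i0 < i1 - M \<cdot> \<eta>" using M\<eta> by (simp add: algebra_simps)
    also have "\<dots> < t0 + 2 \<cdot> \<eta> - M \<cdot> \<eta>" using It0[OF i(2)] by simp
    also have "\<dots> = t0 + (2 - M) \<cdot> \<eta>" by (simp add: zm.scale_left_diff_distrib)
    also have "\<dots> \<le> t0 + s \<cdot> \<eta>" using mono that by blast
    finally show "i0 \<le> t0 + s \<cdot> \<eta>" by simp
  qed
  have inJ: "t0 + s \<cdot> \<eta> \<in> J" if "int g + 2 \<le> s" "s \<le> M" for s
    unfolding J
  proof (rule convex)
    show "y2 \<in> cell V" using sy(2) by (simp only: J)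
    show "j1 \<in> cell V" using j(2) by (simp only: J)
    show "y2 \<le> t0 + s \<cdot> \<eta>" using mono[of s2 s] sy that by (meson order_trans)
    have "t0 + s \<cdot> \<eta> \<le> t0 + M \<cdot> \<eta>" using mono that by blast
    also have "\<dots> < j0 + M \<cdot> \<eta>" using t0J[OF j(1)] by simp
    also have "\<dots> < j1" using M\<eta> by (simp add: algebra_simps)
    finally show "t0 + s \<cdot> \<eta> \<le> j1" by simp
  qed
  have "if 0 < s then (t0 - k \<cdot> \<eta>) + s \<cdot> ((2 * k) \<cdot> \<eta>) \<in> J else (t0 - k \<cdot> \<eta>) + s \<cdot> ((2 * k) \<cdot> \<eta>) \<in> I"
    if s: "\<bar>s\<bar> \<le> int n" for s
  proof -
    have eq: "(t0 - k \<cdot> \<eta>) + s \<cdot> ((2 * k) \<cdot> \<eta>) = t0 + ((2 * s - 1) * k) \<cdot> \<eta>"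
    proof -
      have "(2 * s - 1) * k = s * (2 * k) - k" by (simp add: algebra_simps)
      then show ?thesis by (simp only: zm.scale_left_diff_distrib zm.scale_scale) simp
    qed
    show ?thesis
    proof (cases "0 < s")
      case True
      then have "1 * k \<le> (2 * s - 1) * k" using k0 by (intro mult_right_mono) auto
      then have "int g + 2 \<le> (2 * s - 1) * k" by (simp only: k_def mult_1)
      moreover have "(2 * s - 1) * k \<le> (2 * int n + 1) * k" using s k0 by (intro mult_right_mono) auto
      then have "(2 * s - 1) * k \<le> M" unfolding M_def by (rule order_trans) simp
      ultimately have "t0 + ((2 * s - 1) * k) \<cdot> \<eta> \<in> J" by (rule inJ)
      then show ?thesis using True by (simp only: eq if_True)
    next
      case False
      then have "(2 * s - 1) * k \<le> (- 1) * k" using k0 by (intro mult_right_mono) auto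
      also have "\<dots> \<le> - int g" by (simp add: k_def)
      finally have le: "(2 * s - 1) * k \<le> - int g" .
      have "2 - M = (- (2 * int n + 1)) * k" unfolding M_def by (simp only: mult_minus_left)
      also have "\<dots> \<le> (2 * s - 1) * k" using s k0 by (intro mult_right_mono) auto
      finally have "t0 + ((2 * s - 1) * k) \<cdot> \<eta> \<in> I" using le by (rule inI)
      then show ?thesis using False by (simp only: eq if_False)
    qed
  qed
  then show ?thesis by blast
qed

text \<open>
  Walls cut the line into cells. Among all pairs of infinite cells of which one is inside and one
  outside \<open>X\<close>, take a pair with the fewest walls between them: no infinite cell fits in
  between, so only finitely many elements do, and a progression crosses from one to the other. Its
  direction can be reversed, so which cell comes first does not matter.
\<close>

lemma progression_splits:
  fixes X :: "'a set"
  assumes cut: "cut A W X" and inf: "infinite X" "infinite (- X)"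
  shows "\<exists>p \<delta>. \<forall>s. \<bar>s\<bar> \<le> int n \<longrightarrow> (p + s \<cdot> \<delta> \<in> X \<longleftrightarrow> 0 < s)"
proof -
  have A: "0 < A" and W: "finite W" using cut by (auto simp: cut_def)
  define up where "up x = {w\<in>W. w < A \<cdot> x}" for x
  define cell where "cell U = {x. A \<cdot> x \<notin> W \<and> up x = U}" for U
  define large where "large U \<longleftrightarrow> U \<subseteq> W \<and> infinite (cell U)" for U
  have same: "x \<in> X \<longleftrightarrow> y \<in> X" if "x \<in> cell U" "y \<in> cell U" for x y U
  proof (rule cutD[OF cut])
    fix w assume w: "w \<in> W"
    have "w < A \<cdot> x \<longleftrightarrow> w < A \<cdot> y" "A \<cdot> x \<noteq> w" "A \<cdot> y \<noteq> w"
      using that w by (auto simp: cell_def up_def)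
    then show "sgn3 (A \<cdot> x - w) = sgn3 (A \<cdot> y - w)"
      unfolding sgn3_eq_iff by (auto simp: not_less_iff_gr_or_eq)
  qed
  have pure: "cell U \<subseteq> X \<or> cell U \<subseteq> - X" for U using same by blast
  have ex: "\<exists>U. large U \<and> cell U \<subseteq> Y" if Y: "Y = X \<or> Y = - X" "infinite Y" for Y
  proof -
    have "finite (up ` (Y - {x. A \<cdot> x \<in> W}))"
      by (rule finite_subset[of _ "Pow W"]) (use W in \<open>auto simp: up_def\<close>)
    moreover have "infinite (Y - {x. A \<cdot> x \<in> W})"
      using Y(2) finite_preimage_int_mult(1)[OF A W] by (rule Diff_infinite_finite[rotated])
    ultimately obtain x0 where x0: "x0 \<in> Y - {x. A \<cdot> x \<in> W}"
        "infinite {x \<in> Y - {x. A \<cdot> x \<in> W}. up x = up x0}"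
      using pigeonhole_infinite by blast
    have "{x \<in> Y - {x. A \<cdot> x \<in> W}. up x = up x0} \<subseteq> cell (up x0)" by (auto simp: cell_def)
    then have "large (up x0)"
      using x0(2) finite_subset unfolding large_def by (auto simp: up_def)
    moreover have "x0 \<in> cell (up x0)" using x0 by (simp add: cell_def)
    ultimately show ?thesis using pure[of "up x0"] Y(1) x0(1) by blast
  qed
  have mono: "up x \<subseteq> up y" if "x \<le> y" for x y
    using that A int_mult_le_iff[OF A, of x y] by (auto simp: up_def)
  have nonempty: "cell U \<noteq> {}" if "large U" for U using that by (auto simp: large_def)
  have chain: "U \<subset> V \<or> V \<subset> U" if UV: "large U" "large V" "U \<noteq> V" for U V
  proof -
    obtain x y where "x \<in> cell U" "y \<in> cell V"
      using nonempty[OF UV(1)] nonempty[OF UV(2)] by (meson ex_in_conv)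
    then show ?thesis
      using mono[of x y] mono[of y x] UV(3) linear[of x y] by (auto simp: cell_def)
  qed
  define opposite where "opposite U V \<longleftrightarrow> large U \<and> large V \<and> U \<subset> V \<and> (cell U \<subseteq> X \<longleftrightarrow> \<not> cell V \<subseteq> X)" for U V
  obtain U0 V0 where "large U0" "cell U0 \<subseteq> X" "large V0" "cell V0 \<subseteq> - X"
    using ex[of X] ex[of "- X"] inf by blast
  then have "opposite U0 V0 \<or> opposite V0 U0"
    using chain[of U0 V0] nonempty[of U0] nonempty[of V0] unfolding opposite_def by blast
  then have "\<exists>k U V. opposite U V \<and> card (V - U) = k" by blast
  then obtain U V where UV: "opposite U V"
      and least: "\<And>U' V'. opposite U' V' \<Longrightarrow> card (V - U) \<le> card (V' - U')"
    using ex_has_least_nat[of "\<lambda>(U, V). opposite U V" _ "\<lambda>(U, V). card (V - U)"] by fastforce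
  have V: "V \<subseteq> W" "finite V" using UV W finite_subset by (auto simp: opposite_def large_def)
  have "x \<in> cell (up x) \<or> A \<cdot> x \<in> W" "up x \<subseteq> W" for x
    by (auto simp: cell_def up_def)
  define G where "G = {t. (\<forall>x\<in>cell U. x < t) \<and> (\<forall>y\<in>cell V. t < y)}"
  have "finite (cell (up t))" if t: "t \<in> G" "A \<cdot> t \<notin> W" for t
  proof (rule ccontr)
    assume "infinite (cell (up t))"
    then have T: "large (up t)" by (auto simp: large_def up_def)
    have "t \<in> cell (up t)" using t by (simp add: cell_def)
    moreover have "t \<notin> cell U" "t \<notin> cell V" using t by (auto simp: G_def)
    ultimately have ne: "up t \<noteq> U" "up t \<noteq> V" by auto
    obtain x y where "x \<in> cell U" "y \<in> cell V"
      using UV nonempty unfolding opposite_def by (meson ex_in_conv)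
    moreover from this t(1) have "x \<le> t" "t \<le> y" by (auto simp: G_def intro: less_imp_le)
    ultimately have "U \<subseteq> up t" "up t \<subseteq> V"
      using mono[of x t] mono[of t y] by (auto simp: cell_def)
    with ne have sub: "U \<subset> up t" "up t \<subset> V" by auto
    have "opposite U (up t) \<or> opposite (up t) V"
      using UV T sub unfolding opposite_def by blast
    moreover have "card (up t - U) < card (V - U)" "card (V - up t) < card (V - U)"
      using sub V by (auto intro!: psubset_card_mono)
    ultimately show False using least by fastforce
  qed
  then have "G \<subseteq> {x. A \<cdot> x \<in> W} \<union> (\<Union>T\<in>{T\<in>Pow W. finite (cell T)}. cell T)"
    using \<open>\<And>x. x \<in> cell (up x) \<or> A \<cdot> x \<in> W\<close> \<open>\<And>x. up x \<subseteq> W\<close> by blast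
  moreover have "finite ({x. A \<cdot> x \<in> W} \<union> (\<Union>T\<in>{T\<in>Pow W. finite (cell T)}. cell T))"
    using finite_preimage_int_mult(1)[OF A W] W by auto
  ultimately have gap: "finite G" by (rule finite_subset)
  have "\<exists>p \<delta>. \<forall>s. \<bar>s\<bar> \<le> int (n + 1) \<longrightarrow> (if 0 < s then p + s \<cdot> \<delta> \<in> cell V else p + s \<cdot> \<delta> \<in> cell U)"
  proof (rule progression_crossing[OF W A])
    show "U \<subset> V" "infinite (cell U)" "infinite (cell V)" using UV by (auto simp: opposite_def large_def)
    show "finite {t. (\<forall>x\<in>cell U. x < t) \<and> (\<forall>y\<in>cell V. t < y)}" using gap by (simp only: G_def)
  qed (simp_all add: V(1) cell_def up_def)
  then obtain p \<delta> where p: "\<And>s. \<bar>s\<bar> \<le> int (n + 1) \<Longrightarrow> (if 0 < s then p + s \<cdot> \<delta> \<in> cell V else p + s \<cdot> \<delta> \<in> cell U)"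
    by blast
  show ?thesis
  proof (cases "cell V \<subseteq> X")
    case True
    then have "cell U \<subseteq> - X" using UV pure unfolding opposite_def by blast
    then have "p + s \<cdot> \<delta> \<in> X \<longleftrightarrow> 0 < s" if "\<bar>s\<bar> \<le> int n" for s
      using p[of s] that True by (auto split: if_splits)
    then show ?thesis by blast
  next
    case False
    then have *: "cell U \<subseteq> X" "cell V \<subseteq> - X" using UV pure unfolding opposite_def by blast+
    have "(p + \<delta>) + s \<cdot> (- \<delta>) \<in> X \<longleftrightarrow> 0 < s" if "\<bar>s\<bar> \<le> int n" for s
    proof -
      have "(p + \<delta>) + s \<cdot> (- \<delta>) = p + (1 - s) \<cdot> \<delta>"
        by (simp add: zm.scale_left_diff_distrib int_mult_one)
      moreover have "p + (1 - s) \<cdot> \<delta> \<in> X \<longleftrightarrow> 0 < s"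
      proof (cases "0 < s")
        case True
        then have "p + (1 - s) \<cdot> \<delta> \<in> cell U" using p[of "1 - s"] that by simp
        with * True show ?thesis by blast
      next
        case False
        then have "p + (1 - s) \<cdot> \<delta> \<in> cell V" using p[of "1 - s"] that by simp
        with * False show ?thesis by blast
      qed
      ultimately show ?thesis by (simp only:)
    qed
    then show ?thesis by blast
  qed
qed

end

section \<open>Definability in expansions of the group\<close>

text \<open>
  The bounded dependence makes it possible to choose fresh coordinates.
\<close>

definition fdef :: "('f, 'r, 'a) fo_structure \<Rightarrow> ((nat \<Rightarrow> 'a) \<Rightarrow> 'a) \<Rightarrow> bool" where
  "fdef M f \<longleftrightarrow> (\<forall>j. pdef M (\<lambda>e. e j = f e)) \<and> (\<exists>m. depends {..<m} f)"

lemma dependsI: "(\<And>e e'. (\<And>i. i \<in> S \<Longrightarrow> e i = e' i) \<Longrightarrow> f e = f e') \<Longrightarrow> depends S f"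
  unfolding depends_def by blast

lemma depends_mono: "depends S f \<Longrightarrow> S \<subseteq> T \<Longrightarrow> depends T f"
  unfolding depends_def by blast

lemma depends_fibre:
  "depends S P \<Longrightarrow> (\<And>j. j \<in> S - {i} \<Longrightarrow> e j = e' j) \<Longrightarrow> P (e(i := x)) = P (e'(i := x))"
  by (erule dependsD) auto

lemma depends_upd_Diff: "depends (S - {i}) f \<Longrightarrow> f (e(i := x)) = f e"
  by (erule dependsD) auto

text \<open>
  The values \<open>f e\<close> and \<open>g e\<close> are stored in two fresh coordinates, and \<open>R\<close> is renamed to read them.
\<close>

lemma fdef_pair:
  assumes "fdef M f" "fdef M g" "pdef M R"
    and R: "\<And>e. R e \<longleftrightarrow> Q (e a) (e b) (e c)" and abc: "a \<noteq> b" "a \<noteq> c" "b \<noteq> c"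
  shows "pdef M (\<lambda>e. Q (f e) (g e) (e j))"
proof -
  obtain m n where m: "depends {..<m} f" and n: "depends {..<n} g"
    using assms(1,2) unfolding fdef_def by blast
  define k where "k = m + n + j + 1"
  have f: "f (e(k := x, Suc k := y)) = f e" for e x y
    by (rule dependsD[OF m]) (simp add: k_def)
  have g: "g (e(k := x, Suc k := y)) = g e" for e x y
    by (rule dependsD[OF n]) (simp add: k_def)
  have "pdef M (\<lambda>e. R (\<lambda>i. e (if i = a then k else if i = b then Suc k else j)))"
    by (rule pdef_rename[OF assms(3)])
  then have "pdef M (\<lambda>e. Q (e k) (e (Suc k)) (e j))"
    using abc by (simp add: R)
  then have "pdef M (\<lambda>e. e k = f e \<and> e (Suc k) = g e \<and> Q (e k) (e (Suc k)) (e j))"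
    using assms(1,2) unfolding fdef_def by (intro pdef_conj) blast+
  from pdef_ex[OF pdef_ex[OF this, of "Suc k"], of k]
  have "pdef M (\<lambda>e. \<exists>x y. x = f (e(k := x, Suc k := y)) \<and> y = g (e(k := x, Suc k := y)) \<and> Q x y (e j))"
    by (simp add: k_def)
  then show ?thesis by (simp add: f g)
qed

lemma pdef_fdef_eq:
  assumes "fdef M f" "fdef M g"
  shows "pdef M (\<lambda>e. f e = g e)"
  using fdef_pair[OF assms pdef_eq[of M 0 1], of "\<lambda>x y z. x = y" 0 1 2] by simp

lemma fdef_diff:
  assumes plus: "pdef M (\<lambda>e :: nat \<Rightarrow> 'a::ab_group_add. e 0 + e 1 = e 2)" and "fdef M f" "fdef M g"
  shows "fdef M (\<lambda>e. f e - g e)"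
proof -
  have "pdef M (\<lambda>e. e j = f e - g e)" for j
    using fdef_pair[OF assms(2,3) plus, of "\<lambda>x y z. z + y = x" 2 1 0 j]
    by (simp add: eq_diff_eq)
  moreover obtain m n where "depends {..<m} f" "depends {..<n} g"
    using assms(2,3) unfolding fdef_def by blast
  then have "depends {..<max m n} f" "depends {..<max m n} g"
    by (auto elim!: depends_mono)
  then have "depends {..<max m n} (\<lambda>e. f e - g e)"
    unfolding depends_def by metis
  ultimately show ?thesis unfolding fdef_def by blast
qed

lemma affine_fdef:
  assumes plus: "pdef M (\<lambda>e :: nat \<Rightarrow> 'a::ab_group_add. e 0 + e 1 = e 2)" and "affine f"
  shows "fdef M f"
  using assms(2)
proof induction
  case (affine_const c)
  have "pdef M (\<lambda>e. e j = c)" for j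
    using pdef_subst[OF pdef_eq[of M 0 1], of "\<lambda>i. if i = 0 then Inr j else Inl c"] by simp
  then show ?case by (simp add: fdef_def depends_def)
next
  case (affine_var i)
  then show ?case
    using affine_depends[OF affine.affine_var[of i]] by (simp add: fdef_def pdef_eq)
next
  case (affine_diff f g)
  show ?case by (rule fdef_diff[OF plus affine_diff.IH])
qed

lemma pdef_affine_eq:
  assumes plus: "pdef M (\<lambda>e :: nat \<Rightarrow> 'a::ab_group_add. e 0 + e 1 = e 2)" and "affine f" "affine g"
  shows "pdef M (\<lambda>e. f e = g e)"
  by (rule pdef_fdef_eq[OF affine_fdef[OF plus assms(2)] affine_fdef[OF plus assms(3)]])

text \<open>
  Addition need not be a symbol of the language, so affine terms are not available as terms; their
  values are quantified over instead.
\<close>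

lemma pdef_subst_affine:
  assumes plus: "pdef M (\<lambda>e :: nat \<Rightarrow> 'a::ab_group_add. e 0 + e 1 = e 2)"
    and P: "pdef M P" "depends S P" "finite S"
    and \<tau>: "\<And>j. j \<in> S \<Longrightarrow> affine (\<lambda>e. \<tau> e j)"
  shows "pdef M (\<lambda>e. P (\<tau> e))"
proof -
  obtain r where r: "S \<subseteq> {..<r}" using P(3) by (auto simp: finite_nat_set_iff_bounded)
  have "\<forall>j\<in>S. \<exists>m. depends {..<m} (\<lambda>e. \<tau> e j)" using \<tau> affine_depends by blast
  then obtain d where d: "\<And>j. j \<in> S \<Longrightarrow> depends {..<d j} (\<lambda>e. \<tau> e j)" by metis
  define m where "m = sum d S"
  have m: "depends {..<m} (\<lambda>e. \<tau> e j)" if "j \<in> S" for j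
    by (rule depends_mono[OF d[OF that]]) (use member_le_sum[OF that, of d] P(3) in \<open>auto simp: m_def\<close>)
  have "pdef M (\<lambda>e. (\<forall>j\<in>S. e (m + j) = \<tau> e j) \<and> P (\<lambda>l. e (m + l)))"
    by (intro pdef_conj pdef_Ball P(3) pdef_affine_eq[OF plus] affine_var \<tau> pdef_rename[OF P(1)])
  then have "pdef M (\<lambda>e. \<exists>u. (\<forall>j\<in>S. u j = \<tau> e j) \<and> P u)"
  proof (rule pdef_ex_fun[of M "\<lambda>u e. (\<forall>j\<in>S. u j = \<tau> e j) \<and> P u" m r])
    fix u e e' :: "nat \<Rightarrow> 'a" assume "\<And>j. j < m \<Longrightarrow> e j = e' j"
    then have "\<forall>j\<in>S. \<tau> e j = \<tau> e' j" using dependsD[OF m] by (metis lessThan_iff)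
    then show "((\<forall>j\<in>S. u j = \<tau> e j) \<and> P u) = ((\<forall>j\<in>S. u j = \<tau> e' j) \<and> P u)" by simp
  next
    fix u u' e :: "nat \<Rightarrow> 'a" assume "\<And>l. l < r \<Longrightarrow> u l = u' l"
    then have eq: "u j = u' j" if "j \<in> S" for j using r that by auto
    then have "P u = P u'" by (rule dependsD[OF P(2)])
    with eq show "((\<forall>j\<in>S. u j = \<tau> e j) \<and> P u) = ((\<forall>j\<in>S. u' j = \<tau> e j) \<and> P u')" by simp
  qed
  moreover have "(\<exists>u. (\<forall>j\<in>S. u j = \<tau> e j) \<and> P u) \<longleftrightarrow> P (\<tau> e)" for e
    using dependsD[OF P(2)] by metis
  ultimately show ?thesis by simp
qed

abbreviation small :: "nat \<Rightarrow> 'a set \<Rightarrow> bool" where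
  "small K X \<equiv> finite X \<and> card X \<le> K"

text \<open>
  The negation says that \<open>K + 1\<close> distinct points of the fibre exist.
\<close>

lemma pdef_many:
  fixes P :: "(nat \<Rightarrow> 'b) \<Rightarrow> bool"
  assumes P: "pdef M P"
  shows "pdef M (\<lambda>e. \<not> (small K {x. P (e(i := x))}))"
proof -
  obtain m0 where m0: "depends {..<m0} P" using pdef_depends[OF P] .
  define m where "m = m0 + i + 1"
  have upd: "P (e(i := x)) = P (e'(i := x))" if "\<And>j. j < m \<Longrightarrow> e j = e' j" for e e' x
    by (rule dependsD[OF m0]) (use that in \<open>auto simp: m_def\<close>)
  define Q where "Q u e \<longleftrightarrow> (\<forall>l\<in>{..K}. P (e(i := u l))) \<and> (\<forall>l\<in>{..K}. \<forall>l'\<in>{..K}. l \<noteq> l' \<longrightarrow> u l \<noteq> u l')"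
    for u :: "nat \<Rightarrow> 'b" and e
  have "pdef M (\<lambda>e. Q (\<lambda>l. e (m + l)) e)"
    unfolding Q_def
  proof (intro pdef_conj pdef_Ball pdef_imp pdef_neg pdef_const pdef_eq finite_atMost)
    fix l
    have "pdef M (\<lambda>e. P (\<lambda>j. e (if j = i then m + l else j)))" by (rule pdef_rename[OF P])
    also have "(\<lambda>e. P (\<lambda>j. e (if j = i then m + l else j))) = (\<lambda>e. P (e(i := e (m + l))))"
      by (intro ext arg_cong[of _ _ P]) auto
    finally show "pdef M (\<lambda>e. P (e(i := e (m + l))))" .
  qed
  then have "pdef M (\<lambda>e. \<exists>u. Q u e)"
  proof (rule pdef_ex_fun[where r = "Suc K"])
    show "Q u e \<longleftrightarrow> Q u e'" if "\<And>j. j < m \<Longrightarrow> e j = e' j" for u e e'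
      unfolding Q_def using upd[OF that] by simp
    show "Q u e \<longleftrightarrow> Q u' e" if "\<And>l. l < Suc K \<Longrightarrow> u l = u' l" for u u' e
      unfolding Q_def using that by simp
  qed
  moreover have "(\<exists>u. Q u e) \<longleftrightarrow> \<not> (small K {x. P (e(i := x))})" for e
  proof
    assume "\<exists>u. Q u e"
    then obtain u where "Q u e" ..
    then have "inj_on u {..K}" "u ` {..K} \<subseteq> {x. P (e(i := x))}"
      unfolding Q_def inj_on_def by auto
    then show "\<not> (small K {x. P (e(i := x))})"
      using card_inj_on_le[of u "{..K}" "{x. P (e(i := x))}"] by auto
  next
    assume *: "\<not> (small K {x. P (e(i := x))})"
    have "\<exists>T. finite T \<and> card T = Suc K \<and> T \<subseteq> {x. P (e(i := x))}"
    proof (cases "finite {x. P (e(i := x))}")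
      case True
      with * have "Suc K \<le> card {x. P (e(i := x))}" by simp
      then show ?thesis using obtain_subset_with_card_n by metis
    next
      case False
      then show ?thesis using infinite_arbitrarily_large by metis
    qed
    then obtain T where T: "finite T" "card T = Suc K" "T \<subseteq> {x. P (e(i := x))}" by blast
    then obtain u where "bij_betw u {0..<Suc K} T"
      using ex_bij_betw_nat_finite[OF T(1)] by metis
    then have "Q u e"
      using T(3) unfolding Q_def bij_betw_def inj_on_def
      by (simp add: atLeast0LessThan lessThan_Suc_atMost) blast
    then show "\<exists>u. Q u e" by (rule exI[of _ u])
  qed
  ultimately show ?thesis by simp
qed

text \<open>
  The fibre has at most \<open>K\<close> points, so it can be listed by an existential quantifier, and
  its sum does not depend on the order of the list.
\<close>

lemma fdef_fibre_sum:
  assumes plus: "pdef M (\<lambda>e :: nat \<Rightarrow> 'a::ab_group_add. e 0 + e 1 = e 2)" and P: "pdef M P"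
    and fin: "\<And>e. small K {x. P (e(i := x))}"
  shows "fdef M (\<lambda>e. \<Sum>{x. P (e(i := x))})"
proof -
  obtain m0 where m0: "depends {..<m0} P" using pdef_depends[OF P] .
  have main: "pdef M (\<lambda>e. e j = \<Sum>{x. P (e(i := x))})" for j
  proof -
    define m where "m = m0 + i + j + 1"
    have upd: "P (e(i := x)) = P (e'(i := x))" if "\<And>j. j < m \<Longrightarrow> e j = e' j" for e e' x
      by (rule dependsD[OF m0]) (use that in \<open>auto simp: m_def\<close>)
    define Q where "Q r u e \<longleftrightarrow> (\<forall>x. P (e(i := x)) \<longleftrightarrow> (\<exists>l\<in>{..<r}. x = u l)) \<and>
        (\<forall>l\<in>{..<r}. \<forall>l'\<in>{..<r}. l \<noteq> l' \<longrightarrow> u l \<noteq> u l') \<and> e j = (\<Sum>l<r. u l)"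
      for r and u e :: "nat \<Rightarrow> 'a"
    have "pdef M (\<lambda>e. \<exists>u. Q r u e)" for r
    proof -
      have "pdef M (\<lambda>e. P e \<longleftrightarrow> (\<exists>l\<in>{..<r}. e i = e (m + l)))"
        by (intro pdef_iff P pdef_Bex finite_lessThan pdef_eq)
      from pdef_all[OF this, of i]
      have "pdef M (\<lambda>e. \<forall>x. P (e(i := x)) \<longleftrightarrow> (\<exists>l\<in>{..<r}. x = e (m + l)))"
        by (simp add: m_def)
      then have "pdef M (\<lambda>e. Q r (\<lambda>l. e (m + l)) e)"
        unfolding Q_def
        by (intro pdef_conj pdef_Ball pdef_imp pdef_neg pdef_const pdef_eq finite_lessThan
            pdef_affine_eq[OF plus] affine_var affine_sum)
      then show "pdef M (\<lambda>e. \<exists>u. Q r u e)"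
      proof (rule pdef_ex_fun[where r = r])
        show "Q r u e \<longleftrightarrow> Q r u e'" if "\<And>j. j < m \<Longrightarrow> e j = e' j" for u e e'
          unfolding Q_def using upd[OF that] that[of j] by (simp add: m_def)
        show "Q r u e \<longleftrightarrow> Q r u' e" if "\<And>l. l < r \<Longrightarrow> u l = u' l" for u u' e
          unfolding Q_def using that by simp
      qed
    qed
    then have "pdef M (\<lambda>e. \<exists>r\<in>{..K}. \<exists>u. Q r u e)"
      by (intro pdef_Bex finite_atMost)
    moreover have "(\<exists>r\<in>{..K}. \<exists>u. Q r u e) \<longleftrightarrow> e j = \<Sum>{x. P (e(i := x))}" for e
    proof
      assume "\<exists>r\<in>{..K}. \<exists>u. Q r u e"
      then obtain r u where "Q r u e" by blast
      then have "{x. P (e(i := x))} = u ` {..<r}" "inj_on u {..<r}" "e j = (\<Sum>l<r. u l)"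
        unfolding Q_def inj_on_def by auto
      then show "e j = \<Sum>{x. P (e(i := x))}" by (simp add: sum.reindex)
    next
      assume *: "e j = \<Sum>{x. P (e(i := x))}"
      define T where "T = {x. P (e(i := x))}"
      have T: "finite T" "card T \<le> K" using fin[of e] by (simp_all add: T_def)
      obtain u where u: "bij_betw u {..<card T} T"
        using ex_bij_betw_nat_finite[OF T(1)] by (auto simp: atLeast0LessThan)
      have "(\<Sum>l<card T. u l) = \<Sum>T" using sum.reindex_bij_betw[OF u, of "\<lambda>x. x"] .
      moreover have "u ` {..<card T} = T" "inj_on u {..<card T}" using u by (auto simp: bij_betw_def)
      ultimately have "Q (card T) u e"
        unfolding Q_def inj_on_def using * T_def by auto
      with T show "\<exists>r\<in>{..K}. \<exists>u. Q r u e" by blast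
    qed
    ultimately show ?thesis by simp
  qed
  have "depends {..<m0} (\<lambda>e. \<Sum>{x. P (e(i := x))})"
  proof (rule dependsI)
    fix e e' :: "nat \<Rightarrow> 'a" assume h: "\<And>i. i \<in> {..<m0} \<Longrightarrow> e i = e' i"
    have "P (e(i := x)) = P (e'(i := x))" for x
      by (rule dependsD[OF m0]) (use h in auto)
    then show "\<Sum>{x. P (e(i := x))} = \<Sum>{x. P (e'(i := x))}" by simp
  qed
  with main show ?thesis unfolding fdef_def by blast
qed

lemma group_structure_plus:
  "pdef (group_structure :: (oag_fun, oag_rel, 'a::ab_group_add) fo_structure) (\<lambda>e. e 0 + e 1 = e 2)"
  using pdef_sat[of group_structure "Eq (Fn Plus [Var 0, Var 1]) (Var 2)"]
  by (simp add: group_structure_def)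

section \<open>Expansions whose definable unary sets are tame\<close>

text \<open>
  In direction \<open>i\<close> every fibre of \<open>P\<close> is cut out by walls that are affine functions of the remaining
  coordinates in \<open>S\<close>.
\<close>

definition walls :: "nat set \<Rightarrow> nat \<Rightarrow> int \<Rightarrow> ((nat \<Rightarrow> 'a::linordered_ab_group_add) \<Rightarrow> 'a) set \<Rightarrow>
    ((nat \<Rightarrow> 'a) \<Rightarrow> bool) \<Rightarrow> bool" where
  "walls S i A L P \<longleftrightarrow> finite L \<and> (\<forall>u\<in>L. affine u \<and> depends (S - {i}) u) \<and>
     (\<forall>e. cut A ((\<lambda>u. u e) ` L) {x. P (e(i := x))})"

lemma wallsD:
  assumes "walls S i A L P"
  shows "finite L" "\<And>u. u \<in> L \<Longrightarrow> affine u" "\<And>u. u \<in> L \<Longrightarrow> depends (S - {i}) u"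
    "\<And>e. cut A ((\<lambda>u. u e) ` L) {x. P (e(i := x))}"
  using assms unfolding walls_def by blast+

context regular_group
begin

text \<open>
  The affine forms produced by quantifier elimination may involve coordinates outside \<open>S\<close>; these are set
  to 0, which does not affect \<open>P\<close>. In \<open>N x + r\<close> the variable \<open>x\<close> ranges freely, while all points
  obtained lie in one residue class, so that only the signs matter.
\<close>

lemma fibres_cut:
  fixes P :: "(nat \<Rightarrow> 'a) \<Rightarrow> bool"
  assumes "sigdet sgn3 P" "depends S P"
  shows "\<exists>N>0. \<forall>r. \<exists>A L. walls S i A L (\<lambda>e. P (e(i := N \<cdot> e i + r)))"
proof -
  obtain F N where "sigdet_by sgn3 F N P" using assms(1) unfolding sigdet_def by blast
  note F = sigdet_byD[OF this]
  have "\<exists>A L. walls S i A L (\<lambda>e. P (e(i := N \<cdot> e i + r)))" for r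
  proof -
    define \<tau> where "\<tau> e j = (if j = i then N \<cdot> e 0 + r else if j \<in> S then e (Suc j) else 0)" for e :: "nat \<Rightarrow> 'a" and j
    have \<tau>: "affine (\<lambda>e. \<tau> e j)" for j
      unfolding \<tau>_def
      by (cases "j = i"; cases "j \<in> S") (simp_all add: affine_add affine_int_mult affine_var affine_const)
    define F' where "F' = (\<lambda>f e. f (\<tau> e)) ` F"
    have F': "finite F'" "\<forall>f\<in>F'. affine f"
      unfolding F'_def using F(1,2) \<tau> by (auto intro: affine_subst)
    from oag.normalise[OF this] obtain A L0 L1 where AL: "0 < A" "finite L0" "finite L1"
      "\<forall>u\<in>L0. affine u" "\<forall>v\<in>L1. affine v"
      and sig: "\<forall>e e' x x'. (\<forall>u\<in>L0. sgn3 (A \<cdot> x - u e) = sgn3 (A \<cdot> x' - u e')) \<and>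
        (\<forall>v\<in>L1. sgn3 (v e) = sgn3 (v e')) \<longrightarrow> (\<forall>f\<in>F'. sgn3 (f (case_nat x e)) = sgn3 (f (case_nat x' e')))"
      by (elim exE conjE) (rule that)
    define res where "res e j = (if j \<in> S - {i} then e j else 0)" for e :: "nat \<Rightarrow> 'a" and j
    define L where "L = (\<lambda>u e. u (res e)) ` L0"
    have "affine (\<lambda>e. res e j)" for j
      by (cases "j \<in> S"; cases "j = i") (simp_all add: res_def affine_var affine_const)
    then have "\<forall>u\<in>L. affine u" using AL(4) by (auto simp: L_def intro: affine_subst)
    moreover have "depends (S - {i}) u" if u: "u \<in> L" for u
    proof (rule dependsI)
      fix e e' :: "nat \<Rightarrow> 'a" assume "\<And>j. j \<in> S - {i} \<Longrightarrow> e j = e' j"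
      then have "res e = res e'" by (auto simp: res_def)
      then show "u e = u e'" using u by (auto simp: L_def)
    qed
    moreover have "cut A ((\<lambda>u. u e) ` L) {x. P (e(i := N \<cdot> x + r))}" for e
    proof -
      have "P (e(i := N \<cdot> x + r)) \<longleftrightarrow> P (e(i := N \<cdot> y + r))"
        if h: "\<forall>w\<in>(\<lambda>u. u e) ` L. sgn3 (A \<cdot> x - w) = sgn3 (A \<cdot> y - w)" for x y
      proof -
        have P_eq: "P (e(i := N \<cdot> z + r)) \<longleftrightarrow> P (\<tau> (case_nat z (res e)))" for z
          by (rule dependsD[OF assms(2)]) (auto simp: \<tau>_def res_def)
        have "\<forall>u\<in>L0. sgn3 (A \<cdot> x - u (res e)) = sgn3 (A \<cdot> y - u (res e))"
          using h by (auto simp: L_def)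
        then have "\<forall>f\<in>F'. sgn3 (f (case_nat x (res e))) = sgn3 (f (case_nat y (res e)))"
          using sig by blast
        then have "\<forall>f\<in>F. sgn3 (f (\<tau> (case_nat x (res e)))) = sgn3 (f (\<tau> (case_nat y (res e))))"
          by (auto simp: F'_def)
        moreover have "\<exists>h. \<tau> (case_nat y (res e)) j = \<tau> (case_nat x (res e)) j + N \<cdot> h" for j
        proof (cases "j = i")
          case True
          then show ?thesis
            by (intro exI[of _ "y - x"]) (simp add: \<tau>_def zm.scale_right_diff_distrib)
        next
          case False
          then show ?thesis by (intro exI[of _ 0]) (simp add: \<tau>_def)
        qed
        ultimately show ?thesis unfolding P_eq by (intro F(4)) auto
      qed
      then show ?thesis using AL by (simp add: cut_def L_def)
    qed
    moreover have "finite L" using AL by (simp add: L_def)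
    ultimately have "walls S i A L (\<lambda>e. P (e(i := N \<cdot> e i + r)))" by (simp add: walls_def)
    then show ?thesis by blast
  qed
  then show ?thesis using F(3) by blast
qed

lemma reps_exist:
  assumes "0 < N"
  obtains R where "finite R" "\<And>x :: 'a. \<exists>r\<in>R. \<exists>h. x = N \<cdot> h + r"
  using finite_index[OF assms] by blast

end

text \<open>
  All that the two alternative hypotheses on \<open>M\<close> contribute is the dichotomy.
\<close>

locale tame_expansion = regular_group eps for eps :: "'a::linordered_ab_group_add" +
  fixes M :: "('f, 'r, 'a) fo_structure"
  assumes plus: "pdef M (\<lambda>e. e 0 + e 1 = e 2)"
    and qe: "pdef M P \<Longrightarrow> sigdet sgn3 P"
    and dichotomy: "pdef M P \<Longrightarrow> cut A W {x. P (e(i := x))} \<Longrightarrow>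
      finite {x. P (e(i := x))} \<or> finite (- {x. P (e(i := x))})"
begin

abbreviation "GS \<equiv> group_structure :: 'a oag_type"

lemma pdef_upd_affine:
  assumes "pdef M P" "affine f"
  shows "pdef M (\<lambda>e. P (e(i := f e)))"
proof -
  obtain m where m: "depends {..<m} P" using pdef_depends[OF assms(1)] .
  have "affine (\<lambda>e. (e(i := f e)) j)" for j
    by (cases "j = i") (simp_all add: affine_var assms(2))
  then show ?thesis
    by (intro pdef_subst_affine[OF plus assms(1) m, of "\<lambda>e. e(i := f e)"]) simp_all
qed

text \<open>
  By \<open>near_cut\<close> the set is covered by the finitely many hyperplanes \<open>A e i = u e + s eps\<close>. A hyperplane is
  definable in the group and has at most one point above each base point, so the part of \<open>P\<close> on it
  is recovered from its projection \<open>Q u s\<close>, to which the induction hypothesis applies.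
\<close>

lemma bounded_cut_fibres:
  assumes IH: "\<And>Q. pdef M Q \<Longrightarrow> depends (S - {i}) Q \<Longrightarrow> pdef GS Q"
    and P: "pdef M P" "depends S P"
    and W: "walls S i A L P"
    and bound: "\<And>e. small K {x. P (e(i := x))}"
  shows "pdef GS P"
proof -
  note L = wallsD(1-3)[OF W] and cut = wallsD(4)[OF W]
  define B where "B = A * int (K + 1)"
  have A: "0 < A" using cut by (auto simp: cut_def)
  define Q where "Q u s e \<longleftrightarrow> (\<exists>t. P (e(i := t)) \<and> A \<cdot> t = u e + s \<cdot> eps)" for u :: "(nat \<Rightarrow> 'a) \<Rightarrow> 'a" and s e
  have Q: "pdef GS (Q u s)" if u: "u \<in> L" for u s
  proof (rule IH)
    have "pdef M (\<lambda>e. P e \<and> A \<cdot> e i = u e + s \<cdot> eps)"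
      by (intro pdef_conj P pdef_affine_eq[OF plus] affine_int_mult affine_var affine_add L(2) u affine_const)
    from pdef_ex[OF this, of i] show "pdef M (Q u s)"
      by (simp add: Q_def[abs_def] depends_upd_Diff[OF L(3)[OF u]])
    show "depends (S - {i}) (Q u s)"
    proof (rule dependsI)
      fix e e' :: "nat \<Rightarrow> 'a" assume h: "\<And>j. j \<in> S - {i} \<Longrightarrow> e j = e' j"
      have "P (e(i := t)) = P (e'(i := t))" for t
        using h by (rule depends_fibre[OF P(2)])
      moreover have "u e = u e'" using h by (rule dependsD[OF L(3)[OF u]])
      ultimately show "Q u s e = Q u s e'" by (simp add: Q_def)
    qed
  qed
  have eq: "pdef GS (\<lambda>e. A \<cdot> e i = u e + s \<cdot> eps)" if u: "u \<in> L" for u s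
    by (intro pdef_affine_eq[OF group_structure_plus] affine_int_mult affine_var affine_add
        L(2) u affine_const)
  define R where "R e \<longleftrightarrow> (\<exists>u\<in>L. \<exists>s\<in>{- B..B}. A \<cdot> e i = u e + s \<cdot> eps \<and> Q u s e)" for e
  have "P e \<longleftrightarrow> R e" for e
  proof
    assume "P e"
    then have "e i \<in> {x. P (e(i := x))}" by simp
    from near_cut[OF cut _ _ this, of K] bound[of e]
    obtain u s where "u \<in> L" "\<bar>s\<bar> \<le> B" "A \<cdot> e i = u e + s \<cdot> eps" by (auto simp: B_def)
    moreover then have "Q u s e" using \<open>P e\<close> unfolding Q_def by (intro exI[of _ "e i"]) simp
    ultimately show "R e" unfolding R_def by force
  next
    assume "R e"
    then obtain u s t where "A \<cdot> e i = u e + s \<cdot> eps" "P (e(i := t))" "A \<cdot> t = u e + s \<cdot> eps"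
      unfolding R_def Q_def by blast
    then have "A \<cdot> t = A \<cdot> e i" by simp
    then have "t = e i" using A by (simp add: int_mult_eq_iff)
    with \<open>P (e(i := t))\<close> show "P e" by simp
  qed
  then have "P = R" by (rule ext)
  moreover have "pdef GS R"
    unfolding R_def by (intro pdef_Bex pdef_conj L(1) finite_atLeastAtMost_int Q eq)
  ultimately show ?thesis by simp
qed

text \<open>
  Small quotients leave only finitely many residue classes for the coordinate.
\<close>

lemma residue_split:
  assumes fS: "finite S" and i: "i \<in> S" and dep: "depends S P" and N: "0 < N"
    and def: "\<And>r. pdef GS (\<lambda>e. P (e(i := N \<cdot> e i + r)))"
  shows "pdef GS P"
proof -
  obtain R where R: "finite R" "\<And>x :: 'a. \<exists>r\<in>R. \<exists>h. x = N \<cdot> h + r" using reps_exist[OF N] by blast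
  obtain a where a: "a \<notin> S" using fS ex_new_if_finite infinite_UNIV_nat by blast
  have ai: "a \<noteq> i" using a i by blast
  have "pdef GS (\<lambda>e. P ((\<lambda>j. e (if j = i then a else j))(i := N \<cdot> e a + r)))" for r
    using pdef_rename[OF def[of r], of "\<lambda>j. if j = i then a else j"] by simp
  then have "pdef GS (\<lambda>e. e i = N \<cdot> e a + r \<and> P ((\<lambda>j. e (if j = i then a else j))(i := N \<cdot> e a + r)))" for r
    by (intro pdef_conj pdef_affine_eq[OF group_structure_plus] affine_var affine_add affine_int_mult affine_const)
  from pdef_ex[OF this, of a]
  have "pdef GS (\<lambda>e. \<exists>x. e i = N \<cdot> x + r \<and> P ((\<lambda>j. (e(a := x)) (if j = i then a else j))(i := N \<cdot> x + r)))" for r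
    using ai by simp
  moreover have "P ((\<lambda>j. (e(a := x)) (if j = i then a else j))(i := N \<cdot> x + r)) \<longleftrightarrow> P (e(i := N \<cdot> x + r))" for e x r
    by (rule dependsD[OF dep]) (use a in auto)
  ultimately have "pdef GS (\<lambda>e. \<exists>x. e i = N \<cdot> x + r \<and> P (e(i := N \<cdot> x + r)))" for r by simp
  then have "pdef GS (\<lambda>e. \<exists>r\<in>R. \<exists>x. e i = N \<cdot> x + r \<and> P (e(i := N \<cdot> x + r)))"
    by (intro pdef_Bex R(1))
  moreover have "(\<exists>r\<in>R. \<exists>x. e i = N \<cdot> x + r \<and> P (e(i := N \<cdot> x + r))) \<longleftrightarrow> P e" for e
  proof
    assume "\<exists>r\<in>R. \<exists>x. e i = N \<cdot> x + r \<and> P (e(i := N \<cdot> x + r))"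
    then obtain r x where "e i = N \<cdot> x + r" "P (e(i := N \<cdot> x + r))" by blast
    then have "P (e(i := e i))" by (simp only:)
    then show "P e" by simp
  next
    assume "P e"
    obtain r x where "r \<in> R" "e i = N \<cdot> x + r" using R(2) by blast
    moreover have "P (e(i := e i))" using \<open>P e\<close> by simp
    ultimately show "\<exists>r\<in>R. \<exists>x. e i = N \<cdot> x + r \<and> P (e(i := N \<cdot> x + r))"
      by (intro bexI[of _ r] exI[of _ x]) simp_all
  qed
  ultimately show ?thesis by simp
qed

lemma depends_upd_fun: "depends S P \<Longrightarrow> i \<in> S \<Longrightarrow> depends S (\<lambda>e. P (e(i := f (e i))))"
  by (rule dependsI, erule dependsD) auto

lemma pdef_residue: "pdef M P \<Longrightarrow> pdef M (\<lambda>e. P (e(i := N \<cdot> e i + r)))"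
  by (intro pdef_upd_affine affine_add affine_int_mult affine_var affine_const)

lemma bounded_fibres:
  assumes fS: "finite S" and i: "i \<in> S"
    and IH: "\<And>Q. pdef M Q \<Longrightarrow> depends (S - {i}) Q \<Longrightarrow> pdef GS Q"
    and P: "pdef M P" "depends S P"
    and bound: "\<And>e. small K {x. P (e(i := x))}"
  shows "pdef GS P"
proof -
  obtain N where N: "0 < N" and W: "\<And>r. \<exists>A L. walls S i A L (\<lambda>e. P (e(i := N \<cdot> e i + r)))"
    using fibres_cut[OF qe[OF P(1)] P(2)] by blast
  show ?thesis
  proof (rule residue_split[OF fS i P(2) N])
    fix r
    obtain A L where W: "walls S i A L (\<lambda>e. P (e(i := N \<cdot> e i + r)))" using W by blast
    show "pdef GS (\<lambda>e. P (e(i := N \<cdot> e i + r)))"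
    proof (rule bounded_cut_fibres[OF IH _ _ W])
      show "pdef M (\<lambda>e. P (e(i := N \<cdot> e i + r)))" by (rule pdef_residue[OF P(1)])
      show "depends S (\<lambda>e. P (e(i := N \<cdot> e i + r)))" by (rule depends_upd_fun[OF P(2) i])
      fix e
      have inj: "inj_on (\<lambda>x. N \<cdot> x + r) {x. P (e(i := N \<cdot> x + r))}"
        using N by (simp add: inj_on_def int_mult_eq_iff)
      have sub: "(\<lambda>x. N \<cdot> x + r) ` {x. P (e(i := N \<cdot> x + r))} \<subseteq> {x. P (e(i := x))}" by auto
      show "small K {x. P ((e(i := x))(i := N \<cdot> (e(i := x)) i + r))}"
        using inj_on_finite[OF inj sub] card_inj_on_le[OF inj sub] bound[of e]
        by (simp add: order_trans)
    qed
  qed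
qed

text \<open>
  The dichotomy requires a set cut out by walls; every definable unary set becomes one on each
  residue class.
\<close>

lemma unary_residue_dichotomy:
  assumes "pdef M (\<lambda>e. e i \<in> D)"
  shows "\<exists>N>0. \<forall>r. finite {x. N \<cdot> x + r \<in> D} \<or> finite (- {x. N \<cdot> x + r \<in> D})"
proof -
  let ?P = "\<lambda>e :: nat \<Rightarrow> 'a. e i \<in> D"
  have "depends {i} ?P" by (simp add: depends_def)
  then obtain N where N: "0 < N" and W: "\<And>r. \<exists>A L. walls {i} i A L (\<lambda>e. (e(i := N \<cdot> e i + r)) i \<in> D)"
    using fibres_cut[OF qe[OF assms]] by blast
  have "finite {x. N \<cdot> x + r \<in> D} \<or> finite (- {x. N \<cdot> x + r \<in> D})" for r
  proof -
    obtain A L where "walls {i} i A L (\<lambda>e. (e(i := N \<cdot> e i + r)) i \<in> D)" using W by blast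
    from wallsD(4)[OF this, of "\<lambda>_. 0"]
    have c: "cut A ((\<lambda>u. u (\<lambda>_. 0)) ` L) {x. N \<cdot> x + r \<in> D}" by simp
    have "pdef M (\<lambda>e. (e(i := N \<cdot> e i + r)) i \<in> D)" by (rule pdef_residue[OF assms])
    from dichotomy[OF this, of A "(\<lambda>u. u (\<lambda>_. 0)) ` L" "\<lambda>_. 0" i] c
    show ?thesis by simp
  qed
  with N show ?thesis by blast
qed

end

section \<open>Uniform bounds on fibres\<close>

context tame_expansion
begin

text \<open>
  Right end points minus left end points, with intervals open on the left. This measures a fibre by addition alone, without reference to
  the order, and with a sign that distinguishes finite from cofinite fibres.
\<close>

definition jump :: "((nat \<Rightarrow> 'a) \<Rightarrow> bool) \<Rightarrow> nat \<Rightarrow> (nat \<Rightarrow> 'a) \<Rightarrow> 'a" where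
  "jump P i e = \<Sum>{x. P (e(i := x)) \<and> \<not> P (e(i := x + eps))} - \<Sum>{x. \<not> P (e(i := x)) \<and> P (e(i := x + eps))}"

text \<open>
  Both sides compute \<open>\<Sum>X - \<Sum>(X - eps)\<close>, where the common elements of \<open>X\<close> and its translate cancel.
\<close>

lemma jump_finite:
  fixes X :: "'a set"
  assumes "finite X"
  shows "\<Sum>{x. x \<in> X \<and> x + eps \<notin> X} - \<Sum>{x. x \<notin> X \<and> x + eps \<in> X} = int (card X) \<cdot> eps"
proof -
  define Y where "Y = (\<lambda>x. x - eps) ` X"
  have Y: "finite Y" "x + eps \<in> X \<longleftrightarrow> x \<in> Y" for x
    using assms by (auto simp: Y_def intro: image_eqI[of _ _ "x + eps"])
  have "{x. x \<in> X \<and> x + eps \<notin> X} = X - Y" "{x. x \<notin> X \<and> x + eps \<in> X} = Y - X"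
    using Y(2) by auto
  moreover have "\<Sum>X = \<Sum>(X \<inter> Y) + \<Sum>(X - Y)" "\<Sum>Y = \<Sum>(X \<inter> Y) + \<Sum>(Y - X)"
    using sum.Int_Diff[OF assms, of "\<lambda>x. x" Y] sum.Int_Diff[OF Y(1), of "\<lambda>x. x" X]
    by (simp_all only: Int_commute)
  moreover have "\<Sum>Y = (\<Sum>x\<in>X. x - eps)"
    unfolding Y_def by (subst sum.reindex) (simp_all add: inj_on_def)
  moreover have "(\<Sum>x\<in>X. x - eps) = \<Sum>X - int (card X) \<cdot> eps"
    using assms
    by (induction X rule: finite_induct) (simp_all add: int_mult_0 int_mult_add_one add.commute[of 1])
  ultimately show ?thesis by (simp add: algebra_simps)
qed

lemma jump_fibre_finite: "finite {x. P (e(i := x))} \<Longrightarrow> jump P i e = int (card {x. P (e(i := x))}) \<cdot> eps"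
  using jump_finite[of "{x. P (e(i := x))}"] by (simp add: jump_def)

text \<open>
  Passing to the complement exchanges left and right end points.
\<close>

lemma jump_fibre_cofinite:
  "finite {x. \<not> P (e(i := x))} \<Longrightarrow> jump P i e = - (int (card {x. \<not> P (e(i := x))}) \<cdot> eps)"
  using jump_finite[of "{x. \<not> P (e(i := x))}"] by (simp add: jump_def algebra_simps)

lemma depends_jump:
  assumes "depends S P"
  shows "depends (S - {i}) (jump P i)"
proof (rule dependsI)
  fix e e' :: "nat \<Rightarrow> 'a" assume h: "\<And>j. j \<in> S - {i} \<Longrightarrow> e j = e' j"
  have "P (e(i := t)) = P (e'(i := t))" for t
    using h by (rule depends_fibre[OF assms])
  then show "jump P i e = jump P i e'" by (simp add: jump_def)
qed

end

text \<open>
  The setting of one induction step: \<open>P\<close> has been restricted to a residue class of coordinate \<open>i\<close>, so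
  that its fibres in this direction have the walls \<open>u e\<close>, and sets that depend on the remaining variables
  only are already understood.
\<close>

locale cut_fibres = tame_expansion +
  fixes S :: "nat set" and i :: nat and P :: "(nat \<Rightarrow> 'a) \<Rightarrow> bool"
    and A :: int and L :: "((nat \<Rightarrow> 'a) \<Rightarrow> 'a) set"
  assumes finite_S: "finite S" and i_in_S: "i \<in> S"
    and IH: "\<And>Q. pdef M Q \<Longrightarrow> depends (S - {i}) Q \<Longrightarrow> pdef GS Q"
    and pdef_P: "pdef M P" and depends_P: "depends S P"
    and walls: "walls S i A L P"
begin

lemmas L = wallsD(1-3)[OF walls] and cut = wallsD(4)[OF walls]

lemma A_pos: "0 < A"
  using cut by (auto simp: cut_def)

lemma fibre_dichotomy: "finite {x. P (e(i := x))} \<or> finite {x. \<not> P (e(i := x))}"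
proof -
  have "finite {x. P (e(i := x))} \<or> finite (- {x. P (e(i := x))})"
    by (rule dichotomy[OF pdef_P cut])
  then show ?thesis by (simp only: Collect_neg_eq)
qed

lemma cut': "cut A ((\<lambda>u. u e) ` L) {x. \<not> P (e(i := x))}"
  using cut_compl[OF cut[of e]] by (simp add: Collect_neg_eq)

text \<open>
  Membership can change between \<open>x\<close> and \<open>x + eps\<close> only if \<open>A x\<close> is within \<open>A\<close> steps of a wall. Unlike the fibres
  themselves, their boundaries are therefore uniformly bounded.
\<close>

lemma boundary_bounded:
  "small (card (L \<times> {- A..A})) {x. P (e(i := x)) \<noteq> P (e(i := x + eps))}"
proof -
  define W where "W = (\<lambda>(u, s). u e + s \<cdot> eps) ` (L \<times> {- A..A})"
  have W: "finite W" "card W \<le> card (L \<times> {- A..A})"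
    unfolding W_def using L(1) card_image_le[of "L \<times> {- A..A}" "\<lambda>(u, s). u e + s \<cdot> eps"] by simp_all
  have "{x. P (e(i := x)) \<noteq> P (e(i := x + eps))} \<subseteq> {x. A \<cdot> x \<in> W}"
  proof
    fix x assume "x \<in> {x. P (e(i := x)) \<noteq> P (e(i := x + eps))}"
    then have "\<not> (\<forall>w\<in>(\<lambda>u. u e) ` L. sgn3 (A \<cdot> x - w) = sgn3 (A \<cdot> (x + eps) - w))"
      using cutD[OF cut[of e], of x "x + eps"] by auto
    then obtain u where u: "u \<in> L" "sgn3 (A \<cdot> x - u e) \<noteq> sgn3 (A \<cdot> (x + eps) - u e)" by auto
    define y where "y = A \<cdot> x - u e"
    have y: "sgn3 y \<noteq> sgn3 (y + A \<cdot> eps)"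
      using u(2) by (simp add: y_def zm.scale_right_distrib algebra_simps)
    have nn: "0 \<le> A \<cdot> eps" using A_pos eps_nonneg by (intro int_mult_nonneg) auto
    have "y \<le> 0"
    proof (rule ccontr)
      assume "\<not> y \<le> 0"
      then have "0 < y" by simp
      moreover from this nn have "0 < y + A \<cdot> eps" by (rule add_pos_nonneg)
      ultimately show False using y by (auto simp: sgn3_eq_iff)
    qed
    moreover have "0 \<le> y + A \<cdot> eps"
    proof (rule ccontr)
      assume "\<not> 0 \<le> y + A \<cdot> eps"
      then have "y + A \<cdot> eps < 0" by simp
      moreover from this nn have "y < 0" by (meson le_add_same_cancel1 le_less_trans)
      ultimately show False using y by (auto simp: sgn3_eq_iff)
    qed
    then have "- (A \<cdot> eps) \<le> y" using add_le_cancel_right[of "- (A \<cdot> eps)" "A \<cdot> eps" y] by simp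
    moreover have "y \<le> A \<cdot> eps" using \<open>y \<le> 0\<close> nn by (rule order_trans)
    ultimately have "\<exists>s. \<bar>s\<bar> \<le> A \<and> y = s \<cdot> eps"
      using A_pos by (intro near_zero) simp_all
    then obtain s where "\<bar>s\<bar> \<le> A" "A \<cdot> x = u e + s \<cdot> eps" by (auto simp: y_def diff_eq_eq add.commute)
    then have "A \<cdot> x \<in> W" unfolding W_def using u(1) by (intro image_eqI[of _ _ "(u, s)"]) auto
    then show "x \<in> {x. A \<cdot> x \<in> W}" by simp
  qed
  then show ?thesis
    using finite_preimage_int_mult[OF A_pos W(1)] W(2)
    by (meson card_mono finite_subset order_trans)
qed

lemma fdef_jump: "fdef M (jump P i)"
proof -
  have shift: "pdef M (\<lambda>e. P (e(i := e i + eps)))"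
    by (intro pdef_upd_affine pdef_P affine_add affine_var affine_const)
  have bound: "small (card (L \<times> {- A..A})) {x. Q x}"
    if "\<And>x. Q x \<Longrightarrow> P (e(i := x)) \<noteq> P (e(i := x + eps))" for Q e
  proof -
    have sub: "{x. Q x} \<subseteq> {x. P (e(i := x)) \<noteq> P (e(i := x + eps))}" using that by blast
    then have "finite {x. Q x}" using boundary_bounded[of e] finite_subset by blast
    moreover have "card {x. Q x} \<le> card {x. P (e(i := x)) \<noteq> P (e(i := x + eps))}"
      using boundary_bounded[of e] sub by (intro card_mono) simp_all
    ultimately show ?thesis using boundary_bounded[of e] by simp
  qed
  have "fdef M (\<lambda>e. \<Sum>{x. P (e(i := x)) \<and> \<not> P ((e(i := x))(i := (e(i := x)) i + eps))})"
  proof (rule fdef_fibre_sum[OF plus])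
    show "pdef M (\<lambda>e. P e \<and> \<not> P (e(i := e i + eps)))" by (intro pdef_conj pdef_neg pdef_P shift)
    show "small (card (L \<times> {- A..A})) {x. P (e(i := x)) \<and> \<not> P ((e(i := x))(i := (e(i := x)) i + eps))}" for e
      by (rule bound[of _ e]) auto
  qed
  moreover have "fdef M (\<lambda>e. \<Sum>{x. \<not> P (e(i := x)) \<and> P ((e(i := x))(i := (e(i := x)) i + eps))})"
  proof (rule fdef_fibre_sum[OF plus])
    show "pdef M (\<lambda>e. \<not> P e \<and> P (e(i := e i + eps)))" by (intro pdef_conj pdef_neg pdef_P shift)
    show "small (card (L \<times> {- A..A})) {x. \<not> P (e(i := x)) \<and> P ((e(i := x))(i := (e(i := x)) i + eps))}" for e
      by (rule bound[of _ e]) auto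
  qed
  ultimately show ?thesis
    using fdef_diff[OF plus] by (simp add: jump_def[abs_def])
qed

text \<open>
  The graph has a single point in each fibre, so it can be treated before the uniform bound for \<open>P\<close> is
  known.
\<close>

lemma jump_graph: "pdef M (\<lambda>e. e i = jump P i e)" "pdef GS (\<lambda>e. e i = jump P i e)"
proof -
  show g: "pdef M (\<lambda>e. e i = jump P i e)" using fdef_jump by (simp add: fdef_def)
  have upd: "jump P i (e(i := x)) = jump P i e" for e x
    by (rule depends_upd_Diff[OF depends_jump[OF depends_P]])
  show "pdef GS (\<lambda>e. e i = jump P i e)"
  proof (rule bounded_fibres[OF finite_S i_in_S IH g])
    show "depends S (\<lambda>e. e i = jump P i e)"
      using depends_jump[OF depends_P, of i] i_in_S unfolding depends_def
      by (metis Diff_iff)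
    show "small 1 {x. (e(i := x)) i = jump P i (e(i := x))}" for e
      by (simp add: upd)
  qed
qed

lemma jump_pos_finite: "0 < jump P i e \<Longrightarrow> finite {x. P (e(i := x))}"
  using fibre_dichotomy[of e] jump_fibre_cofinite[of P e i]
    int_mult_nonneg[OF _ eps_nonneg, of "int (card {x. \<not> P (e(i := x))})"] by auto

lemma jump_neg_cofinite: "jump P i e < 0 \<Longrightarrow> finite {x. \<not> P (e(i := x))}"
  using fibre_dichotomy[of e] jump_fibre_finite[of P e i]
    int_mult_nonneg[OF _ eps_nonneg, of "int (card {x. P (e(i := x))})"] by auto

lemma jump_multiple: "\<exists>n. jump P i e = n \<cdot> eps"
  using fibre_dichotomy[of e] jump_fibre_finite[of P e i] jump_fibre_cofinite[of P e i]
  by (metis zm.scale_minus_left)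

lemma jump_range_pdef: "pdef M (\<lambda>e. e i \<in> range (jump P i))"
proof -
  have "pdef M (\<lambda>e. \<exists>u. (\<lambda>j. if j \<in> S - {i} then u j else e j) i = jump P i (\<lambda>j. if j \<in> S - {i} then u j else e j))"
    by (rule pdef_ex_block[OF jump_graph(1)]) (simp add: finite_S)
  moreover have "(\<exists>u. (\<lambda>j. if j \<in> S - {i} then u j else e j) i = jump P i (\<lambda>j. if j \<in> S - {i} then u j else e j)) \<longleftrightarrow>
     e i \<in> range (jump P i)" for e
  proof -
    have "jump P i (\<lambda>j. if j \<in> S - {i} then u j else e j) = jump P i u" for u
      by (rule dependsD[OF depends_jump[OF depends_P]]) simp
    then show ?thesis by auto
  qed
  ultimately show ?thesis by simp
qed

text \<open>
  The multiples of \<open>eps\<close> form a convex subgroup, which is therefore closed under division.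
\<close>

lemma eps_multiples_pure:
  assumes "0 < k" "k \<cdot> \<omega> = z \<cdot> eps"
  shows "\<exists>n. \<omega> = n \<cdot> eps"
proof -
  have 1: "z \<cdot> eps \<le> \<bar>z\<bar> \<cdot> eps" "- (\<bar>z\<bar> \<cdot> eps) \<le> z \<cdot> eps"
    using int_mult_le_left[of z "\<bar>z\<bar>" eps] int_mult_le_left[of "- \<bar>z\<bar>" z eps] eps_nonneg by auto
  have 0: "0 \<le> \<bar>z\<bar> \<cdot> eps" using eps_nonneg by (intro int_mult_nonneg) auto
  have "\<omega> \<le> \<bar>z\<bar> \<cdot> eps"
  proof (cases "0 \<le> \<omega>")
    case True
    have "1 \<cdot> \<omega> \<le> k \<cdot> \<omega>" using assms(1) True by (intro int_mult_le_left) auto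
    then show ?thesis using 1 assms(2) by (simp add: int_mult_one)
  next
    case False
    then show ?thesis using 0 by simp
  qed
  moreover have "- (\<bar>z\<bar> \<cdot> eps) \<le> \<omega>"
  proof (cases "0 \<le> \<omega>")
    case True
    have "- (\<bar>z\<bar> \<cdot> eps) \<le> 0" using 0 by simp
    then show ?thesis using True by (rule order_trans)
  next
    case False
    then have "1 \<cdot> (- \<omega>) \<le> k \<cdot> (- \<omega>)" using assms(1) by (intro int_mult_le_left) auto
    then have "k \<cdot> \<omega> \<le> \<omega>" by (simp add: int_mult_one)
    then show ?thesis using 1 assms(2) by simp
  qed
  ultimately show ?thesis using near_zero[of "\<bar>z\<bar>" \<omega>] by auto
qed

text \<open>
  An infinite range would contain all but finitely many elements of a residue class, in particular
  two that differ by a multiple of \<open>\<omega>\<close>, but all values are multiples of \<open>eps\<close>.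
\<close>

lemma jump_range_finite_not_cyclic:
  assumes \<omega>: "\<And>n. \<omega> \<noteq> n \<cdot> eps"
  shows "finite (range (jump P i))"
proof (rule ccontr)
  assume inf: "infinite (range (jump P i))"
  obtain N where N: "0 < N" "\<forall>r. finite {x. N \<cdot> x + r \<in> range (jump P i)} \<or>
      finite (- {x. N \<cdot> x + r \<in> range (jump P i)})"
    using unary_residue_dichotomy[OF jump_range_pdef] by blast
  define E where "E r = {x. N \<cdot> x + r \<in> range (jump P i)}" for r
  have dich: "finite (E r) \<or> finite (- E r)" for r
    unfolding E_def by (rule spec[OF N(2)])
  obtain R where R: "finite R" "\<And>x :: 'a. \<exists>r\<in>R. \<exists>h. x = N \<cdot> h + r"
    using reps_exist[OF N(1)] by blast
  have "range (jump P i) \<subseteq> (\<Union>r\<in>R. (\<lambda>x. N \<cdot> x + r) ` E r)"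
  proof
    fix y assume y: "y \<in> range (jump P i)"
    obtain r h where "r \<in> R" "y = N \<cdot> h + r" using R(2) by blast
    with y show "y \<in> (\<Union>r\<in>R. (\<lambda>x. N \<cdot> x + r) ` E r)"
      by (intro UN_I[of r] image_eqI[of _ _ h]) (simp_all add: E_def)
  qed
  with inf have "infinite (\<Union>r\<in>R. (\<lambda>x. N \<cdot> x + r) ` E r)"
    using finite_subset by blast
  then obtain r where "infinite ((\<lambda>x. N \<cdot> x + r) ` E r)"
    using R(1) by auto
  then have r: "infinite (E r)" using finite_imageI by blast
  then have cof: "finite (- E r)" using dich by blast
  obtain x0 where x0: "N \<cdot> x0 + r \<in> range (jump P i)" using r not_finite_existsD unfolding E_def by blast
  have "\<omega> \<noteq> 0" using \<omega>[of 0] by simp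
  then have "inj (\<lambda>s. x0 + int (Suc s) \<cdot> \<omega>)"
    by (simp add: inj_def int_mult_right_eq_iff del: of_nat_Suc)
  then have "infinite (range (\<lambda>s. x0 + int (Suc s) \<cdot> \<omega>))"
    using finite_imageD infinite_UNIV_nat by blast
  then have "\<not> range (\<lambda>s. x0 + int (Suc s) \<cdot> \<omega>) \<subseteq> - E r"
    using cof finite_subset by blast
  then obtain s where s: "N \<cdot> (x0 + int (Suc s) \<cdot> \<omega>) + r \<in> range (jump P i)" by (auto simp: E_def)
  obtain a b where ab: "N \<cdot> (x0 + int (Suc s) \<cdot> \<omega>) + r = a \<cdot> eps" "N \<cdot> x0 + r = b \<cdot> eps"
    using s x0 jump_multiple by (metis imageE)
  have "(N * int (Suc s)) \<cdot> \<omega> = (N \<cdot> (x0 + int (Suc s) \<cdot> \<omega>) + r) - (N \<cdot> x0 + r)"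
    by (simp add: zm.scale_right_distrib del: of_nat_Suc)
  also have "\<dots> = (a - b) \<cdot> eps" by (simp only: ab zm.scale_left_diff_distrib)
  finally have "(N * int (Suc s)) \<cdot> \<omega> = (a - b) \<cdot> eps" .
  moreover have "0 < N * int (Suc s)" using N(1) by simp
  ultimately show False using eps_multiples_pure \<omega> by blast
qed

text \<open>
  Infinitely many values leave two points \<open>p\<close> and \<open>q\<close> of the graph that satisfy the same equations and have
  congruent coordinates. On the line through them an equation satisfied by both holds
  identically, and one satisfied by neither holds at most once. As membership in the graph depends
  only on these equations and on residues, the graph contains almost all of the line.
\<close>

lemma jump_line:
  assumes inf: "infinite (range (jump P i))"
  obtains p q B where "p i < q i" "finite B"
    "\<And>z. z \<notin> B \<Longrightarrow> jump P i (\<lambda>j. p j + z \<cdot> (q j - p j)) = p i + z \<cdot> (q i - p i)"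
proof -
  from group_pdef_sigdet[OF jump_graph(2)]
  obtain F N where F: "finite F" "\<forall>f\<in>F. affine f" "0 < N"
    and sig: "\<forall>e e'. (\<forall>f\<in>F. (f e = 0) = (f e' = 0)) \<and> (\<forall>j. \<exists>h. e' j = e j + N \<cdot> h) \<longrightarrow>
        (e i = jump P i e) = (e' i = jump P i e')"
    unfolding sigdet_def sigdet_by_def by (elim exE conjE) (rule that)
  obtain R where R: "finite R" "\<And>x :: 'a. \<exists>r\<in>R. \<exists>h. x = N \<cdot> h + r"
    using reps_exist[OF F(3)] by blast
  \<comment> \<open>a point of the graph with value d, normalised to vanish outside S so that finitely many coordinates matter\<close>
  define pt where "pt d j = (if j = i then d else if j \<in> S then (SOME e. jump P i e = d) j else 0)" for d j
  have pt: "jump P i (pt d) = d" if "d \<in> range (jump P i)" for d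
  proof -
    obtain e where "jump P i e = d" using \<open>d \<in> range (jump P i)\<close> by auto
    then have "jump P i (SOME e. jump P i e = d) = d" by (rule someI[of "\<lambda>e. jump P i e = d"])
    moreover have "jump P i (pt d) = jump P i (SOME e. jump P i e = d)"
      by (rule dependsD[OF depends_jump[OF depends_P]]) (simp add: pt_def)
    ultimately show ?thesis by simp
  qed
  define sg where "sg d = ({f\<in>F. f (pt d) = 0}, {(j, r)\<in>S \<times> R. \<exists>h. pt d j = N \<cdot> h + r})" for d
  have "finite (sg ` range (jump P i))"
    by (rule finite_subset[of _ "Pow F \<times> Pow (S \<times> R)"]) (use F R finite_S in \<open>auto simp: sg_def\<close>)
  from pigeonhole_infinite[OF inf this] obtain d0 where
    "infinite {d\<in>range (jump P i). sg d = sg d0}" by blast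
  then obtain d1 d2 where "d1 \<in> {d\<in>range (jump P i). sg d = sg d0}" "d2 \<in> {d\<in>range (jump P i). sg d = sg d0}"
      "d1 + int 0 \<cdot> eps < d2"
    by (rule infinite_far_apart)
  then have d: "d1 \<in> range (jump P i)" "d2 \<in> range (jump P i)" "sg d1 = sg d2" "d1 < d2" by auto
  define p where "p = pt d1"
  define q where "q = pt d2"
  have pi: "p i = d1" and qi: "q i = d2" by (simp_all add: p_def q_def pt_def)
  define B where "B = (\<Union>f\<in>{f\<in>F. f p \<noteq> 0}. {z. f p + z \<cdot> (f q - f p) = 0})"
  have "finite {z. a + z \<cdot> b = 0}" if "a \<noteq> 0" for a b :: 'a
  proof (rule finite_subset)
    show "{z. a + z \<cdot> b = 0} \<subseteq> {SOME z. a + z \<cdot> b = 0}"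
    proof
      fix z assume "z \<in> {z. a + z \<cdot> b = 0}"
      then have z: "a + z \<cdot> b = 0" by simp
      then have z': "a + (SOME z. a + z \<cdot> b = 0) \<cdot> b = 0" by (rule someI)
      have "b \<noteq> 0" using z that by auto
      have "z \<cdot> b = (SOME z. a + z \<cdot> b = 0) \<cdot> b" using z z' by (metis add_left_cancel)
      then have "(z - (SOME z. a + z \<cdot> b = 0)) \<cdot> b = 0" by (simp add: zm.scale_left_diff_distrib)
      with \<open>b \<noteq> 0\<close> show "z \<in> {SOME z. a + z \<cdot> b = 0}" by (auto simp: int_mult_eq_0_iff)
    qed
  qed simp
  then have B: "finite B" unfolding B_def using F(1) by auto
  have "jump P i (\<lambda>j. p j + z \<cdot> (q j - p j)) = p i + z \<cdot> (q i - p i)" if z: "z \<notin> B" for z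
  proof -
    let ?l = "\<lambda>j. p j + z \<cdot> (q j - p j)"
    have "(p i = jump P i p) = (?l i = jump P i ?l)"
    proof (rule sig[rule_format], intro conjI ballI allI)
      fix f assume f: "f \<in> F"
      have "f ?l = f p + z \<cdot> (f q - f p)" using affine_line F(2) f by blast
      moreover have "f p = 0 \<longleftrightarrow> f q = 0"
        using d(3) f unfolding sg_def p_def q_def by blast
      ultimately show "(f p = 0) = (f ?l = 0)" using z f unfolding B_def by auto
    next
      fix j
      have "\<exists>h. q j - p j = N \<cdot> h"
      proof (cases "j \<in> S")
        case True
        obtain r h where r: "r \<in> R" "p j = N \<cdot> h + r" using R(2) by blast
        then have "(j, r) \<in> snd (sg d1)" using True by (auto simp: sg_def p_def)
        then have "(j, r) \<in> snd (sg d2)" using d(3) by simp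
        then obtain k where "q j = N \<cdot> k + r" by (auto simp: sg_def q_def)
        with r show ?thesis by (intro exI[of _ "k - h"]) (simp add: zm.scale_right_diff_distrib)
      next
        case False
        then have "q j - p j = N \<cdot> 0" using i_in_S by (auto simp: p_def q_def pt_def)
        then show ?thesis ..
      qed
      then obtain h where "q j - p j = N \<cdot> h" ..
      then show "\<exists>h. ?l j = p j + N \<cdot> h"
        by (intro exI[of _ "z \<cdot> h"]) (simp add: mult.commute)
    qed
    moreover have "p i = jump P i p" using pt[OF d(1)] pi by (simp add: p_def)
    ultimately show ?thesis by simp
  qed
  with that[of p q B] pi qi d B show thesis by simp
qed

text \<open>
  On the line of \<open>jump_line\<close> the jump is positive at one end and negative at the other, so the fibres
  are finite at the first end and cofinite at the other. Moving the coordinate \<open>i\<close> with slope \<open>\<sigma>\<close> along the line puts the point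
  beyond all walls at both ends: outside \<open>P\<close> where fibres are finite, inside where they are cofinite.
  So the unary set \<open>D\<close> and its complement are both infinite on a residue class.
\<close>

lemma jump_range_finite_cyclic:
  assumes cyc: "\<And>x. \<exists>n. x = n \<cdot> eps"
  shows "finite (range (jump P i))"
proof (rule ccontr)
  assume "infinite (range (jump P i))"
  then obtain p q B where pq: "p i < q i" and B: "finite B"
    and line: "\<And>z. z \<notin> B \<Longrightarrow> jump P i (\<lambda>j. p j + z \<cdot> (q j - p j)) = p i + z \<cdot> (q i - p i)"
    using jump_line by metis
  have "eps \<noteq> 0" using cyc nontrivial by (metis less_irrefl zm.scale_zero_right)
  then have eps: "0 < eps" using eps_nonneg by simp
  obtain co where co: "\<And>x. x = co x \<cdot> eps" using cyc by metis
  define ln where "ln z j = p j + z \<cdot> (q j - p j)" for z j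
  have pq_co: "co (p i) < co (q i)"
  proof (rule ccontr)
    assume "\<not> co (p i) < co (q i)"
    then have "co (q i) \<cdot> eps \<le> co (p i) \<cdot> eps" using eps by (intro int_mult_le_left) auto
    then show False using pq co by (metis not_less)
  qed
  define \<alpha> where "\<alpha> u = co (u p)" for u :: "(nat \<Rightarrow> 'a) \<Rightarrow> 'a"
  define \<beta> where "\<beta> u = co (u q - u p)" for u :: "(nat \<Rightarrow> 'a) \<Rightarrow> 'a"
  \<comment> \<open>the slope of a line steeper than every wall\<close>
  define \<sigma> where "\<sigma> = 1 + (\<Sum>u\<in>L. \<bar>\<beta> u\<bar>)"
  have \<sigma>: "\<beta> u < A * \<sigma>" if "u \<in> L" for u
  proof -
    have "\<bar>\<beta> u\<bar> \<le> (\<Sum>u\<in>L. \<bar>\<beta> u\<bar>)" using L(1) that by (intro member_le_sum) auto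
    then have "\<beta> u < \<sigma>" "0 \<le> \<sigma>" by (auto simp: \<sigma>_def intro: order_trans)
    moreover have "1 * \<sigma> \<le> A * \<sigma>" using A_pos \<open>0 \<le> \<sigma>\<close> by (intro mult_right_mono) auto
    ultimately show ?thesis by simp
  qed
  define z0 where "z0 = \<bar>co (p i)\<bar> + (\<Sum>u\<in>L. \<bar>\<alpha> u\<bar>)"
  have \<alpha>: "\<bar>\<alpha> u\<bar> \<le> z0" if "u \<in> L" for u
    using L(1) that member_le_sum[of u L "\<lambda>u. \<bar>\<alpha> u\<bar>"] by (simp add: z0_def)
  have p_z0: "\<bar>co (p i)\<bar> \<le> z0" by (simp add: z0_def sum_nonneg)
  have wall: "A \<cdot> (\<sigma> \<cdot> (z \<cdot> eps)) - u (ln z) = (z * (A * \<sigma> - \<beta> u) - \<alpha> u) \<cdot> eps" if "u \<in> L" for u z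
  proof -
    have "u (ln z) = u p + z \<cdot> (u q - u p)" unfolding ln_def by (rule affine_line[OF L(2)[OF that]])
    also have "\<dots> = (\<alpha> u + z * \<beta> u) \<cdot> eps"
      using co[of "u p"] co[of "u q - u p"] by (simp add: \<alpha>_def \<beta>_def zm.scale_left_distrib flip: zm.scale_scale)
    finally have "A \<cdot> (\<sigma> \<cdot> (z \<cdot> eps)) - u (ln z) = (A * \<sigma> * z) \<cdot> eps - (\<alpha> u + z * \<beta> u) \<cdot> eps"
      by (simp add: mult.assoc)
    also have "\<dots> = (A * \<sigma> * z - (\<alpha> u + z * \<beta> u)) \<cdot> eps" by (simp only: zm.scale_left_diff_distrib)
    also have "A * \<sigma> * z - (\<alpha> u + z * \<beta> u) = z * (A * \<sigma> - \<beta> u) - \<alpha> u" by (simp add: algebra_simps)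
    finally show ?thesis .
  qed
  have jump_ln: "jump P i (ln z) = (co (p i) + z * (co (q i) - co (p i))) \<cdot> eps" if "z \<notin> B" for z
  proof -
    have "jump P i (ln z) = p i + z \<cdot> (q i - p i)" unfolding ln_def by (rule line[OF that])
    also have "\<dots> = co (p i) \<cdot> eps + z \<cdot> (co (q i) \<cdot> eps - co (p i) \<cdot> eps)"
      using co[of "p i"] co[of "q i"] by simp
    finally show ?thesis
      by (simp add: zm.scale_left_distrib zm.scale_left_diff_distrib zm.scale_right_diff_distrib right_diff_distrib)
  qed
  have right: "\<not> P ((ln z)(i := \<sigma> \<cdot> (z \<cdot> eps)))" if z: "z \<notin> B" "z0 < z" for z
  proof -
    have "1 * z \<le> (co (q i) - co (p i)) * z" using pq_co z p_z0 by (intro mult_right_mono) auto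
    then have "0 < co (p i) + z * (co (q i) - co (p i))" using z p_z0 by (simp add: mult.commute)
    from int_mult_less_left[OF this eps] have "0 < jump P i (ln z)"
      unfolding jump_ln[OF z(1)] by simp
    note fin = jump_pos_finite[OF this]
    have "\<forall>w\<in>(\<lambda>u. u (ln z)) ` L. w < A \<cdot> (\<sigma> \<cdot> (z \<cdot> eps))"
    proof
      fix w assume "w \<in> (\<lambda>u. u (ln z)) ` L"
      then obtain u where u: "u \<in> L" "w = u (ln z)" by blast
      have "z * 1 \<le> z * (A * \<sigma> - \<beta> u)" using \<sigma>[OF u(1)] z p_z0 by (intro mult_left_mono) auto
      then have "0 < z * (A * \<sigma> - \<beta> u) - \<alpha> u" using \<alpha>[OF u(1)] z by simp
      from int_mult_less_left[OF this eps] have "0 < A \<cdot> (\<sigma> \<cdot> (z \<cdot> eps)) - u (ln z)"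
        unfolding wall[OF u(1)] by simp
      then show "w < A \<cdot> (\<sigma> \<cdot> (z \<cdot> eps))" using u by simp
    qed
    then show ?thesis using beyond_cuts[OF cut fin] by simp
  qed
  have left: "P ((ln z)(i := \<sigma> \<cdot> (z \<cdot> eps)))" if z: "z \<notin> B" "z < - z0" for z
  proof -
    have "(co (q i) - co (p i)) * z \<le> 1 * z" using pq_co z p_z0 by (intro mult_right_mono_neg) auto
    then have "co (p i) + z * (co (q i) - co (p i)) < 0" using z p_z0 by (simp add: mult.commute)
    from int_mult_less_left[OF this eps] have "jump P i (ln z) < 0"
      unfolding jump_ln[OF z(1)] by simp
    note fin = jump_neg_cofinite[OF this]
    have "\<forall>w\<in>(\<lambda>u. u (ln z)) ` L. A \<cdot> (\<sigma> \<cdot> (z \<cdot> eps)) < w"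
    proof
      fix w assume "w \<in> (\<lambda>u. u (ln z)) ` L"
      then obtain u where u: "u \<in> L" "w = u (ln z)" by blast
      have "z * (A * \<sigma> - \<beta> u) \<le> z * 1" using \<sigma>[OF u(1)] z p_z0 by (intro mult_left_mono_neg) auto
      then have "z * (A * \<sigma> - \<beta> u) - \<alpha> u < 0" using \<alpha>[OF u(1)] z by simp
      from int_mult_less_left[OF this eps] have "A \<cdot> (\<sigma> \<cdot> (z \<cdot> eps)) - u (ln z) < 0"
        unfolding wall[OF u(1)] by simp
      then show "A \<cdot> (\<sigma> \<cdot> (z \<cdot> eps)) < w" using u by simp
    qed
    then show ?thesis using beyond_cuts[OF cut' fin] by simp
  qed
  define D where "D = {x. P (\<lambda>j. if j = i then \<sigma> \<cdot> x else p j + co (q j - p j) \<cdot> x)}"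
  have "affine (\<lambda>e. if j = i then \<sigma> \<cdot> e i else p j + co (q j - p j) \<cdot> e i)" for j
    by (cases "j = i") (simp_all add: affine_int_mult affine_var affine_add affine_const)
  then have "pdef M (\<lambda>e. P (\<lambda>j. if j = i then \<sigma> \<cdot> e i else p j + co (q j - p j) \<cdot> e i))"
    by (intro pdef_subst_affine[OF plus pdef_P depends_P finite_S])
  then have "pdef M (\<lambda>e. e i \<in> D)" by (simp add: D_def)
  from unary_residue_dichotomy[OF this] obtain N where N: "0 < N"
    and dich: "finite {x. N \<cdot> x + 0 \<in> D} \<or> finite (- {x. N \<cdot> x + 0 \<in> D})" by blast
  have D_iff: "z \<cdot> eps \<in> D \<longleftrightarrow> P ((ln z)(i := \<sigma> \<cdot> (z \<cdot> eps)))" for z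
  proof -
    have "co (q j - p j) \<cdot> (z \<cdot> eps) = z \<cdot> (q j - p j)" for j
      using co[of "q j - p j"] by (metis mult.commute zm.scale_scale)
    then have "(\<lambda>j. if j = i then \<sigma> \<cdot> (z \<cdot> eps) else p j + co (q j - p j) \<cdot> (z \<cdot> eps)) =
       (ln z)(i := \<sigma> \<cdot> (z \<cdot> eps))"
      by (auto simp: ln_def)
    then show ?thesis unfolding D_def by simp
  qed
  have B': "finite {z. N * z \<in> B}"
    using finite_vimageI[OF B, of "\<lambda>z. N * z"] N by (simp add: vimage_def inj_def)
  have inj: "inj (\<lambda>z. z \<cdot> eps)"
    using eps by (simp add: inj_def int_mult_right_eq_iff)
  have infinite_image: "infinite ((\<lambda>z. z \<cdot> eps) ` (T - {z. N * z \<in> B}))" if "infinite T" for T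
    using that B' inj by (metis Diff_infinite_finite finite_imageD inj_on_subset subset_UNIV)
  have z0: "0 \<le> z0" using p_z0 by simp
  have "(\<lambda>z. z \<cdot> eps) ` ({z0<..} - {z. N * z \<in> B}) \<subseteq> - {x. N \<cdot> x + 0 \<in> D}"
  proof (rule image_subsetI)
    fix z assume z: "z \<in> {z0<..} - {z. N * z \<in> B}"
    then have "1 * z \<le> N * z" using N z0 by (intro mult_right_mono) auto
    with z have "z0 < N * z" by simp
    then show "z \<cdot> eps \<in> - {x. N \<cdot> x + 0 \<in> D}" using right z D_iff[of "N * z"] by simp
  qed
  moreover have "(\<lambda>z. z \<cdot> eps) ` ({..<- z0} - {z. N * z \<in> B}) \<subseteq> {x. N \<cdot> x + 0 \<in> D}"
  proof (rule image_subsetI)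
    fix z assume z: "z \<in> {..<- z0} - {z. N * z \<in> B}"
    then have "N * z \<le> 1 * z" using N z0 by (intro mult_right_mono_neg) auto
    with z have "N * z < - z0" by simp
    then show "z \<cdot> eps \<in> {x. N \<cdot> x + 0 \<in> D}" using left z D_iff[of "N * z"] by simp
  qed
  ultimately show False
    using dich infinite_image[of "{z0<..}"] infinite_image[of "{..<- z0}"] finite_subset
      infinite_Ioi[of z0] infinite_Iio[of "- z0"] by blast
qed

text \<open>
  If \<open>eps = 0\<close>, all points of a finite fibre are walls. Otherwise the number of points, or of missing
  points, is read off from the jump, which takes finitely many values.
\<close>

lemma uniform_bound:
  "\<exists>K. \<forall>e. (small K {x. P (e(i := x))}) \<or>
           (small K {x. \<not> P (e(i := x))})"
proof (cases "eps = 0")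
  case True
  have bound: "card X \<le> card L" if "finite X" "cut A ((\<lambda>u. u e) ` L) X" for X e
  proof -
    have "X \<subseteq> {x. A \<cdot> x \<in> (\<lambda>u. u e) ` L}"
    proof
      fix x assume "x \<in> X"
      from near_cut[OF that(2,1) order_refl this] show "x \<in> {x. A \<cdot> x \<in> (\<lambda>u. u e) ` L}"
        by (auto simp: True)
    qed
    then have "card X \<le> card {x. A \<cdot> x \<in> (\<lambda>u. u e) ` L}"
      using finite_preimage_int_mult(1)[OF A_pos, of "(\<lambda>u. u e) ` L"] L(1) by (intro card_mono) auto
    also have "\<dots> \<le> card ((\<lambda>u. u e) ` L)"
      using L(1) by (intro finite_preimage_int_mult(2) A_pos) simp
    also have "\<dots> \<le> card L" using L(1) by (rule card_image_le)
    finally show ?thesis .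
  qed
  show ?thesis
    by (rule exI[of _ "card L"]) (use fibre_dichotomy bound cut cut' in blast)
next
  case False
  then have eps: "0 < eps" using eps_nonneg by simp
  have fin: "finite (range (jump P i))"
  proof (cases "\<forall>x. \<exists>n. x = n \<cdot> eps")
    case True
    then show ?thesis using jump_range_finite_cyclic by blast
  next
    case False
    then show ?thesis using jump_range_finite_not_cyclic by blast
  qed
  have inj: "inj (\<lambda>n. int n \<cdot> eps)" "inj (\<lambda>n. - (int n \<cdot> eps))"
    using eps by (simp_all add: inj_def int_mult_right_eq_iff)
  have "finite ((\<lambda>n. int n \<cdot> eps) -` range (jump P i) \<union> (\<lambda>n. - (int n \<cdot> eps)) -` range (jump P i))"
    using finite_vimageI[OF fin inj(1)] finite_vimageI[OF fin inj(2)] by simp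
  then obtain K where K: "\<And>n. int n \<cdot> eps \<in> range (jump P i) \<or> - (int n \<cdot> eps) \<in> range (jump P i) \<Longrightarrow> n \<le> K"
    unfolding finite_nat_set_iff_bounded_le by (metis UnI1 UnI2 vimageI2)
  show ?thesis
  proof (rule exI[of _ K], rule allI)
    fix e
    show "(small K {x. P (e(i := x))}) \<or>
           (small K {x. \<not> P (e(i := x))})"
      using fibre_dichotomy[of e]
    proof
      assume h: "finite {x. P (e(i := x))}"
      have "int (card {x. P (e(i := x))}) \<cdot> eps \<in> range (jump P i)"
        using jump_fibre_finite[OF h] by (metis rangeI)
      with h show ?thesis using K by blast
    next
      assume h: "finite {x. \<not> P (e(i := x))}"
      have "- (int (card {x. \<not> P (e(i := x))}) \<cdot> eps) \<in> range (jump P i)"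
        using jump_fibre_cofinite[OF h] by (metis rangeI)
      with h show ?thesis using K by blast
    qed
  qed
qed

lemma pdef_group: "pdef GS P"
proof -
  obtain K where K: "\<And>e. (small K {x. P (e(i := x))}) \<or>
           (small K {x. \<not> P (e(i := x))})"
    using uniform_bound by blast
  define C where "C e \<longleftrightarrow> \<not> (small K {x. P (e(i := x))})" for e
  have C: "pdef M C" unfolding C_def by (rule pdef_many[OF pdef_P])
  have C_dep: "depends (S - {i}) C"
  proof (rule dependsI)
    fix e e' :: "nat \<Rightarrow> 'a" assume h: "\<And>j. j \<in> S - {i} \<Longrightarrow> e j = e' j"
    have "P (e(i := t)) = P (e'(i := t))" for t
      using h by (rule depends_fibre[OF depends_P])
    then show "C e = C e'" by (simp add: C_def)
  qed
  have C_upd: "C (e(i := x)) = C e" for e x by (rule depends_upd_Diff[OF C_dep])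
  have "pdef GS (\<lambda>e. \<not> (P e \<longleftrightarrow> C e))"
  proof (rule bounded_fibres[OF finite_S i_in_S IH])
    show "pdef M (\<lambda>e. \<not> (P e \<longleftrightarrow> C e))" by (intro pdef_neg pdef_iff pdef_P C)
    show "depends S (\<lambda>e. \<not> (P e \<longleftrightarrow> C e))"
      using depends_P depends_mono[OF C_dep, of S] unfolding depends_def by (metis Diff_subset)
    show "small K {x. \<not> (P (e(i := x)) \<longleftrightarrow> C (e(i := x)))}" for e
      using K[of e] by (cases "C e") (auto simp: C_upd C_def[of e])
  qed
  then have "pdef GS (\<lambda>e. \<not> (\<not> (P e \<longleftrightarrow> C e) \<longleftrightarrow> C e))"
    by (rule pdef_neg[OF pdef_iff[OF _ IH[OF C C_dep]]])
  moreover have "(\<lambda>e. \<not> (\<not> (P e \<longleftrightarrow> C e) \<longleftrightarrow> C e)) = P" by auto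
  ultimately show ?thesis by simp
qed

end

context tame_expansion
begin

lemma pdef_group_of_finite_support:
  assumes "finite S" "pdef M P" "depends S P"
  shows "pdef GS P"
  using assms
proof (induction S arbitrary: P rule: finite_induct)
  case empty
  have "P e = P undefined" for e
    by (rule dependsD[OF empty.prems(2)]) simp
  then have "P = (\<lambda>e. P undefined)" by (rule ext)
  then show ?case using pdef_const[of GS "P undefined"] by (simp only:)
next
  case (insert i S)
  have IH: "pdef GS Q" if "pdef M Q" "depends (insert i S - {i}) Q" for Q
    using insert.IH[OF that(1)] that(2) insert.hyps(2) by simp
  obtain N where N: "0 < N" and W: "\<And>r. \<exists>A L. walls (insert i S) i A L (\<lambda>e. P (e(i := N \<cdot> e i + r)))"
    using fibres_cut[OF qe[OF insert.prems(1)] insert.prems(2)] by blast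
  show ?case
  proof (rule residue_split[OF _ _ insert.prems(2) N])
    show "finite (insert i S)" "i \<in> insert i S" using insert.hyps by simp_all
    fix r
    obtain A L where W: "walls (insert i S) i A L (\<lambda>e. P (e(i := N \<cdot> e i + r)))" using W by blast
    have "cut_fibres eps M (insert i S) i (\<lambda>e. P (e(i := N \<cdot> e i + r))) A L"
    proof
      show "finite (insert i S)" "i \<in> insert i S" using insert.hyps by simp_all
      show "pdef M (\<lambda>e. P (e(i := N \<cdot> e i + r)))" by (rule pdef_residue[OF insert.prems(1)])
      show "depends (insert i S) (\<lambda>e. P (e(i := N \<cdot> e i + r)))"
        by (rule depends_upd_fun[OF insert.prems(2)]) simp
    qed (use W IH in blast)+
    then show "pdef GS (\<lambda>e. P (e(i := N \<cdot> e i + r)))" by (rule cut_fibres.pdef_group)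
  qed
qed

theorem reduct_group: "reduct M GS"
proof (rule reductI_pdef)
  fix P assume P: "pdef M P"
  then obtain m where "depends {..<m} P" using pdef_depends by blast
  with P show "pdef GS P" by (intro pdef_group_of_finite_support[of "{..<m}"]) simp_all
qed

end

section \<open>Stability and the unary condition both give tameness\<close>

text \<open>
  The remaining coordinates become parameters.
\<close>

lemma pdef_fibre:
  assumes "pdef M P"
  shows "pdef M (\<lambda>d. d 0 \<in> {x. P (e(i := x))})"
proof -
  have "pdef M (\<lambda>d. P (\<lambda>j. source d (if j = i then Inr 0 else Inl (e j))))"
    by (rule pdef_subst[OF assms])
  also have "(\<lambda>d. P (\<lambda>j. source d (if j = i then Inr 0 else Inl (e j)))) = (\<lambda>d. P (e(i := d 0)))"
    by (intro ext arg_cong[of _ _ P]) simp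
  finally show ?thesis by simp
qed

context regular_group
begin

text \<open>
  Apart from finitely many exceptions \<open>Z\<close>, membership in a unary set definable in the group depends only on
  the residue class. But if \<open>D\<close> and its complement are infinite, both contain long intervals that avoid
  \<open>Z\<close>, and both intervals contain multiples of \<open>N\<close>.
\<close>

lemma dichotomy_of_unary_group_definable:
  fixes M :: "('f, 'r, 'a) fo_structure"
  assumes unary: "\<forall>D :: 'a set. definable M UNIV 1 ((\<lambda>d. [d]) ` D) \<longrightarrow>
      definable (group_structure :: 'a oag_type) UNIV 1 ((\<lambda>d. [d]) ` D)"
    and D: "pdef M (\<lambda>d. d 0 \<in> D)" and cut: "cut A W D"
  shows "finite D \<or> finite (- D)"
proof (rule ccontr)
  assume "\<not> ?thesis"
  then have inf: "infinite D" "infinite (- D)" by auto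
  have "depends {..<1} (\<lambda>d :: nat \<Rightarrow> 'a. d 0 \<in> D)" by (simp add: depends_def)
  from pdef_imp_definable[OF D this]
  have "definable M UNIV 1 {xs. length xs = 1 \<and> xs ! 0 \<in> D}" .
  moreover have "{xs. length xs = 1 \<and> xs ! 0 \<in> D} = (\<lambda>d. [d]) ` D"
    by (auto simp: length_Suc_conv)
  ultimately have "definable (group_structure :: 'a oag_type) UNIV 1 ((\<lambda>d. [d]) ` D)"
    using unary by simp
  from definable_imp_pdef[OF this]
  have "pdef (group_structure :: 'a oag_type) (\<lambda>d. d 0 \<in> D)"
    by (simp add: image_iff)
  from group_pdef_sigdet[OF this] obtain F N where F: "finite F" "\<forall>f\<in>F. affine f" "0 < N"
    and sig: "\<forall>e e'. (\<forall>f\<in>F. (f e = 0) = (f e' = 0)) \<and> (\<forall>j. \<exists>h. e' j = e j + N \<cdot> h) \<longrightarrow>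
        (e 0 \<in> D) = (e' 0 \<in> D)"
    unfolding sigdet_def sigdet_by_def by (elim exE conjE) (rule that)
  have "\<exists>Z. finite Z \<and> (\<forall>x y. x \<notin> Z \<longrightarrow> y \<notin> Z \<longrightarrow> (f (\<lambda>_. x) = 0) = (f (\<lambda>_. y) = 0))" if "f \<in> F" for f
  proof -
    have "affine (\<lambda>e. f (\<lambda>_. e 0))" 
      using affine_subst[of f "\<lambda>e _. e 0"] F(2) that by (simp add: affine_var)
    from affine_split_case_nat[OF this] obtain a g where
      "affine g \<and> (\<forall>x e. f (\<lambda>_. case_nat x e 0) = a \<cdot> x + g e)"
      by (elim exE) (rule that)
    then have f: "f (\<lambda>_. x) = a \<cdot> x + g (\<lambda>_. 0)" for x by simp
    show ?thesis
    proof (cases "a = 0")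
      case True
      then show ?thesis by (intro exI[of _ "{}"]) (simp add: f)
    next
      case False
      have "x = y" if "f (\<lambda>_. x) = 0" "f (\<lambda>_. y) = 0" for x y
        using that False unfolding f by (metis add_right_cancel int_mult_eq_iff)
      then have "\<exists>x0. {x. f (\<lambda>_. x) = 0} \<subseteq> {x0}" by blast
      then have "finite {x. f (\<lambda>_. x) = 0}" by (metis finite.emptyI finite.insertI finite_subset)
      then show ?thesis by (intro exI[of _ "{x. f (\<lambda>_. x) = 0}"]) simp
    qed
  qed
  then obtain Zf where Zf: "\<And>f. f \<in> F \<Longrightarrow> finite (Zf f)"
      "\<And>f x y. f \<in> F \<Longrightarrow> x \<notin> Zf f \<Longrightarrow> y \<notin> Zf f \<Longrightarrow> (f (\<lambda>_. x) = 0) = (f (\<lambda>_. y) = 0)"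
    by metis
  define Z where "Z = (\<Union>f\<in>F. Zf f)"
  have Z: "finite Z" unfolding Z_def using F(1) Zf(1) by blast
  have hit: "\<exists>g. N \<cdot> g \<in> Y \<and> N \<cdot> g \<notin> Z" if Y: "cut A W Y" "infinite Y" for Y
  proof -
    obtain \<alpha> \<beta> where ab: "\<alpha> + int (nat N) \<cdot> eps < \<beta>" "\<forall>t. \<alpha> < t \<and> t < \<beta> \<longrightarrow> t \<in> Y \<and> t \<notin> Z"
      using long_interval[OF Y Z] by blast
    have "\<exists>g. \<alpha> < 0 + N \<cdot> g \<and> 0 + N \<cdot> g < \<beta>" using ab(1) F(3) by (intro regular) simp_all
    then show ?thesis using ab(2) by auto
  qed
  obtain g where g: "N \<cdot> g \<in> D" "N \<cdot> g \<notin> Z" using hit[OF cut inf(1)] by blast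
  obtain h where h: "N \<cdot> h \<in> - D" "N \<cdot> h \<notin> Z" using hit[OF cut_compl[OF cut] inf(2)] by blast
  have "((\<lambda>_. N \<cdot> g) (0::nat) \<in> D) = ((\<lambda>_. N \<cdot> h) (0::nat) \<in> D)"
  proof (rule sig[rule_format], intro conjI ballI allI)
    show "(f (\<lambda>_. N \<cdot> g) = 0) = (f (\<lambda>_. N \<cdot> h) = 0)" if "f \<in> F" for f
      using Zf(2)[OF that] g(2) h(2) that unfolding Z_def by blast
    show "\<exists>k. N \<cdot> h = N \<cdot> g + N \<cdot> k" for j :: nat
      by (intro exI[of _ "h - g"]) (simp add: zm.scale_right_diff_distrib)
  qed
  with g h show False by simp
qed

text \<open>
  Translates of \<open>D\<close>: the relation \<open>x + y \<in> D\<close> is definable, and a progression \<open>p + s \<delta>\<close> that enters \<open>D\<close> at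
  \<open>s = 1\<close> gives the ladder \<open>x = - i \<delta>\<close>, \<open>y = p + j \<delta>\<close>.
\<close>

lemma dichotomy_of_stable:
  fixes M :: "('f, 'r, 'a) fo_structure"
  assumes stable: "stable M" and plus: "pdef M (\<lambda>e. e 0 + e 1 = e 2)"
    and D: "pdef M (\<lambda>d. d 0 \<in> D)" and cut: "cut A W D"
  shows "finite D \<or> finite (- D)"
proof (rule ccontr)
  assume "\<not> ?thesis"
  then have inf: "infinite D" "infinite (- D)" by auto
  have "pdef M (\<lambda>d. d 0 + d 1 \<in> D)"
    by (rule pdef_subst_affine[OF plus D, of "{0}" "\<lambda>d j. d 0 + d 1"])
       (simp_all add: depends_def affine_add affine_var)
  moreover have "depends {..<2} (\<lambda>d :: nat \<Rightarrow> 'a. d 0 + d 1 \<in> D)" by (simp add: depends_def)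
  ultimately have "definable M UNIV 2 {xs. length xs = 2 \<and> xs ! 0 + xs ! 1 \<in> D}"
    by (rule pdef_imp_definable)
  then obtain \<phi> bs where \<phi>: "wf_form M \<phi>" "fv \<phi> \<subseteq> {..<2 + length bs}"
    and eq: "{xs. length xs = 2 \<and> xs ! 0 + xs ! 1 \<in> D} = {xs. length xs = 2 \<and> sat M ((!) (xs @ bs)) \<phi>}"
    unfolding definable_def by blast
  have sat: "sat M ((!) ([x] @ (y # bs))) \<phi> \<longleftrightarrow> x + y \<in> D" for x y
  proof -
    have "[x, y] \<in> {xs. length xs = 2 \<and> sat M ((!) (xs @ bs)) \<phi>} \<longleftrightarrow>
          [x, y] \<in> {xs. length xs = 2 \<and> xs ! 0 + xs ! 1 \<in> D}" by (simp only: eq)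
    then show ?thesis by simp
  qed
  have "fv \<phi> \<subseteq> {..<1 + Suc (length bs)}" using \<phi>(2) by simp
  then obtain n where n: "\<not> has_ladder M \<phi> 1 (Suc (length bs)) n"
    using stable \<phi>(1) unfolding stable_def by blast
  obtain p \<delta> where p: "\<And>s. \<bar>s\<bar> \<le> int n \<Longrightarrow> p + s \<cdot> \<delta> \<in> D \<longleftrightarrow> 0 < s"
    using progression_splits[OF cut inf] by blast
  have "has_ladder M \<phi> 1 (Suc (length bs)) n"
    unfolding has_ladder_def
  proof (intro exI conjI allI impI)
    show "length [- (int i \<cdot> \<delta>)] = 1" "length ((p + int i \<cdot> \<delta>) # bs) = Suc (length bs)" for i
      by simp_all
    fix i j assume ij: "i < n" "j < n"
    have "- (int i \<cdot> \<delta>) + (p + int j \<cdot> \<delta>) = p + (int j - int i) \<cdot> \<delta>"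
      by (simp add: zm.scale_left_diff_distrib)
    moreover have "p + (int j - int i) \<cdot> \<delta> \<in> D \<longleftrightarrow> i < j"
      using p[of "int j - int i"] ij by simp
    ultimately show "sat M ((!) ([- (int i \<cdot> \<delta>)] @ ((p + int j \<cdot> \<delta>) # bs))) \<phi> \<longleftrightarrow> i < j"
      unfolding sat by (simp only:)
  qed
  with n show False ..
qed

end

section \<open>Interdefinability with the group\<close>

theorem theorem1p5:
  fixes M :: "('f, 'r, 'a::linordered_ab_group_add) fo_structure"
  assumes "archimedean_group TYPE('b::linordered_ab_group_add)"
    and "small_quotients TYPE('b)"
    and "elementarily_equivalent
           (oag_structure :: (oag_fun, oag_rel, 'a) fo_structure)
           (oag_structure :: (oag_fun, oag_rel, 'b) fo_structure)"
    and "reduct M (oag_structure :: (oag_fun, oag_rel, 'a) fo_structure)"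
    and "expands M (group_structure :: (oag_fun, oag_rel, 'a) fo_structure)"
    and "stable M \<or>
         (\<forall>D :: 'a set. definable M UNIV 1 ((\<lambda>d. [d]) ` D) \<longrightarrow>
            definable (group_structure :: (oag_fun, oag_rel, 'a) fo_structure)
              UNIV 1 ((\<lambda>d. [d]) ` D))"
  shows "interdefinable M (group_structure :: (oag_fun, oag_rel, 'a) fo_structure)"
proof -
  have "reduct M (group_structure :: (oag_fun, oag_rel, 'a) fo_structure)"
  proof (cases "\<exists>x::'a. 0 < x")
    \<comment> \<open>the trivial group has only one environment\<close>
    case False
    have zero: "x = 0" for x :: 'a
    proof (rule ccontr)
      assume "x \<noteq> 0"
      then have "0 < x \<or> 0 < - x" by (auto simp: neq_iff)
      with False show False by blast
    qed
    show ?thesis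
    proof (rule reductI_pdef)
      fix P :: "(nat \<Rightarrow> 'a) \<Rightarrow> bool"
      have "e = (\<lambda>_. 0)" for e :: "nat \<Rightarrow> 'a" using zero by blast
      then have "P e = P (\<lambda>_. 0)" for e by (rule arg_cong)
      then have "P = (\<lambda>e. P (\<lambda>_. 0))" by (rule ext)
      moreover have "pdef (group_structure :: (oag_fun, oag_rel, 'a) fo_structure) (\<lambda>e. P (\<lambda>_. 0))"
        by (rule pdef_const)
      ultimately show "pdef (group_structure :: (oag_fun, oag_rel, 'a) fo_structure) P"
        by (simp only:)
    qed
  next
    case True
    then obtain eps :: 'a where "regular_group eps"
      using elementarily_equivalent_regular[OF assms(1-3)] by blast
    then interpret regular_group eps .
    have plus: "pdef M (\<lambda>e. e 0 + e 1 = e 2)"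
      by (rule reduct_pdef[OF assms(5) group_structure_plus])
    interpret tame_expansion eps M
    proof
      show "pdef M (\<lambda>e. e 0 + e 1 = e 2)" by (rule plus)
      show "sigdet sgn3 P" if "pdef M P" for P
        by (rule oag_pdef_sigdet[OF reduct_pdef[OF assms(4) that]])
      show "finite {x. P (e(i := x))} \<or> finite (- {x. P (e(i := x))})"
        if "pdef M P" "cut A W {x. P (e(i := x))}" for P A W e i
        using assms(6) dichotomy_of_stable[OF _ plus pdef_fibre[OF that(1)] that(2)]
          dichotomy_of_unary_group_definable[OF _ pdef_fibre[OF that(1)] that(2)] by blast
    qed
    show ?thesis by (rule reduct_group)
  qed
  with assms(5) show ?thesis by (simp add: interdefinable_def)
qed

end
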